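(* Let $a>0$ and let $f_1,f_2\in L^1(\mathbb{R}^2)$ be functions supported in $\mathbb{B}^2_{a/2}$. Let $m\in\mathbb{Z}$ and let $n\ge |m|$ be an integer with $n-|m|$ even. Then the Fourier-Zernike coefficient $C_{n,m}^a(f_1\ast f_2)$ of $f_1\ast f_2$ is given by $$C_{n,m}^a(f_1\ast f_2)=\sum_{\mathbf{k}\in\mathbb{Z}^2}c_a(\mathbf{k};n,m)\,\widehat{f_1}(\mathbf{k})\,\widehat{f_2}(\mathbf{k}),$$ where for $j\in\{1,2\}$ and $\mathbf{k}=(k_1,k_2)^T\in\mathbb{Z}^2$ $$\widehat{f_j}(\mathbf{k}):=\int_{-a}^a\int_{-a}^af_j(x_1,x_2)e^{-\pi \mathrm{i} a^{-1}(k_1x_1+k_2x_2)}\,dx_1dx_2,$$ $$c_a(\mathbf{k};n,m):=\sqrt{n+1}\,\frac{\mathrm{i}^m(-1)^{\frac{n-m}{2}}J_{n+1}(\pi|\mathbf{k}|)}{2a\sqrt{\pi}\,|\mathbf{k}|}\,e^{-\mathrm{i} m\Phi(\mathbf{k})}.$$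
   Context: $\mathbb{B}_a^2=\{\mathbf{x}\in\mathbb{R}^2:\|\mathbf{x}\|_2\le a\}$. Convolution is $f_1\ast f_2(\mathbf{x})=\int_{\mathbb{R}^2}f_1(\mathbf{y})f_2(\mathbf{x}-\mathbf{y})\,d\mathbf{y}$; here $f_1\ast f_2$ is supported in $\mathbb{B}_a^2$. $J_q$ is the Bessel function of the first kind of integer order $q$. For $m\in\mathbb{Z}$ and an integer $n\ge|m|$ with $n-|m|$ even, the radial Zernike polynomial is $$Z_{nm}(r)=\sum_{j=0}^{\frac{n-|m|}{2}}(-1)^j\frac{(n-j)!}{j!\,(\frac{n+|m|}{2}-j)!\,(\frac{n-|m|}{2}-j)!}r^{n-2j},$$ and the Fourier-Zernike basis element of radius $a$ is, in polar coordinates, $V_{nm}^a(r,\theta)=a^{-1}\sqrt{\frac{n+1}{\pi}}\,Z_{nm}(a^{-1}r)\,e^{\mathrm{i} m\theta}$. The Fourier-Zernike coefficient of a function $f$ on $\mathbb{B}_a^2$ is $C_{n,m}^a(f)=\int_0^a\int_0^{2\pi}f(r,\theta)\overline{V_{nm}^a(r,\theta)}\,r\,d\theta\,dr$, where $f(r,\theta)$ denotes $f$ in polar coordinates. For $\mathbf{k}=(k_1,k_2)^T\in\mathbb{Z}^2$, $|\mathbf{k}|=\sqrt{k_1^2+k_2^2}$ and $\Phi(\mathbf{k})\in[0,2\pi)$ is the polar angle: $k_1=|\mathbf{k}|\cos\Phi(\mathbf{k})$, $k_2=|\mathbf{k}|\sin\Phi(\mathbf{k})$, with $\Phi(\mathbf{0})=0$.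 At $\mathbf{k}=\mathbf{0}$ the quotient $J_{n+1}(\pi|\mathbf{k}|)/|\mathbf{k}|$ is understood as its limit as $|\mathbf{k}|\to0$ (that is, $\pi/2$ if $n=0$, and $0$ if $n\ge1$). *)

theory Defs
  imports "HOL-Analysis.Analysis"
begin

text \<open>
  The plane is the type \<^typ>\<open>real \<times> real\<close>, whose norm is the Euclidean one. All integrals are
  Bochner integrals with respect to (the completion of) Lebesgue measure; in iterated integrals the
  completed measure matters, since a slice of a Lebesgue measurable function need not be Borel.
\<close>

definition conv2 :: "(real \<times> real \<Rightarrow> complex) \<Rightarrow> (real \<times> real \<Rightarrow> complex) \<Rightarrow> real \<times> real \<Rightarrow> complex"
  where "conv2 f g x = (LINT y|lebesgue. f y * g (x - y))"

text \<open>
  The power series of \<open>J\<^sub>q\<close>. For \<open>q < 0\<close> the terms with \<open>j < -q\<close> vanish because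
  \<^const>\<open>rGamma\<close> is zero at the non-positive integers.
\<close>
definition bessel_J :: "int \<Rightarrow> real \<Rightarrow> real"
  where "bessel_J q z =
    (\<Sum>j. (- 1) ^ j / fact j * rGamma (of_int q + of_nat j + 1) * (z / 2) powi (q + 2 * int j))"

text \<open>The differences and quotients of naturals are exact when \<open>\<bar>m\<bar> \<le> n\<close> and \<open>n - \<bar>m\<bar>\<close> is even.\<close>
definition zernike_radial :: "nat \<Rightarrow> int \<Rightarrow> real \<Rightarrow> real"
  where "zernike_radial n m r =
    (let l = nat \<bar>m\<bar> in
      \<Sum>j = 0..(n - l) div 2.
        (- 1) ^ j * (fact (n - j) / (fact j * fact ((n + l) div 2 - j) * fact ((n - l) div 2 - j)))
          * r ^ (n - 2 * j))"

definition fourier_zernike :: "real \<Rightarrow> nat \<Rightarrow> int \<Rightarrow> real \<Rightarrow> real \<Rightarrow> complex"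
  where "fourier_zernike a n m r \<theta> =
    of_real (1 / a * sqrt ((real n + 1) / pi) * zernike_radial n m (r / a))
      * exp (\<i> * of_int m * of_real \<theta>)"

definition fz_coeff :: "real \<Rightarrow> nat \<Rightarrow> int \<Rightarrow> (real \<times> real \<Rightarrow> complex) \<Rightarrow> complex"
  where "fz_coeff a n m f =
    (LINT r:{0..a}|lebesgue. LINT \<theta>:{0..2 * pi}|lebesgue.
      f (r * cos \<theta>, r * sin \<theta>) * cnj (fourier_zernike a n m r \<theta>) * of_real r)"

definition fourier_hat :: "real \<Rightarrow> (real \<times> real \<Rightarrow> complex) \<Rightarrow> int \<times> int \<Rightarrow> complex"
  where "fourier_hat a f k =
    (LINT x2:{-a..a}|lebesgue. LINT x1:{-a..a}|lebesgue.
      f (x1, x2) * exp (- (of_real pi * \<i> * of_real (1 / a)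
        * of_real (of_int (fst k) * x1 + of_int (snd k) * x2))))"

definition lattice_abs :: "int \<times> int \<Rightarrow> real"
  where "lattice_abs k = sqrt ((of_int (fst k))\<^sup>2 + (of_int (snd k))\<^sup>2)"

text \<open>\<^const>\<open>Arg2pi\<close> takes values in \<open>[0, 2\<pi>)\<close> and is \<open>0\<close> at the origin.\<close>
definition lattice_angle :: "int \<times> int \<Rightarrow> real"
  where "lattice_angle k = Arg2pi (Complex (of_int (fst k)) (of_int (snd k)))"

definition bessel_quotient :: "nat \<Rightarrow> int \<times> int \<Rightarrow> real"
  where "bessel_quotient n k =
    (if k = (0, 0) then Lim (at_right 0) (\<lambda>t. bessel_J (int n + 1) (pi * t) / t)
     else bessel_J (int n + 1) (pi * lattice_abs k) / lattice_abs k)"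

definition conv_coeff :: "real \<Rightarrow> int \<times> int \<Rightarrow> nat \<Rightarrow> int \<Rightarrow> complex"
  where "conv_coeff a k n m =
    of_real (sqrt (real n + 1))
      * (\<i> powi m * (- 1) powi ((int n - m) div 2) * of_real (bessel_quotient n k)
          / of_real (2 * a * sqrt pi))
      * exp (- (\<i> * of_int m * of_real (lattice_angle k)))"

text \<open>
  Convergence of a double series over \<open>\<int>\<^sup>2\<close>: the symmetric rectangular partial sums over
  \<open>\<bar>k\<^sub>1\<bar> \<le> M\<close>, \<open>\<bar>k\<^sub>2\<bar> \<le> N\<close> converge as \<open>M\<close> and \<open>N\<close> tend to infinity independently (so in particular
  the square partial sums converge). \<^const>\<open>has_sum\<close> would be too strong for Fourier
  series of \<open>L\<^sup>1\<close> functions, as it means absolute convergence here.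
\<close>
definition lattice_sums :: "(int \<times> int \<Rightarrow> complex) \<Rightarrow> complex \<Rightarrow> bool"
  where "lattice_sums u s \<longleftrightarrow>
    ((\<lambda>(M, N). \<Sum>k\<in>{- int M..int M} \<times> {- int N..int N}. u k) \<longlongrightarrow> s) (sequentially \<times>\<^sub>F sequentially)"

end

theory Submission
  imports Defs "HOL-Probability.Probability"
begin

text \<open>The numbers \<open>4 a\<^sup>2 c\<^sub>a(k)\<close> are the integrals of \<open>W e\<^sub>k\<close> over the disc, where \<open>W\<close> is the conjugate basis
  element, a polynomial in the Cartesian coordinates, and \<open>e\<^sub>k\<close> is a character of period \<open>2 a\<close>: expand
  the character along rays and compare the moments of the Zernike polynomial, obtained from a partial
  fraction decomposition, with the Bessel series. Since the transform of a convolution is a product, the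
  rectangular partial sums of the series are the integrals of \<open>f\<^sub>1 * f\<^sub>2\<close> against the partial Fourier sums of
  \<open>W\<close> cut off to the disc, and it suffices that these partial sums converge weakly to \<open>W\<close> against \<open>L\<^sup>1\<close>.
  Against boxes inside the disc this is the one-dimensional Dirichlet-Jordan theorem, so the point is a
  bound on the disc, uniform in both truncation parameters.

  At a point of the disc one coordinate, say the first, is at distance at least a quarter of the radius
  from the ends of its range, where the half chord \<open>h\<close> in the second direction is smooth and strictly
  concave. The Dirichlet kernel in the second variable is split into the Fejer kernel and \<open>2 / (N + 1)\<close> times
  the sum of the terms \<open>k cos (k t)\<close>. The Fejer kernel is nonnegative, so its integral over the
  chord is monotone in \<open>h\<close>. The other terms reduce, by parts, to partial Fourier sums of \<open>sin (k h)\<close>; these are bounded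
  by van der Corput's second derivative estimate at distance at least of order \<open>1 / sqrt k\<close>
  from the centre of the kernel and by linearising the phase nearer to it.\<close>

section \<open>Dirichlet and Fejer kernels\<close>

text \<open>What shapes the proof is that the convolution is merely integrable while the conjugate
  basis element, cut off at the circle, jumps along a curve. Convergence against every
  \<open>L1\<close> function then calls for partial sums bounded in the sup norm on the disc, and
  absolute values lose logarithms, because the \<open>L1\<close> norms of Dirichlet kernels are
  unbounded. The Fejer splitting keeps the cancellation: the weight \<open>k\<close> is what one
  integration by parts in the second variable consumes, so each harmonic contributes a bounded
  amount and the factor \<open>2 / (N + 1)\<close> averages \<open>N\<close> of them. The distance
  \<open>1 / sqrt k\<close> balances two estimates for one harmonic: beyond it the van der Corput
  gain \<open>1 / sqrt k\<close> pays for a kernel of size up to \<open>sqrt k\<close>; inside it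
  the quadratic error \<open>k t^2\<close> of the linearised phase, against a kernel of size
  \<open>1 / t\<close>, integrates to a constant. The disc touches the sides of the period square,
  so a coordinate near the end of its range would meet the next peak of the periodic kernel as well
  as the vertical tangents of the half chord; choosing the better coordinate avoids both.\<close>

lemma sin_ge_chord: fixes x :: real
  assumes "0 \<le> x" "x \<le> pi / 2" shows "2 * x / pi \<le> sin x"
proof -
  have c: "concave_on {0..pi} sin"
    by (rule f''_le0_imp_concave[where f' = cos and f'' = "\<lambda>x. - sin x"])
      (auto intro!: derivative_eq_intros sin_ge_zero)
  define t where "t = 2 * x / pi"
  have t: "0 \<le> t" "t \<le> 1" "x = (1 - t) *\<^sub>R 0 + t *\<^sub>R (pi / 2)" using assms by (auto simp: t_def field_simps)
  have "sin ((1 - t) *\<^sub>R 0 + t *\<^sub>R (pi / 2)) \<ge> (1 - t) * sin 0 + t * sin (pi / 2)"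
    using t by (intro concave_onD[OF c]) auto
  then show ?thesis unfolding t(3)[symmetric] by (simp add: t_def)
qed

text \<open>Bonnet's form of the second mean value theorem. Writing
  \<open>g a = (g a - g b) + g b\<close> and replacing the tail integral by the full one minus the
  head leaves only integrals that start at \<open>a\<close>, with nonnegative weights adding up to
  \<open>g a\<close>.\<close>

lemma integral_antimono_mult_bound:
  fixes f g :: "real \<Rightarrow> real"
  assumes f: "f integrable_on {a..b}" and "a \<le> b"
    and g: "\<And>x y. a \<le> x \<Longrightarrow> x \<le> y \<Longrightarrow> y \<le> b \<Longrightarrow> g y \<le> g x"
    and nonneg: "0 \<le> g b"
    and A: "\<And>c. a \<le> c \<Longrightarrow> c \<le> b \<Longrightarrow> \<bar>integral {a..c} f\<bar> \<le> A"
  shows "\<bar>integral {a..b} (\<lambda>x. g x * f x)\<bar> \<le> g a * A"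
proof -
  obtain c where c: "c \<in> {a..b}"
    and I: "integral {a..b} (\<lambda>x. - g x * f x) = - g a * integral {a..c} f + - g b * integral {c..b} f"
  proof (rule second_mean_value_theorem[OF f \<open>a \<le> b\<close>, of "\<lambda>x. - g x"])
    show "- g x \<le> - g y" if "a \<le> x" "x \<le> y" "y \<le> b" for x y using g that by simp
  qed
  have split: "integral {a..c} f + integral {c..b} f = integral {a..b} f"
    using c f by (intro Henstock_Kurzweil_Integration.integral_combine) auto
  have "integral {a..b} (\<lambda>x. g x * f x) = g a * integral {a..c} f + g b * integral {c..b} f"
    using I by simp
  then have "integral {a..b} (\<lambda>x. g x * f x)
      = (g a - g b) * integral {a..c} f + g b * integral {a..b} f"
    by (simp only: split[symmetric] ring_distribs)
  then have "\<bar>integral {a..b} (\<lambda>x. g x * f x)\<bar>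
      \<le> (g a - g b) * \<bar>integral {a..c} f\<bar> + g b * \<bar>integral {a..b} f\<bar>"
    using g[of a b] \<open>a \<le> b\<close> nonneg
      abs_triangle_ineq[of "(g a - g b) * integral {a..c} f" "g b * integral {a..b} f"]
    by (simp add: abs_mult)
  also have "\<dots> \<le> (g a - g b) * A + g b * A"
    using g[of a b] \<open>a \<le> b\<close> nonneg c by (intro add_mono mult_left_mono A) auto
  finally show ?thesis by (simp add: algebra_simps)
qed

text \<open>The counterpart for an increasing factor of any sign. Both the head and the tail at the
  mean value point are estimated, hence the bound \<open>A\<close> over all subintervals and the
  factor 2.\<close>

lemma integral_mono_mult_bound:
  fixes f g :: "real \<Rightarrow> real"
  assumes f: "f integrable_on {a..b}" and "a \<le> b"
    and g: "\<And>x y. a \<le> x \<Longrightarrow> x \<le> y \<Longrightarrow> y \<le> b \<Longrightarrow> g x \<le> g y"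
    and L: "\<bar>g a\<bar> \<le> L" "\<bar>g b\<bar> \<le> L"
    and A: "\<And>c d. a \<le> c \<Longrightarrow> c \<le> d \<Longrightarrow> d \<le> b \<Longrightarrow> \<bar>integral {c..d} f\<bar> \<le> A"
  shows "\<bar>integral {a..b} (\<lambda>x. g x * f x)\<bar> \<le> 2 * L * A"
proof -
  obtain c where c: "c \<in> {a..b}"
    and I: "integral {a..b} (\<lambda>x. g x * f x) = g a * integral {a..c} f + g b * integral {c..b} f"
    by (rule second_mean_value_theorem[OF f \<open>a \<le> b\<close> g])
  have "\<bar>g a * integral {a..c} f + g b * integral {c..b} f\<bar>
      \<le> \<bar>g a\<bar> * \<bar>integral {a..c} f\<bar> + \<bar>g b\<bar> * \<bar>integral {c..b} f\<bar>"
    using abs_triangle_ineq[of "g a * integral {a..c} f" "g b * integral {c..b} f"] by (simp add: abs_mult)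
  also have "\<dots> \<le> L * A + L * A"
    using c L abs_ge_zero[of "g a"] by (intro add_mono mult_mono A) (auto intro: order_trans)
  finally show ?thesis using I by (simp add: mult.commute)
qed

lemma integral_sin_scale:
  fixes n :: real assumes "n \<noteq> 0" "u \<le> v"
  shows "((\<lambda>t. sin (n * t)) has_integral (cos (n * u) - cos (n * v)) / n) {u..v}"
proof -
  have "((\<lambda>t. sin (n * t)) has_integral (- cos (n * v) / n - (- cos (n * u) / n))) {u..v}"
    using assms by (intro fundamental_theorem_of_calculus)
      (auto intro!: derivative_eq_intros simp: has_real_derivative_iff_has_vector_derivative[symmetric])
  then show ?thesis by (simp add: diff_divide_distrib)
qed

text \<open>The quotient \<open>sin (n t) / sin (t / 2)\<close>, with the removable singularity at 0
  filled in by writing both sines through \<open>sinc\<close>. The frequency \<open>n\<close> is a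
  real number because later it is shifted by the slope of a phase, which is arbitrary.\<close>

definition sine_kernel :: "real \<Rightarrow> real \<Rightarrow> real"
  where "sine_kernel n t = 2 * n * sinc (n * t) / sinc (t / 2)"

lemma sine_kernel_eq: "t \<noteq> 0 \<Longrightarrow> sine_kernel n t = sin (n * t) / sin (t / 2)"
  by (auto simp: sine_kernel_def)

lemma sinc_half_ge: assumes "0 \<le> t" "t \<le> pi" shows "sinc (t / 2) \<ge> 2 / pi"
proof (cases "t = 0")
  case False
  then show ?thesis using sin_ge_chord[of "t/2"] assms by (auto simp: field_simps)
qed (use pi_ge_two in auto)

lemma continuous_sine_kernel: assumes "0 \<le> u" "v \<le> pi" shows "continuous_on {u..v} (sine_kernel n)"
proof -
  have "sinc (t / 2) \<noteq> 0" if "t \<in> {u..v}" for t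
  proof -
    have "0 < 2 / pi" by simp
    also have "2/pi \<le> sinc (t/2)" using that assms by (intro sinc_half_ge) auto
    finally show ?thesis by linarith
  qed
  then show ?thesis unfolding sine_kernel_def[abs_def]
    by (intro continuous_intros) auto
qed

text \<open>The bound does not depend on \<open>n\<close>, whereas the integral of the absolute
  value grows like \<open>log n\<close>. Up to \<open>1 / n\<close> the integrand is at most
  \<open>n pi\<close>, which gives \<open>pi\<close>. Beyond, \<open>1 / sin (t / 2)\<close>
  decreases from at most \<open>n pi\<close>, and integrals of \<open>sin (n t)\<close> are at most
  \<open>2 / n\<close>, which gives \<open>2 pi\<close>.\<close>

lemma integral_sine_kernel_bound_pos:
  assumes "0 < n" "0 \<le> v" "v \<le> pi"
  shows "\<bar>integral {0..v} (sine_kernel n)\<bar> \<le> 3 * pi"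
proof -
  define w where "w = min v (1 / n)"
  have w: "0 \<le> w" "w \<le> v" "w \<le> 1 / n" using assms by (auto simp: w_def)
  have int: "sine_kernel n integrable_on {0..v}"
    using assms by (intro integrable_continuous_real continuous_sine_kernel) auto
  have b: "norm (sine_kernel n t) \<le> n * pi" if "t \<in> {0..w}" for t
  proof -
    have *: "norm (2 * n * A / B) \<le> n * pi" if "\<bar>A\<bar> \<le> 1" "B \<ge> 2 / pi" for A B
    proof -
      have "0 < 2 / pi" by simp
      then have B: "0 < B" using that by linarith
      have "\<bar>A\<bar> / B \<le> 1 / (2/pi)"
        using that by (intro frac_le) auto
      then have "2 * n * (\<bar>A\<bar> / B) \<le> 2 * n * (1 / (2/pi))"
        using \<open>0 < n\<close> by (intro mult_left_mono) auto
      then show ?thesis using B \<open>0 < n\<close> by (simp add: abs_mult)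
    qed
    have 1: "\<bar>sinc (n * t)\<bar> \<le> 1" using abs_sin_x_le_abs_x[of "n*t"] by (auto simp: field_simps)
    have 2: "sinc (t/2) \<ge> 2/pi" using that w assms by (intro sinc_half_ge) auto
    show ?thesis unfolding sine_kernel_def by (rule *[OF 1 2])
  qed
  have "norm (integral {0..w} (sine_kernel n)) \<le> (n * pi) * (w - 0)"
    using w assms by (intro integral_bound b continuous_sine_kernel) auto
  also have "\<dots> \<le> pi" using w assms by (simp add: field_simps)
  finally have 1: "\<bar>integral {0..w} (sine_kernel n)\<bar> \<le> pi" by simp
  have 2: "\<bar>integral {w..v} (sine_kernel n)\<bar> \<le> 2 * pi"
  proof (cases "w = v")
    case False
    then have wn: "w = 1 / n" "0 < w" using assms by (auto simp: w_def min_def split: if_splits)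
    have s: "0 < sin (x/2)" if "w \<le> x" "x \<le> v" for x
    proof (rule sin_gt_zero)
      show "0 < x/2" using that wn by linarith
      show "x / 2 < pi" using that assms pi_gt_zero by linarith
    qed
    have "integral {w..v} (sine_kernel n) = integral {w..v} (\<lambda>t. (1 / sin (t/2)) * sin (n * t))"
      using wn(2) by (intro integral_cong) (simp add: sine_kernel_eq)
    also have "\<bar>\<dots>\<bar> \<le> (1 / sin (w/2)) * (2 / n)"
    proof (rule integral_antimono_mult_bound)
      show "(\<lambda>t. sin (n * t)) integrable_on {w..v}"
        by (intro integrable_continuous_real continuous_intros)
      show "1 / sin (y / 2) \<le> 1 / sin (x / 2)" if "w \<le> x" "x \<le> y" "y \<le> v" for x y
        using that assms wn s[of x] s[of y]
        by (intro frac_le sin_monotone_2pi_le) linarith+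
      show "0 \<le> 1 / sin (v/2)" using s[of v] w by auto
      show "\<bar>integral {w..c} (\<lambda>t. sin (n * t))\<bar> \<le> 2 / n" if "w \<le> c" "c \<le> v" for c
      proof -
        have "integral {w..c} (\<lambda>t. sin (n * t)) = (cos (n * w) - cos (n * c)) / n"
          using integral_sin_scale[of n w c] that assms by (auto simp: integral_unique)
        moreover have "\<bar>cos (n * w) - cos (n * c)\<bar> \<le> 2"
          using abs_cos_le_one[of "n*w"] abs_cos_le_one[of "n*c"] by linarith
        ultimately show ?thesis using assms by (simp add: abs_divide divide_right_mono)
      qed
    qed (use w in auto)
    also have "\<dots> \<le> (1 / (w / pi)) * (2 / n)"
    proof -
      have "2 * (w/2) / pi \<le> sin (w/2)" using wn assms w by (intro sin_ge_chord) auto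
      then show ?thesis using wn assms by (intro mult_right_mono frac_le) auto
    qed
    also have "\<dots> = 2 * pi" using wn assms by (simp add: field_simps)
    finally show ?thesis .
  qed (use pi_ge_zero in auto)
  have "integral {0..v} (sine_kernel n) = integral {0..w} (sine_kernel n) + integral {w..v} (sine_kernel n)"
    using w int by (intro Henstock_Kurzweil_Integration.integral_combine[symmetric]) auto
  then show ?thesis using 1 2 by linarith
qed

lemma sine_kernel_minus: "sine_kernel (- n) t = - sine_kernel n t"
  by (auto simp: sine_kernel_def)

lemma integral_sine_kernel_bound:
  assumes "0 \<le> v" "v \<le> pi"
  shows "\<bar>integral {0..v} (sine_kernel n)\<bar> \<le> 3 * pi"
proof -
  consider "n > 0" | "n = 0" | "n < 0" by linarith
  then show ?thesis
  proof cases
    case 3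
    then have "\<bar>integral {0..v} (sine_kernel (- n))\<bar> \<le> 3 * pi"
      using assms by (intro integral_sine_kernel_bound_pos) auto
    moreover have "sine_kernel (- n) = (\<lambda>t. - sine_kernel n t)" by (simp add: fun_eq_iff sine_kernel_minus)
    ultimately show ?thesis by simp
  next
    case 2
    then have "sine_kernel n = (\<lambda>_. 0)" by (auto simp: sine_kernel_def)
    then show ?thesis by simp
  qed (use integral_sine_kernel_bound_pos assms in auto)
qed

definition dirichlet_kernel :: "nat \<Rightarrow> real \<Rightarrow> real"
  where "dirichlet_kernel M t = 1 + 2 * (\<Sum>k\<in>{1..M}. cos (real k * t))"

lemma sin_half_dirichlet: "sin (t / 2) * dirichlet_kernel M t = sin ((real M + 1 / 2) * t)"
proof (induction M)
  case (Suc M)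
  have "sin (t/2) * dirichlet_kernel (Suc M) t = sin ((real M + 1/2) * t) + 2 * sin (t/2) * cos (real (Suc M) * t)"
    using Suc by (simp add: dirichlet_kernel_def algebra_simps)
  also have "2 * sin (t/2) * cos (real (Suc M) * t) = sin (t/2 + real (Suc M) * t) + sin (t/2 - real (Suc M) * t)"
    by (simp add: sin_add sin_diff)
  also have "t/2 - real (Suc M) * t = - ((real M + 1/2) * t)" by (simp add: algebra_simps)
  also have "t/2 + real (Suc M) * t = (real (Suc M) + 1/2) * t" by (simp add: algebra_simps)
  finally show ?case by (simp only: sin_minus)
qed (simp add: dirichlet_kernel_def)

lemma continuous_dirichlet [continuous_intros]:
  fixes f :: "'a :: t2_space \<Rightarrow> real" shows "continuous_on S f \<Longrightarrow> continuous_on S (\<lambda>x. dirichlet_kernel M (f x))"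
  unfolding dirichlet_kernel_def
  by (intro continuous_intros)

lemma dirichlet_minus: "dirichlet_kernel M (- t) = dirichlet_kernel M t"
  by (simp add: dirichlet_kernel_def)

text \<open>Modulation by \<open>cos (n t)\<close> only moves the frequency \<open>M + 1/2\<close>
  to \<open>M + 1/2 + n\<close> and \<open>M + 1/2 - n\<close>. Since the bound on the sine kernel
  is the same for all real frequencies, a modulated Dirichlet kernel has integrals as small as the
  plain one.\<close>

lemma dirichlet_mult_cos:
  assumes "0 \<le> t" "t \<le> pi"
  shows "dirichlet_kernel M t * cos (n * t)
    = (sine_kernel (real M + 1/2 + n) t + sine_kernel (real M + 1/2 - n) t) / 2"
proof (cases "t = 0")
  case False
  have s: "sin (t/2) > 0" using assms False by (intro sin_gt_zero) auto
  have "sin (t/2) * (dirichlet_kernel M t * cos (n*t)) = sin ((real M + 1/2) * t) * cos (n * t)"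
    using sin_half_dirichlet[of t M] by (metis mult.assoc)
  also have "\<dots> = (sin ((real M + 1/2 + n) * t) + sin ((real M + 1/2 - n) * t)) / 2"
    unfolding sin_times_cos by (simp only: ring_distribs)
  finally show ?thesis using s False by (simp add: sine_kernel_eq field_simps)
qed (simp add: dirichlet_kernel_def sine_kernel_def)

lemma integral_dirichlet_cos_bound:
  assumes "0 \<le> v" "v \<le> pi"
  shows "\<bar>integral {0..v} (\<lambda>t. dirichlet_kernel M t * cos (n * t))\<bar> \<le> 3 * pi"
proof -
  let ?a = "real M + 1/2 + n" and ?b = "real M + 1/2 - n"
  have int: "sine_kernel m integrable_on {0..v}" for m
    using assms by (intro integrable_continuous_real continuous_sine_kernel) auto
  have "integral {0..v} (\<lambda>t. dirichlet_kernel M t * cos (n * t))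
    = integral {0..v} (\<lambda>t. (sine_kernel ?a t + sine_kernel ?b t) / 2)"
    using assms by (intro integral_cong dirichlet_mult_cos) auto
  also have "\<dots> = (integral {0..v} (sine_kernel ?a) + integral {0..v} (sine_kernel ?b)) / 2"
    using int by (simp add: Henstock_Kurzweil_Integration.integral_add)
  finally have "integral {0..v} (\<lambda>t. dirichlet_kernel M t * cos (n * t))
    = (integral {0..v} (sine_kernel ?a) + integral {0..v} (sine_kernel ?b)) / 2" .
  moreover have "\<bar>(A + B) / 2\<bar> \<le> 3 * pi" if "\<bar>A\<bar> \<le> 3 * pi" "\<bar>B\<bar> \<le> 3 * pi" for A B
    using that unfolding abs_le_iff by (simp add: field_simps)
  ultimately show ?thesis
    using integral_sine_kernel_bound[OF assms, of ?a] integral_sine_kernel_bound[OF assms, of ?b]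
    by presburger
qed

section \<open>Van der Corput's second derivative estimate\<close>

text \<open>Since \<open>p'\<close> starts nonnegative and grows at rate at least \<open>r\<close>,
  the stretch where \<open>p' < sqrt r\<close> lies within \<open>1 / sqrt r\<close> of
  \<open>u\<close> and is estimated by its length. Beyond it \<open>1 / p'\<close> is a decreasing
  weight, at most \<open>1 / sqrt r\<close>, on the derivative of \<open>sin (p t)\<close>.\<close>

lemma integral_cos_phase_bound_nonneg:
  fixes p p' p'' :: "real \<Rightarrow> real"
  assumes p: "\<And>t. u \<le> t \<Longrightarrow> t \<le> v \<Longrightarrow> (p has_real_derivative p' t) (at t)"
    and p': "\<And>t. u \<le> t \<Longrightarrow> t \<le> v \<Longrightarrow> (p' has_real_derivative p'' t) (at t)"
    and p'': "\<And>t. u \<le> t \<Longrightarrow> t \<le> v \<Longrightarrow> r \<le> p'' t"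
    and "0 < r" "u \<le> v" "0 \<le> p' u"
  shows "\<bar>integral {u..v} (\<lambda>t. cos (p t))\<bar> \<le> 3 / sqrt r"
proof -
  have contp: "continuous_on {u..v} p"
    by (intro DERIV_atLeastAtMost_imp_continuous_on) (use p in auto)
  have contp': "continuous_on {u..v} p'"
    by (intro DERIV_atLeastAtMost_imp_continuous_on) (use p' in auto)
  have cont: "continuous_on {u..v} (\<lambda>t. cos (p t))" using contp by (intro continuous_intros)
  have inc: "p' t - p' s \<ge> r * (t - s)" if "u \<le> s" "s \<le> t" "t \<le> v" for s t
  proof (cases "s = t")
    case False
    then have "\<exists>z>s. z < t \<and> p' t - p' s = (t - s) * p'' z"
      by (intro MVT2 p') (use that in auto)
    then obtain z where "s < z" "z < t" "p' t - p' s = (t - s) * p'' z" by blast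
    then show ?thesis using p''[of z] that False by (simp add: mult.commute mult_left_mono)
  qed simp
  define w where "w = min v (u + 1 / sqrt r)"
  have w: "u \<le> w" "w \<le> v" "w \<le> u + 1 / sqrt r" using assms by (auto simp: w_def)
  have "norm (integral {u..w} (\<lambda>t. cos (p t))) \<le> 1 * (w - u)"
    using w by (intro integral_bound continuous_on_subset[OF cont]) auto
  then have 1: "\<bar>integral {u..w} (\<lambda>t. cos (p t))\<bar> \<le> 1 / sqrt r" using w by auto
  have 2: "\<bar>integral {w..v} (\<lambda>t. cos (p t))\<bar> \<le> 2 / sqrt r"
  proof (cases "w = v")
    case False
    then have wu: "w = u + 1 / sqrt r" by (auto simp: w_def min_def split: if_splits)
    have ge: "sqrt r \<le> p' t" if "w \<le> t" "t \<le> v" for t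
    proof -
      have "sqrt r = r * (1 / sqrt r)" using \<open>0 < r\<close> by (simp add: real_div_sqrt)
      also have "\<dots> \<le> r * (t - u)" using that wu \<open>0 < r\<close> by (intro mult_left_mono) auto
      also have "\<dots> \<le> p' t - p' u" using inc[of u t] that w by auto
      finally show ?thesis using assms by linarith
    qed
    have sq: "0 < sqrt r" using \<open>0 < r\<close> by simp
    have "integral {w..v} (\<lambda>t. cos (p t)) = integral {w..v} (\<lambda>t. (1 / p' t) * (cos (p t) * p' t))"
      using ge sq by (intro integral_cong) force
    also have "\<bar>\<dots>\<bar> \<le> (1 / p' w) * 2"
    proof (rule integral_antimono_mult_bound)
      show "(\<lambda>t. cos (p t) * p' t) integrable_on {w..v}"
        using w by (intro integrable_continuous_real continuous_intros
            continuous_on_subset[OF contp] continuous_on_subset[OF contp']) auto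
      show "1 / p' y \<le> 1 / p' x" if "w \<le> x" "x \<le> y" "y \<le> v" for x y
      proof (rule frac_le)
        have "0 \<le> r * (y - x)" using that \<open>0 < r\<close> by simp
        then show "p' x \<le> p' y" using inc[of x y] that w by linarith
        show "0 < p' x" using ge[of x] that sq by linarith
      qed auto
      have "0 < p' v" using ge[of v] sq w by linarith
      then show "0 \<le> 1 / p' v" by simp
      show "\<bar>integral {w..c} (\<lambda>t. cos (p t) * p' t)\<bar> \<le> 2" if "w \<le> c" "c \<le> v" for c
      proof -
        have "((\<lambda>t. cos (p t) * p' t) has_integral (sin (p c) - sin (p w))) {w..c}"
          using that w by (intro fundamental_theorem_of_calculus)
            (auto intro!: derivative_eq_intros has_field_derivative_at_within[OF p]
              simp: has_real_derivative_iff_has_vector_derivative[symmetric])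
        then have "integral {w..c} (\<lambda>t. cos (p t) * p' t) = sin (p c) - sin (p w)"
          by (rule integral_unique)
        then show ?thesis using abs_sin_le_one[of "p c"] abs_sin_le_one[of "p w"] by linarith
      qed
    qed (use w in auto)
    also have "\<dots> \<le> 2 / sqrt r" using ge[of w] w sq by (simp add: frac_le)
    finally show ?thesis .
  qed (use \<open>0 < r\<close> in auto)
  have "integral {u..v} (\<lambda>t. cos (p t)) = integral {u..w} (\<lambda>t. cos (p t)) + integral {w..v} (\<lambda>t. cos (p t))"
    using w integrable_continuous_real[OF cont]
    by (intro Henstock_Kurzweil_Integration.integral_combine[symmetric]) auto
  then have "\<bar>integral {u..v} (\<lambda>t. cos (p t))\<bar> \<le> 1 / sqrt r + 2 / sqrt r" using 1 2 by linarith
  then show ?thesis by simp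
qed

text \<open>The reflection \<open>t -> - t\<close> keeps the second derivative of the phase and
  reverses the sign of its slope.\<close>

lemma integral_cos_phase_bound_nonpos:
  fixes p p' p'' :: "real \<Rightarrow> real"
  assumes p: "\<And>t. u \<le> t \<Longrightarrow> t \<le> v \<Longrightarrow> (p has_real_derivative p' t) (at t)"
    and p': "\<And>t. u \<le> t \<Longrightarrow> t \<le> v \<Longrightarrow> (p' has_real_derivative p'' t) (at t)"
    and p'': "\<And>t. u \<le> t \<Longrightarrow> t \<le> v \<Longrightarrow> r \<le> p'' t"
    and "0 < r" "u \<le> v" "p' v \<le> 0"
  shows "\<bar>integral {u..v} (\<lambda>t. cos (p t))\<bar> \<le> 3 / sqrt r"
proof -
  have "integral {u..v} (\<lambda>t. cos (p t)) = integral {-v..-u} (\<lambda>t. cos (p (- t)))"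
    using Henstock_Kurzweil_Integration.integral_reflect_real[of v u "\<lambda>t. cos (p t)"] by simp
  moreover have "\<bar>integral {-v..-u} (\<lambda>t. cos (p (- t)))\<bar> \<le> 3 / sqrt r"
  proof (rule integral_cos_phase_bound_nonneg[where p' = "\<lambda>t. - p' (- t)" and p'' = "\<lambda>t. p'' (- t)"])
    fix t assume "- v \<le> t" "t \<le> - u"
    then have t: "u \<le> - t" "- t \<le> v" by auto
    show "((\<lambda>t. p (- t)) has_real_derivative - p' (- t)) (at t)"
      using DERIV_chain'[OF DERIV_minus[OF DERIV_ident] p[OF t]] by simp
    show "((\<lambda>t. - p' (- t)) has_real_derivative p'' (- t)) (at t)"
      using DERIV_minus[OF DERIV_chain'[OF DERIV_minus[OF DERIV_ident] p'[OF t]]] by simp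
    show "r \<le> p'' (- t)" by (rule p''[OF t])
  qed (use assms in auto)
  ultimately show ?thesis by simp
qed

text \<open>The slope \<open>p'\<close> is increasing, so it changes sign at most once; the interval
  is split there. The bound depends on \<open>r\<close> alone, whatever the size of
  \<open>p'\<close>, which makes it uniform in linear terms added to the phase.\<close>

lemma integral_cos_phase_bound:
  fixes p p' p'' :: "real \<Rightarrow> real"
  assumes p: "\<And>t. u \<le> t \<Longrightarrow> t \<le> v \<Longrightarrow> (p has_real_derivative p' t) (at t)"
    and p': "\<And>t. u \<le> t \<Longrightarrow> t \<le> v \<Longrightarrow> (p' has_real_derivative p'' t) (at t)"
    and p'': "\<And>t. u \<le> t \<Longrightarrow> t \<le> v \<Longrightarrow> r \<le> p'' t"
    and "0 < r" "u \<le> v"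
  shows "\<bar>integral {u..v} (\<lambda>t. cos (p t))\<bar> \<le> 6 / sqrt r"
proof -
  have le: "3 / sqrt r \<le> 6 / sqrt r" using \<open>0 < r\<close> by (intro divide_right_mono) auto
  consider "0 \<le> p' u" | "p' v \<le> 0" | "p' u \<le> 0" "0 \<le> p' v" by linarith
  then show ?thesis
  proof cases
    case 1 then show ?thesis
      using integral_cos_phase_bound_nonneg[of u v p p' p'' r] assms le by force
  next
    case 2 then show ?thesis
      using integral_cos_phase_bound_nonpos[of u v p p' p'' r] assms le by force
  next
    case 3
    have "continuous_on {u..v} p'" by (intro DERIV_atLeastAtMost_imp_continuous_on) (use p' in auto)
    then obtain w where w: "u \<le> w" "w \<le> v" "p' w = 0"
      using IVT'[of p' u 0 v] 3 assms by auto
    have "continuous_on {u..v} p" by (intro DERIV_atLeastAtMost_imp_continuous_on) (use p in auto)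
    then have "(\<lambda>t. cos (p t)) integrable_on {u..v}"
      by (intro integrable_continuous_real continuous_intros)
    then have "integral {u..v} (\<lambda>t. cos (p t)) = integral {u..w} (\<lambda>t. cos (p t)) + integral {w..v} (\<lambda>t. cos (p t))"
      using w by (intro Henstock_Kurzweil_Integration.integral_combine[symmetric]) auto
    moreover have "\<bar>integral {w..v} (\<lambda>t. cos (p t))\<bar> \<le> 3 / sqrt r"
      by (rule integral_cos_phase_bound_nonneg[of w v p p' p'' r]) (use assms w in auto)
    moreover have "\<bar>integral {u..w} (\<lambda>t. cos (p t))\<bar> \<le> 3 / sqrt r"
      by (rule integral_cos_phase_bound_nonpos[of u w p p' p'' r]) (use assms w in auto)
    ultimately have "\<bar>integral {u..v} (\<lambda>t. cos (p t))\<bar> \<le> 3 / sqrt r + 3 / sqrt r" by linarith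
    then show ?thesis by simp
  qed
qed

section \<open>Primitives of the kernels\<close>

lemma sin_nat_mult_shift: "sin (real k * (t + 2 * pi)) = sin (real k * t)"
proof -
  have "real k * (t + 2 * pi) = real k * t + 2 * real k * pi" by (simp add: algebra_simps)
  then show ?thesis by (simp only: sin_add sin_2npi cos_2npi)
qed

text \<open>The linear term carries the mean value 1 of the kernel, so this odd function is not
  periodic but gains \<open>2 pi\<close> over each period.\<close>

definition dirichlet_primitive :: "nat \<Rightarrow> real \<Rightarrow> real"
  where "dirichlet_primitive M t = t + 2 * (\<Sum>k\<in>{1..M}. sin (real k * t) / real k)"

lemma dirichlet_primitive_deriv:
  "(dirichlet_primitive M has_real_derivative dirichlet_kernel M t) (at t within S)"
  unfolding dirichlet_primitive_def dirichlet_kernel_def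
  by (auto intro!: derivative_eq_intros sum.cong)

lemma has_integral_dirichlet:
  "u \<le> v \<Longrightarrow> (dirichlet_kernel M has_integral (dirichlet_primitive M v - dirichlet_primitive M u)) {u..v}"
  using dirichlet_primitive_deriv
  by (intro fundamental_theorem_of_calculus) (auto simp: has_real_derivative_iff_has_vector_derivative)

lemma dirichlet_primitive_minus: "dirichlet_primitive M (- t) = - dirichlet_primitive M t"
  by (simp add: dirichlet_primitive_def sum_negf)

lemma dirichlet_primitive_periodic: "dirichlet_primitive M (t + 2 * pi) = dirichlet_primitive M t + 2 * pi"
proof -
  have "sin (real k * (t + 2 * pi)) = sin (real k * t)" for k
    using sin_nat_mult_shift[of k t] by simp
  then show ?thesis by (simp add: dirichlet_primitive_def)
qed

lemma dirichlet_primitive_bound_pi: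
  assumes "\<bar>t\<bar> \<le> pi" shows "\<bar>dirichlet_primitive M t\<bar> \<le> 3 * pi"
proof -
  have *: "\<bar>dirichlet_primitive M t\<bar> \<le> 3 * pi" if "0 \<le> t" "t \<le> pi" for t
  proof -
    have "integral {0..t} (dirichlet_kernel M) = dirichlet_primitive M t"
      using has_integral_dirichlet[of 0 t M] that by (auto simp: integral_unique dirichlet_primitive_def)
    then show ?thesis using integral_dirichlet_cos_bound[OF that, of M 0] by simp
  qed
  show ?thesis using *[of t] *[of "- t"] assms by (cases "t \<ge> 0") (auto simp: dirichlet_primitive_minus)
qed

text \<open>Arguments of the kernel are differences of points of a square of side
  \<open>2 pi\<close>. One shift by a period brings them back to \<open>[-pi, pi]\<close>, at the
  price of \<open>2 pi\<close> in the value.\<close>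

lemma dirichlet_primitive_bound:
  assumes "\<bar>t\<bar> \<le> 3 * pi" shows "\<bar>dirichlet_primitive M t\<bar> \<le> 5 * pi"
proof -
  consider "\<bar>t\<bar> \<le> pi" | "\<bar>t - 2 * pi\<bar> \<le> pi" | "\<bar>t + 2 * pi\<bar> \<le> pi" using assms by linarith
  then show ?thesis
  proof cases
    case 1 then show ?thesis using dirichlet_primitive_bound_pi[of t M] pi_gt_zero by linarith
  next
    case 2 then show ?thesis
      using dirichlet_primitive_bound_pi[of "t - 2 * pi" M] dirichlet_primitive_periodic[of M "t - 2 * pi"]
      by simp
  next
    case 3 then show ?thesis
      using dirichlet_primitive_bound_pi[of "t + 2 * pi" M] dirichlet_primitive_periodic[of M "t"]
      by simp
  qed
qed

text \<open>The usual bound \<open>pi / |t|\<close>, multiplied out so that it covers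
  \<open>t = 0\<close>.\<close>

lemma abs_dirichlet_le:
  assumes "\<bar>t\<bar> \<le> pi" shows "\<bar>dirichlet_kernel M t\<bar> * \<bar>t\<bar> \<le> pi"
proof -
  have *: "\<bar>dirichlet_kernel M t\<bar> * t \<le> pi" if "0 \<le> t" "t \<le> pi" for t
  proof -
    have "2 * (t/2) / pi \<le> sin (t/2)" using that by (intro sin_ge_chord) auto
    then have "\<bar>dirichlet_kernel M t\<bar> * (t / pi) \<le> \<bar>dirichlet_kernel M t\<bar> * \<bar>sin (t/2)\<bar>"
      by (intro mult_left_mono) auto
    also have "\<dots> = \<bar>sin ((real M + 1/2) * t)\<bar>"
      unfolding sin_half_dirichlet[symmetric] by (simp add: abs_mult)
    also have "\<dots> \<le> 1" by simp
    finally show ?thesis by (simp add: field_simps)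
  qed
  show ?thesis using *[of t] *[of "- t"] assms by (cases "t \<ge> 0") (auto simp: dirichlet_minus)
qed

section \<open>The Fejer kernel and its integrals\<close>

definition fejer_kernel :: "nat \<Rightarrow> real \<Rightarrow> real"
  where "fejer_kernel N t = 1 + 2 * (\<Sum>k\<in>{1..N}. (1 - real k / (real N + 1)) * cos (real k * t))"

text \<open>Frequency \<open>k\<close> occurs in the kernels with \<open>k <= n <= N\<close>, that
  is \<open>N + 1 - k\<close> times, which is \<open>N + 1\<close> times its Fejer weight.\<close>

lemma sum_dirichlet: "(\<Sum>n\<le>N. dirichlet_kernel n t) = (real N + 1) * fejer_kernel N t"
proof (induction N)
  case (Suc N)
  have "(real N + 1) * fejer_kernel N t = (real N + 1) + 2 * (\<Sum>k\<in>{1..N}. (real N + 1 - real k) * cos (real k * t))" for N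
  proof -
    have "(real N + 1) * (1 - real k / (real N + 1)) = real N + 1 - real k" for k
      by (simp add: field_simps)
    then have "(real N + 1) * ((1 - real k / (real N + 1)) * cos (real k * t)) = (real N + 1 - real k) * cos (real k * t)" for k
      by (simp only: mult.assoc[symmetric])
    moreover have "(real N + 1) * fejer_kernel N t = (real N + 1) + 2 * (\<Sum>k\<in>{1..N}. (real N + 1) * ((1 - real k / (real N + 1)) * cos (real k * t)))"
      by (simp only: fejer_kernel_def distrib_left mult.left_commute[of "real N + 1" 2] sum_distrib_left mult_1_right)
    ultimately show ?thesis by (simp only:)
  qed
  note eq = this
  have "(\<Sum>n\<le>Suc N. dirichlet_kernel n t) =
    (real N + 1) + 2 * (\<Sum>k\<in>{1..N}. (real N + 1 - real k) * cos (real k * t)) + dirichlet_kernel (Suc N) t"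
    using Suc eq[of N] by simp
  also have "\<dots> = (real (Suc N) + 1) + 2 * (\<Sum>k\<in>{1..Suc N}. (real (Suc N) + 1 - real k) * cos (real k * t))"
    by (simp add: dirichlet_kernel_def algebra_simps sum.distrib sum_subtractf sum_distrib_left)
  finally show ?case using eq[of "Suc N"] by simp
qed (simp add: fejer_kernel_def dirichlet_kernel_def)

text \<open>Multiplied by the square of \<open>sin (t / 2)\<close>, the sum of Dirichlet kernels
  telescopes to \<open>(1 - cos ((N + 1) t)) / 2\<close>. At the zeros of \<open>sin (t / 2)\<close>
  this says nothing, but there every cosine is 1 and the weights are nonnegative.\<close>

lemma fejer_kernel_nonneg: "0 \<le> fejer_kernel N t"
proof (cases "sin (t / 2) = 0")
  case True
  then have "cos (2 * (t/2)) = 1" unfolding cos_double_sin by simp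
  then obtain i :: int where i: "t = i * 2 * pi" by (auto simp: cos_one_2pi_int)
  have "cos (real k * t) = 1" for k
    using i cos_int_2pin[of "int k * i"] by (simp add: algebra_simps)
  then show ?thesis by (auto simp: fejer_kernel_def intro!: add_nonneg_nonneg sum_nonneg)
next
  case False
  have "(sin (t/2))\<^sup>2 * (\<Sum>n\<le>N. dirichlet_kernel n t) = (1 - cos ((real N + 1) * t)) / 2"
  proof (induction N)
    case 0
    show ?case using cos_double_sin[of "t/2"] by (simp add: dirichlet_kernel_def)
  next
    case (Suc N)
    have "(sin (t/2))\<^sup>2 * dirichlet_kernel (Suc N) t = sin (t/2) * sin ((real (Suc N) + 1/2) * t)"
      by (simp only: power2_eq_square mult.assoc sin_half_dirichlet)
    also have "\<dots> = (cos ((real N + 1) * t) - cos ((real (Suc N) + 1) * t)) / 2"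
    proof -
      have "t/2 - (real (Suc N) + 1/2) * t = - ((real N + 1) * t)" "t/2 + (real (Suc N) + 1/2) * t = (real (Suc N) + 1) * t"
        by (simp_all add: algebra_simps)
      then show ?thesis unfolding sin_times_sin by simp
    qed
    finally show ?case using Suc by (simp add: distrib_left)
  qed
  moreover have "0 \<le> (1 - cos ((real N + 1) * t)) / 2" by simp
  ultimately have "0 \<le> (sin (t/2))\<^sup>2 * ((real N + 1) * fejer_kernel N t)"
    unfolding sum_dirichlet by (simp only:)
  then show ?thesis using False by (auto simp: zero_le_mult_iff)
qed

text \<open>A primitive of the nonnegative kernel is nondecreasing and gains exactly
  \<open>2 pi\<close> over a period, so an interval of length at most \<open>2 pi\<close> cannot
  collect more.\<close>

lemma integral_fejer_bound:
  assumes "0 \<le> s" "s \<le> 2 * pi"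
  shows "integral {0..s} (\<lambda>y. fejer_kernel N (c - y)) \<le> 2 * pi"
proof -
  define Q where "Q t = t + 2 * (\<Sum>k\<in>{1..N}. (1 - real k / (real N + 1)) * (sin (real k * t) / real k))" for t
  have Q: "(Q has_real_derivative fejer_kernel N t) (at t within S)" for t S
    unfolding Q_def fejer_kernel_def by (auto intro!: derivative_eq_intros sum.cong)
  have mono: "Q x \<le> Q y" if "x \<le> y" for x y
    using that Q fejer_kernel_nonneg by (intro DERIV_nonneg_imp_nondecreasing[of x y Q]) blast+
  have "sin (real k * (c - 2 * pi)) = sin (real k * c)" for k
    using sin_nat_mult_shift[of k "c - 2 * pi"] by simp
  then have per: "Q (c - 2 * pi) = Q c - 2 * pi" by (simp add: Q_def)
  have "((\<lambda>y. fejer_kernel N (c - y)) has_integral (- Q (c - s) - (- Q (c - 0)))) {0..s}"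
  proof (rule fundamental_theorem_of_calculus)
    fix y assume "y \<in> {0..s}"
    have "((\<lambda>y. - Q (c - y)) has_real_derivative - (fejer_kernel N (c - y) * (- 1))) (at y within {0..s})"
      by (intro DERIV_minus DERIV_chain'[where f = "\<lambda>y. c - y" and g = Q] Q) (auto intro!: derivative_eq_intros)
    then show "((\<lambda>y. - Q (c - y)) has_vector_derivative fejer_kernel N (c - y)) (at y within {0..s})"
      by (simp add: has_real_derivative_iff_has_vector_derivative)
  qed (use assms in auto)
  then have "integral {0..s} (\<lambda>y. fejer_kernel N (c - y)) = Q c - Q (c - s)" by (simp add: integral_unique)
  also have "\<dots> \<le> Q c - Q (c - 2 * pi)" using mono[of "c - 2 * pi" "c - s"] assms by auto
  finally show ?thesis by (simp add: per)
qed

section \<open>Oscillation along the boundary of the disc\<close>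

text \<open>Half the length of the chord in the second direction of the disc of radius
  \<open>pi\<close>, at first coordinate \<open>y\<close>. Real \<open>sqrt\<close> is extended to
  negative arguments as an odd function, so \<open>disc_height\<close> is continuous on the whole
  line but negative beyond \<open>pi\<close>; whence a range condition wherever its sign
  matters.\<close>

definition disc_height :: "real \<Rightarrow> real"
  where "disc_height y = sqrt (pi\<^sup>2 - y\<^sup>2)"

text \<open>The range \<open>7 pi / 8\<close> is the largest admissible coordinate
  \<open>3 pi / 4\<close> enlarged by \<open>pi / 8\<close>, the half width of the window around the
  peak of the kernel. There \<open>1 - 49 / 64 >= 1 / 9\<close> gives the lower bound.\<close>

lemma disc_height_ge:
  assumes "\<bar>y\<bar> \<le> 7 * pi / 8" shows "pi / 3 \<le> disc_height y"
proof -
  have "y\<^sup>2 \<le> (7 * pi / 8)\<^sup>2" using assms abs_le_square_iff[of y "7 * pi / 8"] by simp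
  then have "(pi / 3)\<^sup>2 \<le> pi\<^sup>2 - y\<^sup>2"
    by (simp add: power_divide power_mult_distrib) (smt (verit) zero_le_power2)
  then show ?thesis unfolding disc_height_def by (intro real_le_rsqrt) auto
qed

lemma disc_height_le: "disc_height y \<le> pi"
proof -
  have "sqrt (pi\<^sup>2 - y\<^sup>2) \<le> sqrt (pi\<^sup>2)" by (intro real_sqrt_le_mono) simp
  then show ?thesis by (simp add: disc_height_def)
qed

lemma disc_height_nonneg: "\<bar>y\<bar> \<le> pi \<Longrightarrow> 0 \<le> disc_height y"
  using abs_le_square_iff[of y pi] by (simp add: disc_height_def)

lemma disc_height_antimono: "\<bar>x\<bar> \<le> \<bar>y\<bar> \<Longrightarrow> disc_height y \<le> disc_height x"
  using abs_le_square_iff[of x y] by (simp add: disc_height_def)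

lemma continuous_disc_height [continuous_intros]:
  "continuous_on S f \<Longrightarrow> continuous_on S (\<lambda>x. disc_height (f x))"
  unfolding disc_height_def by (intro continuous_intros)

lemma disc_height_deriv:
  assumes "\<bar>y\<bar> \<le> 7 * pi / 8"
  shows "(disc_height has_real_derivative - y / disc_height y) (at y)"
proof -
  have "0 < disc_height y" using disc_height_ge[OF assms] pi_gt_zero by linarith
  then have "0 < pi\<^sup>2 - y\<^sup>2" by (simp add: disc_height_def)
  then show ?thesis unfolding disc_height_def[abs_def]
    by (auto intro!: derivative_eq_intros simp: field_simps)
qed

text \<open>With \<open>h\<close> for the height, the quotient rule gives
  \<open>- (h^2 + y^2) / h^3\<close>, and \<open>h^2 + y^2 = pi^2\<close>.\<close>

lemma disc_height_deriv2:
  assumes "\<bar>y\<bar> \<le> 7 * pi / 8"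
  shows "((\<lambda>y. - y / disc_height y) has_real_derivative - pi\<^sup>2 / disc_height y ^ 3) (at y)"
proof -
  have p: "0 < disc_height y" using disc_height_ge[OF assms] pi_gt_zero by linarith
  then have "0 < pi\<^sup>2 - y\<^sup>2" by (simp add: disc_height_def)
  then have sq: "disc_height y ^ 2 + y\<^sup>2 = pi\<^sup>2" by (simp add: disc_height_def)
  have "((\<lambda>y. - y / disc_height y) has_real_derivative
     ((- 1) * disc_height y - (- y) * (- y / disc_height y)) / (disc_height y * disc_height y)) (at y)"
    using p by (intro DERIV_divide disc_height_deriv[OF assms]) (auto intro!: derivative_eq_intros)
  also have "((- 1) * disc_height y - (- y) * (- y / disc_height y)) / (disc_height y * disc_height y)
     = - (disc_height y ^ 2 + y\<^sup>2) / disc_height y ^ 3"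
    using p by (simp add: field_simps power2_eq_square power3_eq_cube)
  finally show ?thesis unfolding sq .
qed

lemma disc_height_deriv_le:
  assumes "\<bar>y\<bar> \<le> 7 * pi / 8" shows "\<bar>- y / disc_height y\<bar> \<le> 3"
proof -
  note ge = disc_height_ge[OF assms]
  then have p: "0 < disc_height y" using pi_gt_zero by linarith
  have "\<bar>y\<bar> \<le> 3 * disc_height y" using assms ge by linarith
  then show ?thesis using p by (simp add: field_simps)
qed

text \<open>The first bound is the strict concavity that van der Corput's estimate feeds on; it
  comes from \<open>h <= pi\<close>. The second comes from \<open>h >= pi / 3\<close> and controls
  the error of linearisation.\<close>

lemma disc_height_deriv2_bounds:
  assumes "\<bar>y\<bar> \<le> 7 * pi / 8"
  shows "- pi\<^sup>2 / disc_height y ^ 3 \<le> - (1 / pi)" "\<bar>- pi\<^sup>2 / disc_height y ^ 3\<bar> \<le> 9"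
proof -
  note ge = disc_height_ge[OF assms]
  then have p: "0 < disc_height y" using pi_gt_zero by linarith
  have "disc_height y ^ 3 \<le> pi ^ 3" using p disc_height_le by (intro power_mono) auto
  then have "pi\<^sup>2 / disc_height y ^ 3 \<ge> pi\<^sup>2 / pi ^ 3" using p by (intro divide_left_mono) auto
  moreover have "pi\<^sup>2 / pi ^ 3 = 1 / pi" by (simp add: power2_eq_square power3_eq_cube)
  ultimately show "- pi\<^sup>2 / disc_height y ^ 3 \<le> - (1 / pi)" by simp
  have "(pi / 3) ^ 3 \<le> disc_height y ^ 3" using ge by (intro power_mono) auto
  then have "pi\<^sup>2 / disc_height y ^ 3 \<le> pi\<^sup>2 / (pi / 3) ^ 3" using p by (intro divide_left_mono) auto
  also have "\<dots> = 27 / pi" by (simp add: power2_eq_square power3_eq_cube)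
  also have "\<dots> \<le> 9" using pi_gt3 by (simp add: field_simps)
  finally show "\<bar>- pi\<^sup>2 / disc_height y ^ 3\<bar> \<le> 9" using p by simp
qed

lemma disc_height_lipschitz:
  assumes "\<bar>x\<bar> \<le> 7 * pi / 8" "\<bar>y\<bar> \<le> 7 * pi / 8"
  shows "\<bar>disc_height x - disc_height y\<bar> \<le> 3 * \<bar>x - y\<bar>"
proof -
  have "norm (disc_height x - disc_height y) \<le> 3 * norm (x - y)"
  proof (rule field_differentiable_bound[where S = "{-(7*pi/8)..7*pi/8}"])
    fix z :: real assume "z \<in> {-(7*pi/8)..7*pi/8}"
    then have z: "\<bar>z\<bar> \<le> 7 * pi / 8" by auto
    show "(disc_height has_field_derivative - z / disc_height z) (at z within {-(7*pi/8)..7*pi/8})"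
      by (rule has_field_derivative_at_within[OF disc_height_deriv[OF z]])
    show "norm (- z / disc_height z) \<le> 3" using disc_height_deriv_le[OF z] by simp
  qed (use assms in auto)
  then show ?thesis by simp
qed

text \<open>The derivative of the height is Lipschitz with constant 9 on the enlarged range. The
  remainder after linearisation has derivative 0 at the centre, hence a derivative of size at most
  \<open>9 |t|\<close> all the way to \<open>t\<close>.\<close>

lemma disc_height_taylor:
  assumes x: "\<bar>x\<bar> \<le> 3 * pi / 4" and t: "\<bar>t\<bar> \<le> pi / 8"
  shows "\<bar>disc_height (x - t) - (disc_height x - t * (- x / disc_height x))\<bar> \<le> 9 * t\<^sup>2"
proof -
  define d where "d y = - y / disc_height y" for y
  define r where "r s = disc_height (x - s) + s * d x" for s
  have in_range: "\<bar>x - s\<bar> \<le> 7 * pi / 8" if "\<bar>s\<bar> \<le> \<bar>t\<bar>" for s using that x t by linarith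
  have x': "\<bar>x\<bar> \<le> 7 * pi / 8" using x by linarith
  have dlip: "\<bar>d y - d z\<bar> \<le> 9 * \<bar>y - z\<bar>" if "\<bar>y\<bar> \<le> 7 * pi / 8" "\<bar>z\<bar> \<le> 7 * pi / 8" for y z
  proof -
    have "norm (d y - d z) \<le> 9 * norm (y - z)"
    proof (rule field_differentiable_bound[where S = "{-(7*pi/8)..7*pi/8}"])
      fix z :: real assume "z \<in> {-(7*pi/8)..7*pi/8}"
      then have z: "\<bar>z\<bar> \<le> 7 * pi / 8" by auto
      show "(d has_field_derivative - pi\<^sup>2 / disc_height z ^ 3) (at z within {-(7*pi/8)..7*pi/8})"
        unfolding d_def[abs_def] by (rule has_field_derivative_at_within[OF disc_height_deriv2[OF z]])
      show "norm (- pi\<^sup>2 / disc_height z ^ 3) \<le> 9" using disc_height_deriv2_bounds[OF z] by simp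
    qed (use that in auto)
    then show ?thesis by simp
  qed
  have "norm (r t - r 0) \<le> (9 * \<bar>t\<bar>) * norm (t - 0)"
  proof (rule field_differentiable_bound[where S = "{-\<bar>t\<bar>..\<bar>t\<bar>}" and f = r and f' = "\<lambda>s. d x - d (x - s)"])
    fix s assume "s \<in> {-\<bar>t\<bar>..\<bar>t\<bar>}"
    then have s: "\<bar>s\<bar> \<le> \<bar>t\<bar>" by auto
    have "((\<lambda>s. disc_height (x - s)) has_real_derivative d (x - s) * (- 1)) (at s within {-\<bar>t\<bar>..\<bar>t\<bar>})"
      unfolding d_def using in_range[OF s]
      by (intro DERIV_chain'[where f = "\<lambda>s. x - s" and g = disc_height] disc_height_deriv)
        (auto intro!: derivative_eq_intros)
    then show "(r has_field_derivative d x - d (x - s)) (at s within {-\<bar>t\<bar>..\<bar>t\<bar>})"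
      unfolding r_def[abs_def] by (auto intro!: derivative_eq_intros)
    show "norm (d x - d (x - s)) \<le> 9 * \<bar>t\<bar>" using dlip[OF x' in_range[OF s]] s by auto
  qed auto
  then show ?thesis by (simp add: r_def d_def power2_eq_square)
qed

lemma integral_even_part:
  fixes G :: "real \<Rightarrow> real"
  assumes "continuous_on {-b..b} G" "0 \<le> b"
  shows "integral {-b..b} G = integral {0..b} (\<lambda>t. G t + G (- t))"
proof -
  have c1: "continuous_on {0..b} G" by (rule continuous_on_subset[OF assms(1)]) (use assms in auto)
  have c2: "continuous_on {0..b} (\<lambda>t. G (- t))"
    by (rule continuous_on_compose2[OF assms(1)]) (auto intro!: continuous_intros)
  have "integral {-b..b} G = integral {-b..0} G + integral {0..b} G"
    using assms integrable_continuous_real[OF assms(1)]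
    by (intro Henstock_Kurzweil_Integration.integral_combine[symmetric]) auto
  also have "integral {-b..0} G = integral {0..b} (\<lambda>t. G (- t))"
    using Henstock_Kurzweil_Integration.integral_reflect_real[of 0 "-b" G] by simp
  also have "integral {0..b} (\<lambda>t. G (- t)) + integral {0..b} G = integral {0..b} (\<lambda>t. G t + G (- t))"
    using c1 c2 by (simp add: Henstock_Kurzweil_Integration.integral_add integrable_continuous_real)
  finally show ?thesis .
qed

lemma abs_sin_diff_le: "\<bar>sin x - sin y\<bar> \<le> \<bar>x - y\<bar>" for x y :: real
proof -
  have "norm (sin x - sin y) \<le> 1 * norm (x - y)"
    by (rule field_differentiable_bound[where S = UNIV and f' = cos])
      (auto intro: DERIV_sin)
  then show ?thesis by simp
qed

text \<open>With \<open>n = M + 1/2\<close>, the product \<open>sin (n t) sin (q t)\<close> becomes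
  a difference of cosines of the phases \<open>n t - q t\<close> and \<open>- n t - q t\<close>. The
  kernel contributes only a linear term, so both have second derivative
  \<open>- q'' >= k / pi\<close> whatever \<open>M\<close> is. The weight
  \<open>1 / sin (t / 2)\<close> is at most \<open>pi / b = 8 sqrt k\<close> on the range, and its
  product with \<open>6 / sqrt (k / pi)\<close> is \<open>48 sqrt pi\<close>. The sign
  \<open>e\<close> treats the two sides of the window together; it enters \<open>q''\<close>
  squared.\<close>

lemma osc_far:
  fixes x c e k :: real
  assumes x: "\<bar>x\<bar> \<le> 3 * pi / 4" and k: "1 \<le> k" and e: "e = 1 \<or> e = - 1"
  defines "b \<equiv> pi / 8 / sqrt k"
  shows "\<bar>integral {b..pi/8} (\<lambda>t. dirichlet_kernel M t * sin (k * (disc_height (x - e * t) - c)))\<bar>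
    \<le> 48 * sqrt pi"
proof -
  have sk: "1 \<le> sqrt k" using k by simp
  have b: "0 < b" "b \<le> pi / 8" using sk k unfolding b_def by (simp_all add: divide_le_eq)
  define q where "q = (\<lambda>t. k * (disc_height (x - e * t) - c))"
  define q' where "q' = (\<lambda>t. - e * k * (- (x - e * t) / disc_height (x - e * t)))"
  define q'' where "q'' = (\<lambda>t. k * (- pi\<^sup>2 / disc_height (x - e * t) ^ 3))"
  have rng: "\<bar>x - e * t\<bar> \<le> 7 * pi / 8" if "\<bar>t\<bar> \<le> pi / 8" for t
    using e
  proof
    assume "e = 1" then have "x - e * t = x - t" by simp
    then show ?thesis using that x by linarith
  next
    assume "e = - 1" then have "x - e * t = x + t" by simp
    then show ?thesis using that x by linarith
  qed
  have q: "(q has_real_derivative q' t) (at t)" if "\<bar>t\<bar> \<le> pi / 8" for t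
  proof -
    have "((\<lambda>t. disc_height (x - e * t)) has_real_derivative (- (x - e * t) / disc_height (x - e * t)) * (- e)) (at t)"
      using rng[OF that] by (intro DERIV_chain'[where f = "\<lambda>t. x - e * t" and g = disc_height] disc_height_deriv)
        (auto intro!: derivative_eq_intros)
    then show ?thesis unfolding q_def q'_def by (auto intro!: derivative_eq_intros)
  qed
  have q': "(q' has_real_derivative q'' t) (at t)" if "\<bar>t\<bar> \<le> pi / 8" for t
  proof -
    have *: "((\<lambda>t. - (x - e * t) / disc_height (x - e * t)) has_real_derivative
        (- pi\<^sup>2 / disc_height (x - e * t) ^ 3) * (- e)) (at t)"
      using rng[OF that] by (intro DERIV_chain'[where f = "\<lambda>t. x - e * t" and g = "\<lambda>y. - y / disc_height y"] disc_height_deriv2)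
        (auto intro!: derivative_eq_intros)
    have "(q' has_real_derivative - e * k * ((- pi\<^sup>2 / disc_height (x - e * t) ^ 3) * (- e))) (at t)"
      unfolding q'_def by (intro DERIV_cmult *)
    then show ?thesis using e by (auto simp: q''_def)
  qed
  have q'': "k / pi \<le> - q'' t" if "\<bar>t\<bar> \<le> pi / 8" for t
  proof -
    have "k * (1 / pi) \<le> k * (- (- pi\<^sup>2 / disc_height (x - e * t) ^ 3))"
      using disc_height_deriv2_bounds(1)[OF rng[OF that]] k by (intro mult_left_mono) auto
    then show ?thesis by (simp add: q''_def)
  qed
  define n where "n = real M + 1 / 2"
  have posr: "0 < k / pi" using k by simp
  have vdc: "\<bar>integral {b..d} (\<lambda>t. cos (s * (n * t) - q t))\<bar> \<le> 6 / sqrt (k / pi)"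
    if "b \<le> d" "d \<le> pi / 8" for d s
  proof (rule integral_cos_phase_bound[where p' = "\<lambda>t. s * n - q' t" and p'' = "\<lambda>t. - q'' t"])
    fix t assume "b \<le> t" "t \<le> d"
    then have t: "\<bar>t\<bar> \<le> pi / 8" using b that by auto
    show "((\<lambda>t. s * (n * t) - q t) has_real_derivative s * n - q' t) (at t)"
      using q[OF t] by (auto intro!: derivative_eq_intros)
    show "((\<lambda>t. s * n - q' t) has_real_derivative - q'' t) (at t)"
      using q'[OF t] by (auto intro!: derivative_eq_intros)
    show "k / pi \<le> - q'' t" by (rule q''[OF t])
  qed (use posr that in auto)
  have contq: "continuous_on {b..d} q" for d unfolding q_def by (intro continuous_intros)
  have half: "0 < sin (t / 2)" if "b \<le> t" "t \<le> pi / 8" for t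
    using that b pi_gt_zero by (intro sin_gt_zero) linarith+
  have "integral {b..pi/8} (\<lambda>t. dirichlet_kernel M t * sin (q t))
    = integral {b..pi/8} (\<lambda>t. (1 / sin (t/2)) * (sin (n * t) * sin (q t)))"
  proof (intro integral_cong)
    fix t assume "t \<in> {b..pi/8}"
    then have "0 < sin (t/2)" using half by auto
    then show "dirichlet_kernel M t * sin (q t) = (1 / sin (t/2)) * (sin (n * t) * sin (q t))"
      unfolding n_def sin_half_dirichlet[symmetric] by simp
  qed
  also have "\<bar>\<dots>\<bar> \<le> (1 / sin (b/2)) * (6 / sqrt (k / pi))"
  proof (rule integral_antimono_mult_bound)
    show "(\<lambda>t. sin (n * t) * sin (q t)) integrable_on {b..pi/8}"
      by (intro integrable_continuous_real continuous_intros contq)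
    show "1 / sin (y / 2) \<le> 1 / sin (z / 2)" if "b \<le> z" "z \<le> y" "y \<le> pi / 8" for z y
      using that b pi_gt_zero half[of z] half[of y] by (intro frac_le sin_monotone_2pi_le) linarith+
    show "0 \<le> 1 / sin (pi / 8 / 2)" using half[of "pi/8"] b by simp
    show "\<bar>integral {b..d} (\<lambda>t. sin (n * t) * sin (q t))\<bar> \<le> 6 / sqrt (k / pi)" if "b \<le> d" "d \<le> pi / 8" for d
    proof -
      have "integral {b..d} (\<lambda>t. sin (n * t) * sin (q t))
        = integral {b..d} (\<lambda>t. (1/2) * (cos (1 * (n * t) - q t) - cos ((-1) * (n * t) - q t)))"
      proof (intro integral_cong)
        fix t
        have "cos ((-1) * (n * t) - q t) = cos (n * t + q t)"
          using cos_minus[of "n * t + q t"] by simp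
        then show "sin (n * t) * sin (q t) = (1/2) * (cos (1 * (n * t) - q t) - cos ((-1) * (n * t) - q t))"
          by (simp add: sin_times_sin)
      qed
      also have "\<dots> = (1/2) * (integral {b..d} (\<lambda>t. cos (1 * (n * t) - q t)) - integral {b..d} (\<lambda>t. cos ((-1) * (n * t) - q t)))"
        unfolding Henstock_Kurzweil_Integration.integral_mult_right
        by (subst Henstock_Kurzweil_Integration.integral_diff)
           (auto intro!: integrable_continuous_real continuous_intros contq)
      finally have eq: "integral {b..d} (\<lambda>t. sin (n * t) * sin (q t)) = (1/2) * (integral {b..d} (\<lambda>t. cos (1 * (n * t) - q t)) - integral {b..d} (\<lambda>t. cos ((-1) * (n * t) - q t)))" .
      have half_diff: "\<bar>(1/2) * (A - B)\<bar> \<le> r" if "\<bar>A\<bar> \<le> r" "\<bar>B\<bar> \<le> r" for A B r :: real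
        using that unfolding abs_le_iff by (simp add: field_simps)
      then show ?thesis unfolding eq by (intro half_diff vdc that)
    qed
  qed (use b in auto)
  also have "\<dots> \<le> (1 / (b / pi)) * (6 / sqrt (k / pi))"
  proof -
    have "2 * (b/2) / pi \<le> sin (b/2)" using b pi_gt_zero by (intro sin_ge_chord) linarith+
    then show ?thesis using b posr by (intro mult_right_mono frac_le) auto
  qed
  also have "\<dots> = 48 * sqrt pi" using k by (simp add: b_def real_sqrt_divide)
  finally show ?thesis unfolding q_def .
qed

text \<open>The kernel is at most \<open>pi / |t|\<close> and the phase differs from its tangent by
  at most \<open>9 k t^2\<close>, so linearising costs \<open>18 pi k b^2\<close> in all, a constant
  for \<open>b\<close> of order \<open>1 / sqrt k\<close>. After folding the two sides together the
  linear phase leaves \<open>2 sin A cos (m t)\<close> times the kernel, whose integral is bounded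
  for every real slope \<open>m\<close>.\<close>

lemma osc_near:
  fixes x c k :: real and M :: nat
  assumes x: "\<bar>x\<bar> \<le> 3 * pi / 4" and k: "1 \<le> k"
  defines "b \<equiv> pi / 8 / sqrt k" and "G \<equiv> (\<lambda>t. dirichlet_kernel M t * sin (k * (disc_height (x - t) - c)))"
  shows "\<bar>integral {0..b} (\<lambda>t. G t + G (- t))\<bar> \<le> 6 * pi + 18 * pi ^ 3"
proof -
  have sk: "1 \<le> sqrt k" using k by simp
  have b: "0 < b" "b \<le> pi / 8" using sk k unfolding b_def by (simp_all add: divide_le_eq)
  define A where "A = k * (disc_height x - c)"
  define m where "m = k * (- x / disc_height x)"
  define D where "D = dirichlet_kernel M"
  have Dle: "\<bar>D t\<bar> * \<bar>t\<bar> \<le> pi" if "\<bar>t\<bar> \<le> pi / 8" for t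
    unfolding D_def by (rule abs_dirichlet_le) (use that pi_gt_zero in linarith)
  have lin: "\<bar>G t - D t * sin (A - t * m)\<bar> \<le> 9 * pi * k * b" if "\<bar>t\<bar> \<le> b" for t
  proof -
    have t: "\<bar>t\<bar> \<le> pi / 8" using that b by linarith
    have "\<bar>sin (k * (disc_height (x - t) - c)) - sin (A - t * m)\<bar> \<le> \<bar>k * (disc_height (x - t) - c) - (A - t * m)\<bar>"
      by (rule abs_sin_diff_le)
    also have "\<dots> = k * \<bar>disc_height (x - t) - (disc_height x - t * (- x / disc_height x))\<bar>"
    proof -
      have "k * (disc_height (x - t) - c) - (A - t * m) = k * (disc_height (x - t) - (disc_height x - t * (- x / disc_height x)))"
        by (simp add: A_def m_def algebra_simps)
      then show ?thesis using k by (simp add: abs_mult)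
    qed
    also have "\<dots> \<le> k * (9 * t\<^sup>2)" using disc_height_taylor[OF x t] k by (intro mult_left_mono) auto
    finally have "\<bar>D t\<bar> * \<bar>sin (k * (disc_height (x - t) - c)) - sin (A - t * m)\<bar> \<le> \<bar>D t\<bar> * (k * (9 * t\<^sup>2))"
      by (rule mult_left_mono) simp
    \<comment> \<open>One factor \<open>|t|\<close> is spent on the kernel, the other is bounded by
      \<open>b\<close>.\<close>
    also have "\<dots> = (\<bar>D t\<bar> * \<bar>t\<bar>) * (9 * k * \<bar>t\<bar>)"
      by (simp add: power2_eq_square abs_mult_self_eq mult.assoc)
    also have "\<dots> \<le> pi * (9 * k * b)" using Dle[OF t] that k by (intro mult_mono) auto
    finally show ?thesis by (simp add: G_def D_def abs_mult right_diff_distrib[symmetric] mult.assoc mult.commute mult.left_commute)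
  qed
  have contG: "continuous_on S G" "continuous_on S (\<lambda>t. G (- t))" for S
    unfolding G_def by (intro continuous_intros)+
  have contL: "continuous_on S (\<lambda>t. D t * cos (m * t))" for S
    unfolding D_def by (intro continuous_intros)
  have L: "integral {0..b} (\<lambda>t. 2 * sin A * (D t * cos (m * t))) = 2 * sin A * integral {0..b} (\<lambda>t. D t * cos (m * t))"
    by (rule Henstock_Kurzweil_Integration.integral_mult_right)
  have "norm (integral {0..b} (\<lambda>t. (G t + G (- t)) - 2 * sin A * (D t * cos (m * t)))) \<le> (18 * pi * k * b) * (b - 0)"
  proof (rule integral_bound)
    show "continuous_on {0..b} (\<lambda>t. G t + G (- t) - 2 * sin A * (D t * cos (m * t)))"
      by (intro continuous_intros contG contL)
    fix t assume "t \<in> {0..b}"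
    then have t: "\<bar>t\<bar> \<le> b" "\<bar>- t\<bar> \<le> b" by auto
    have "D (- t) = D t" by (simp add: D_def dirichlet_minus)
    moreover have "sin (A - t * m) + sin (A + t * m) = 2 * sin A * cos (m * t)"
      by (simp add: sin_add sin_diff mult.commute)
    ultimately have "2 * sin A * (D t * cos (m * t)) = D t * sin (A - t * m) + D (- t) * sin (A - (- t) * m)"
      by (simp add: algebra_simps flip: distrib_left)
    then show "norm (G t + G (- t) - 2 * sin A * (D t * cos (m * t))) \<le> 18 * pi * k * b"
      using lin[OF t(1)] lin[OF t(2)] unfolding real_norm_def by linarith
  qed (use b in auto)
  also have "\<dots> = 18 * pi * k * b\<^sup>2" by (simp add: power2_eq_square)
  also have "\<dots> = 18 * pi * (pi\<^sup>2 / 64)" using k by (simp add: b_def power_divide)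
  also have "\<dots> \<le> 18 * pi ^ 3" by (simp add: power2_eq_square power3_eq_cube)
  finally have "\<bar>integral {0..b} (\<lambda>t. G t + G (- t)) - 2 * sin A * integral {0..b} (\<lambda>t. D t * cos (m * t))\<bar> \<le> 18 * pi ^ 3"
    unfolding L[symmetric]
    by (subst (asm) Henstock_Kurzweil_Integration.integral_diff)
       (auto intro!: integrable_continuous_real continuous_intros contG contL)
  moreover have "\<bar>2 * sin A * integral {0..b} (\<lambda>t. D t * cos (m * t))\<bar> \<le> 2 * 1 * (3 * pi)"
    unfolding abs_mult D_def using b pi_gt_zero
    by (intro mult_mono integral_dirichlet_cos_bound) (auto intro: order_trans)
  ultimately show ?thesis by linarith
qed

text \<open>The part near the centre, \<open>6 pi + 18 pi^3\<close>, plus \<open>48 sqrt pi\<close>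
  for each of the two far sides.\<close>

definition osc_bound :: real where "osc_bound = 6 * pi + 18 * pi ^ 3 + 96 * sqrt pi"

lemma integral_dirichlet_osc_bound:
  fixes x c k :: real
  assumes x: "\<bar>x\<bar> \<le> 3 * pi / 4" and k: "1 \<le> k"
  shows "\<bar>integral {-(pi/8)..pi/8} (\<lambda>t. dirichlet_kernel M t * sin (k * (disc_height (x - t) - c)))\<bar> \<le> osc_bound"
proof -
  define G where "G = (\<lambda>t. dirichlet_kernel M t * sin (k * (disc_height (x - t) - c)))"
  define b where "b = pi / 8 / sqrt k"
  have sk: "1 \<le> sqrt k" using k by simp
  have b: "0 < b" "b \<le> pi / 8" using sk k unfolding b_def by (simp_all add: divide_le_eq)
  have contG: "continuous_on S G" "continuous_on S (\<lambda>t. G (- t))" for S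
    unfolding G_def by (intro continuous_intros)+
  have "integral {-(pi/8)..pi/8} G = integral {0..pi/8} (\<lambda>t. G t + G (- t))"
    by (intro integral_even_part contG) auto
  also have "\<dots> = integral {0..b} (\<lambda>t. G t + G (- t)) + integral {b..pi/8} (\<lambda>t. G t + G (- t))"
    using b by (intro Henstock_Kurzweil_Integration.integral_combine[symmetric] integrable_continuous_real continuous_intros contG) auto
  also have "integral {b..pi/8} (\<lambda>t. G t + G (- t)) = integral {b..pi/8} G + integral {b..pi/8} (\<lambda>t. G (- t))"
    by (intro Henstock_Kurzweil_Integration.integral_add integrable_continuous_real contG)
  finally have eq: "integral {-(pi/8)..pi/8} G = integral {0..b} (\<lambda>t. G t + G (- t))
      + (integral {b..pi/8} G + integral {b..pi/8} (\<lambda>t. G (- t)))" .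
  have 1: "\<bar>integral {b..pi/8} G\<bar> \<le> 48 * sqrt pi"
    using osc_far[OF x k, of 1 M c] by (simp add: G_def b_def)
  have 2: "\<bar>integral {b..pi/8} (\<lambda>t. G (- t))\<bar> \<le> 48 * sqrt pi"
    using osc_far[OF x k, of "-1" M c] by (simp add: G_def b_def dirichlet_minus)
  have 3: "\<bar>integral {0..b} (\<lambda>t. G t + G (- t))\<bar> \<le> 6 * pi + 18 * pi ^ 3"
    unfolding G_def b_def by (rule osc_near[OF x k])
  have "\<bar>integral {-(pi/8)..pi/8} G\<bar> \<le> osc_bound"
    unfolding eq osc_bound_def using 1 2 3 by linarith
  then show ?thesis by (simp add: G_def)
qed

lemma integral_dirichlet_bound:
  assumes "u \<le> v" "\<bar>u\<bar> \<le> 3 * pi" "\<bar>v\<bar> \<le> 3 * pi"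
  shows "\<bar>integral {u..v} (dirichlet_kernel M)\<bar> \<le> 10 * pi"
  using has_integral_dirichlet[OF assms(1), of M] dirichlet_primitive_bound[OF assms(2), of M]
    dirichlet_primitive_bound[OF assms(3), of M]
  by (simp add: integral_unique)

lemma integral_dirichlet_reflect_bound:
  assumes "u \<le> v" "\<bar>c - u\<bar> \<le> 3 * pi" "\<bar>c - v\<bar> \<le> 3 * pi"
  shows "\<bar>integral {u..v} (\<lambda>y. dirichlet_kernel M (c - y))\<bar> \<le> 10 * pi"
proof -
  have "((\<lambda>y. dirichlet_kernel M (c - y)) has_integral (- dirichlet_primitive M (c - v) - (- dirichlet_primitive M (c - u)))) {u..v}"
  proof (rule fundamental_theorem_of_calculus)
    fix y assume "y \<in> {u..v}"
    have "((\<lambda>y. - dirichlet_primitive M (c - y)) has_real_derivative - (dirichlet_kernel M (c - y) * (- 1))) (at y within {u..v})"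
      by (intro DERIV_minus DERIV_chain'[where f = "\<lambda>y. c - y" and g = "dirichlet_primitive M"] dirichlet_primitive_deriv)
        (auto intro!: derivative_eq_intros)
    then show "((\<lambda>y. - dirichlet_primitive M (c - y)) has_vector_derivative dirichlet_kernel M (c - y)) (at y within {u..v})"
      by (simp add: has_real_derivative_iff_has_vector_derivative)
  qed (use assms in auto)
  then show ?thesis using dirichlet_primitive_bound[OF assms(2), of M] dirichlet_primitive_bound[OF assms(3), of M]
    by (simp add: integral_unique)
qed

section \<open>Partial Fourier sums of monomials on the disc\<close>

text \<open>The inner partial sum, without normalising factor, for the monomial \<open>y^j\<close>
  on the half chord \<open>[0, s]\<close>; \<open>c\<close> is the second coordinate of the point of
  evaluation. Full chords are recovered by reflection.\<close>

definition slice_sum :: "nat \<Rightarrow> nat \<Rightarrow> real \<Rightarrow> real \<Rightarrow> real"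
  where "slice_sum j N c s = integral {0..s} (\<lambda>y. y ^ j * dirichlet_kernel N (c - y))"

lemma slice_sum_bound:
  assumes "\<bar>c\<bar> \<le> pi" "0 \<le> s" "s \<le> pi"
  shows "\<bar>slice_sum j N c s\<bar> \<le> 20 * pi ^ Suc j"
proof -
  have "\<bar>slice_sum j N c s\<bar> \<le> 2 * pi ^ j * (10 * pi)"
    unfolding slice_sum_def
  proof (rule integral_mono_mult_bound)
    show "(\<lambda>y. dirichlet_kernel N (c - y)) integrable_on {0..s}"
      by (intro integrable_continuous_real continuous_intros)
    show "\<bar>s ^ j\<bar> \<le> pi ^ j" "\<bar>0 ^ j\<bar> \<le> pi ^ j"
      using assms power_mono[of s pi j] power_mono[of 0 pi j] by auto
    show "\<bar>integral {p..q} (\<lambda>y. dirichlet_kernel N (c - y))\<bar> \<le> 10 * pi" if "0 \<le> p" "p \<le> q" "q \<le> s" for p q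
      by (intro integral_dirichlet_reflect_bound) (use that assms in linarith)+
  qed (use assms in \<open>auto intro!: power_mono\<close>)
  then show ?thesis by (simp add: mult.commute)
qed

lemma continuous_indefinite_height:
  fixes g :: "real \<Rightarrow> real"
  assumes g: "continuous_on {0..pi} g" and S: "\<And>t. t \<in> S \<Longrightarrow> \<bar>f t\<bar> \<le> pi" and f: "continuous_on S f"
  shows "continuous_on S (\<lambda>t. integral {0..disc_height (f t)} g)"
proof (rule continuous_on_compose2[where g = "\<lambda>s. integral {0..s} g" and t = "{0..pi}"])
  show "continuous_on {0..pi} (\<lambda>s. integral {0..s} g)"
    by (rule indefinite_integral_continuous_1) (rule integrable_continuous_real[OF g])
  show "continuous_on S (\<lambda>t. disc_height (f t))" by (intro continuous_intros f)
  show "(\<lambda>t. disc_height (f t)) ` S \<subseteq> {0..pi}"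
    using S disc_height_nonneg disc_height_le by auto
qed

text \<open>A Lipschitz factor \<open>w\<close> may be frozen at the centre of the kernel:
  \<open>|w t - w 0| <= L |t|\<close> cancels the size \<open>pi / |t|\<close> of the kernel, and
  the remaining factor is bounded by \<open>F\<close>.\<close>

lemma dirichlet_lipschitz_mult:
  fixes f w :: "real \<Rightarrow> real"
  assumes f: "continuous_on {-(pi/8)..pi/8} f" and w: "continuous_on {-(pi/8)..pi/8} w"
    and F: "\<And>t. \<bar>t\<bar> \<le> pi / 8 \<Longrightarrow> \<bar>f t\<bar> \<le> F"
    and L: "\<And>t. \<bar>t\<bar> \<le> pi / 8 \<Longrightarrow> \<bar>w t - w 0\<bar> \<le> L * \<bar>t\<bar>"
  shows "\<bar>integral {-(pi/8)..pi/8} (\<lambda>t. dirichlet_kernel M t * (w t * f t))\<bar>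
    \<le> \<bar>w 0\<bar> * \<bar>integral {-(pi/8)..pi/8} (\<lambda>t. dirichlet_kernel M t * f t)\<bar> + L * F * pi\<^sup>2"
proof -
  define D where "D = dirichlet_kernel M"
  have F0: "0 \<le> F" using F[of 0] by simp
  have "0 \<le> L * \<bar>pi/8\<bar>" by (rule order_trans[OF abs_ge_zero L]) simp
  then have L0: "0 \<le> L" using pi_gt_zero by (auto simp: zero_le_mult_iff)
  have contD: "continuous_on S D" for S unfolding D_def using continuous_dirichlet[of S "\<lambda>t. t" M] by simp
  have "norm (integral {-(pi/8)..pi/8} (\<lambda>t. D t * (w t - w 0) * f t)) \<le> (pi * L * F) * (pi/8 - (-(pi/8)))"
  proof (rule integral_bound)
    fix t assume "t \<in> {-(pi/8)..pi/8}"
    then have t: "\<bar>t\<bar> \<le> pi / 8" by auto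
    have "\<bar>D t\<bar> * \<bar>w t - w 0\<bar> \<le> \<bar>D t\<bar> * (L * \<bar>t\<bar>)" by (intro mult_left_mono L t) auto
    also have "\<dots> = L * (\<bar>D t\<bar> * \<bar>t\<bar>)" by simp
    also have "\<dots> \<le> L * pi"
      unfolding D_def using t pi_gt_zero L0 by (intro mult_left_mono abs_dirichlet_le) linarith+
    finally have "(\<bar>D t\<bar> * \<bar>w t - w 0\<bar>) * \<bar>f t\<bar> \<le> (L * pi) * F"
      by (rule mult_mono[OF _ F[OF t]]) (use L0 in simp_all)
    then show "norm (D t * (w t - w 0) * f t) \<le> pi * L * F" by (simp add: abs_mult mult.commute mult.left_commute)
  qed (auto intro!: continuous_intros contD f w)
  also have "\<dots> = L * F * (pi\<^sup>2 / 4)" by (simp add: power2_eq_square)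
  also have "\<dots> \<le> L * F * pi\<^sup>2" using F0 L0 by (intro mult_left_mono) auto
  finally have 1: "\<bar>integral {-(pi/8)..pi/8} (\<lambda>t. D t * (w t - w 0) * f t)\<bar> \<le> L * F * pi\<^sup>2" by simp
  have "integral {-(pi/8)..pi/8} (\<lambda>t. D t * (w t * f t)) =
      integral {-(pi/8)..pi/8} (\<lambda>t. w 0 * (D t * f t) + D t * (w t - w 0) * f t)"
    by (intro integral_cong) (simp add: algebra_simps)
  also have "\<dots> = w 0 * integral {-(pi/8)..pi/8} (\<lambda>t. D t * f t) + integral {-(pi/8)..pi/8} (\<lambda>t. D t * (w t - w 0) * f t)"
    unfolding Henstock_Kurzweil_Integration.integral_mult_right[symmetric]
    by (intro Henstock_Kurzweil_Integration.integral_add integrable_continuous_real continuous_intros contD f w)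
  finally show ?thesis using 1 unfolding D_def[symmetric]
    using abs_triangle_ineq[of "w 0 * integral {-(pi/8)..pi/8} (\<lambda>t. D t * f t)"
         "integral {-(pi/8)..pi/8} (\<lambda>t. D t * (w t - w 0) * f t)"]
    by (simp add: abs_mult)
qed

lemma power_lipschitz:
  fixes a b :: real
  assumes "\<bar>a\<bar> \<le> pi" "\<bar>b\<bar> \<le> pi"
  shows "\<bar>a ^ j - b ^ j\<bar> \<le> (real j * pi ^ (j - 1)) * \<bar>a - b\<bar>"
proof -
  have "norm (a ^ j - b ^ j) \<le> (real j * pi ^ (j - 1)) * norm (a - b)"
  proof (rule field_differentiable_bound[where S = "{-pi..pi}"])
    fix z :: real assume z: "z \<in> {-pi..pi}"
    show "((\<lambda>z. z ^ j) has_field_derivative real j * z ^ (j - 1)) (at z within {-pi..pi})"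
      by (auto intro!: derivative_eq_intros)
    have "\<bar>z\<bar> ^ (j - 1) \<le> pi ^ (j - 1)" using z by (intro power_mono) auto
    then show "norm (real j * z ^ (j - 1)) \<le> real j * pi ^ (j - 1)"
      by (simp add: abs_mult power_abs mult_left_mono)
  qed (use assms in auto)
  then show ?thesis by simp
qed

lemma indefinite_integral_lipschitz:
  fixes g :: "real \<Rightarrow> real"
  assumes g: "continuous_on {0..pi} g" and B: "\<And>y. 0 \<le> y \<Longrightarrow> y \<le> pi \<Longrightarrow> \<bar>g y\<bar> \<le> B"
    and "0 \<le> a" "a \<le> pi" "0 \<le> b" "b \<le> pi"
  shows "\<bar>integral {0..a} g - integral {0..b} g\<bar> \<le> B * \<bar>a - b\<bar>"
proof -
  have *: "\<bar>integral {0..v} g - integral {0..u} g\<bar> \<le> B * (v - u)" if "0 \<le> u" "u \<le> v" "v \<le> pi" for u v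
  proof -
    have "integral {0..u} g + integral {u..v} g = integral {0..v} g"
      using that by (intro Henstock_Kurzweil_Integration.integral_combine integrable_continuous_real continuous_on_subset[OF g]) auto
    moreover have "norm (integral {u..v} g) \<le> B * (v - u)"
      using that B by (intro integral_bound continuous_on_subset[OF g]) auto
    ultimately show ?thesis by simp
  qed
  show ?thesis
  proof (cases "a \<le> b")
    case True then show ?thesis using *[of a b] assms by (simp add: abs_minus_commute)
  next
    case False then show ?thesis using *[of b a] assms by simp
  qed
qed

text \<open>The factor \<open>k\<close> absorbs the \<open>1 / k\<close> of the integration. Of the
  three resulting terms the first oscillates with the height, the second does not depend on it and
  is present for \<open>j = 0\<close> only, as \<open>0 ^ 0 = 1\<close>, and the last is Lipschitz
  in \<open>s\<close> with a constant independent of \<open>k\<close>.\<close>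

lemma integral_power_cos_by_parts:
  fixes c k s :: real
  assumes "0 \<le> s"
  shows "k * integral {0..s} (\<lambda>y. y ^ j * cos (k * (c - y)))
    = s ^ j * sin (k * (s - c)) + 0 ^ j * sin (k * c)
      + integral {0..s} (\<lambda>y. real j * y ^ (j - 1) * sin (k * (c - y)))"
proof -
  have "((\<lambda>y. k * (y ^ j * cos (k * (c - y))) - real j * y ^ (j - 1) * sin (k * (c - y))) has_integral
      (- (s ^ j) * sin (k * (c - s)) - (- (0 ^ j) * sin (k * (c - 0))))) {0..s}"
    using assms
    by (intro fundamental_theorem_of_calculus)
      (auto intro!: derivative_eq_intros simp: has_real_derivative_iff_has_vector_derivative[symmetric] algebra_simps)
  then have "integral {0..s} (\<lambda>y. k * (y ^ j * cos (k * (c - y))) - real j * y ^ (j - 1) * sin (k * (c - y)))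
     = - (s ^ j) * sin (k * (c - s)) + 0 ^ j * sin (k * c)" by (simp add: integral_unique)
  also have "integral {0..s} (\<lambda>y. k * (y ^ j * cos (k * (c - y))) - real j * y ^ (j - 1) * sin (k * (c - y)))
     = k * integral {0..s} (\<lambda>y. y ^ j * cos (k * (c - y))) - integral {0..s} (\<lambda>y. real j * y ^ (j - 1) * sin (k * (c - y)))"
    unfolding Henstock_Kurzweil_Integration.integral_mult_right[symmetric]
    by (intro Henstock_Kurzweil_Integration.integral_diff integrable_continuous_real continuous_intros)
  also have "- (s ^ j) * sin (k * (c - s)) = s ^ j * sin (k * (s - c))"
    using sin_minus[of "k * (s - c)"] by (simp add: algebra_simps)
  finally show ?thesis by linarith
qed

text \<open>The summands answer to the three terms of the integration by parts: the oscillating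
  boundary term with its power of the height frozen, the constant term, and the Lipschitz
  remainder.\<close>

definition harmonic_bound :: "nat \<Rightarrow> real"
  where "harmonic_bound j = pi ^ j * osc_bound + 3 * (real j * pi ^ (j - 1)) * pi\<^sup>2
    + 20 * pi + (real j * pi ^ (j - 1) * pi) * (20 * pi) + 3 * (real j * pi ^ (j - 1)) * pi\<^sup>2"

text \<open>The core estimate, for a single harmonic and uniform in \<open>M\<close>,
  \<open>k\<close>, \<open>x\<close> and \<open>c\<close>. Only the oscillating boundary term draws
  on van der Corput; in the other two the factor beside the kernel is constant or Lipschitz, and the
  bounded integral of the bare kernel suffices.\<close>

lemma integral_dirichlet_harmonic_bound:
  assumes x: "\<bar>x\<bar> \<le> 3 * pi / 4" and k: "1 \<le> k"
  shows "\<bar>integral {-(pi/8)..pi/8} (\<lambda>t. dirichlet_kernel M t *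
      (k * integral {0..disc_height (x - t)} (\<lambda>y. y ^ j * cos (k * (c - y)))))\<bar> \<le> harmonic_bound j"
proof -
  define D where "D = dirichlet_kernel M"
  define E where "E s = integral {0..s} (\<lambda>y. real j * y ^ (j - 1) * sin (k * (c - y)))" for s
  define P where "P = real j * pi ^ (j - 1)"
  have P0: "0 \<le> P" by (simp add: P_def)
  let ?I = "{-(pi/8)..pi/8}"
  have rng: "\<bar>x - t\<bar> \<le> 7 * pi / 8" "\<bar>x - t\<bar> \<le> pi" if "\<bar>t\<bar> \<le> pi / 8" for t using that x pi_gt_zero by linarith+
  have h: "0 \<le> disc_height (x - t)" "disc_height (x - t) \<le> pi" if "\<bar>t\<bar> \<le> pi / 8" for t
    using disc_height_nonneg[OF rng(2)[OF that]] disc_height_le by auto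
  have hlip: "\<bar>disc_height (x - t) - disc_height (x - 0)\<bar> \<le> 3 * \<bar>t\<bar>" if "\<bar>t\<bar> \<le> pi / 8" for t
    using disc_height_lipschitz[OF rng(1)[OF that] rng(1)[of 0]] by simp
  have contD: "continuous_on S D" for S unfolding D_def using continuous_dirichlet[of S "\<lambda>t. t" M] by simp
  have contE: "continuous_on ?I (\<lambda>t. E (disc_height (x - t)))"
    unfolding E_def using rng by (intro continuous_indefinite_height continuous_intros) auto
  have Elip: "\<bar>E a - E b\<bar> \<le> P * \<bar>a - b\<bar>" if "0 \<le> a" "a \<le> pi" "0 \<le> b" "b \<le> pi" for a b
    unfolding E_def
  proof (rule indefinite_integral_lipschitz)
    fix y :: real assume y: "0 \<le> y" "y \<le> pi"
    have "\<bar>real j * y ^ (j - 1) * sin (k * (c - y))\<bar> \<le> (real j * y ^ (j - 1)) * 1"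
      unfolding abs_mult using y by (intro mult_mono) auto
    also have "\<dots> \<le> P" unfolding P_def using y by (auto intro!: mult_left_mono power_mono)
    finally show "\<bar>real j * y ^ (j - 1) * sin (k * (c - y))\<bar> \<le> P" .
  qed (use that in \<open>auto intro!: continuous_intros\<close>)
  have D0: "\<bar>integral ?I (\<lambda>t. D t * 1)\<bar> \<le> 20 * pi"
    using integral_dirichlet_bound[of "-(pi/8)" "pi/8" M] by (simp add: D_def)
  have T1: "\<bar>integral ?I (\<lambda>t. D t * (disc_height (x - t) ^ j * sin (k * (disc_height (x - t) - c))))\<bar>
    \<le> pi ^ j * osc_bound + 3 * P * 1 * pi\<^sup>2"
  proof -
    have "\<bar>integral ?I (\<lambda>t. D t * (disc_height (x - t) ^ j * sin (k * (disc_height (x - t) - c))))\<bar>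
      \<le> \<bar>disc_height (x - 0) ^ j\<bar> * \<bar>integral ?I (\<lambda>t. D t * sin (k * (disc_height (x - t) - c)))\<bar> + 3 * P * 1 * pi\<^sup>2"
      unfolding D_def
    proof (rule dirichlet_lipschitz_mult)
      fix t :: real assume t: "\<bar>t\<bar> \<le> pi / 8"
      have "\<bar>disc_height (x - t) ^ j - disc_height (x - 0) ^ j\<bar> \<le> P * \<bar>disc_height (x - t) - disc_height (x - 0)\<bar>"
        unfolding P_def using h[OF t] h[of 0] by (intro power_lipschitz) auto
      also have "\<dots> \<le> P * (3 * \<bar>t\<bar>)" by (intro mult_left_mono hlip t P0)
      finally show "\<bar>disc_height (x - t) ^ j - disc_height (x - 0) ^ j\<bar> \<le> 3 * P * \<bar>t\<bar>" by simp
    qed (auto intro!: continuous_intros)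
    also have "\<dots> \<le> pi ^ j * osc_bound + 3 * P * 1 * pi\<^sup>2"
      unfolding D_def using h[of 0]
      by (intro add_mono[OF mult_mono order_refl] integral_dirichlet_osc_bound x k) (auto intro: power_mono simp: power_abs)
    finally show ?thesis .
  qed
  have T2: "\<bar>integral ?I (\<lambda>t. D t * (0 ^ j * sin (k * c)))\<bar> \<le> 20 * pi"
  proof -
    have "integral ?I (\<lambda>t. D t * (0 ^ j * sin (k * c))) = (0 ^ j * sin (k * c)) * integral ?I (\<lambda>t. D t * 1)"
      by (simp add: mult.commute)
    also have "\<bar>\<dots>\<bar> \<le> 1 * (20 * pi)"
      unfolding abs_mult by (intro mult_mono D0) (auto intro!: mult_le_one simp: power_0_left)
    finally show ?thesis by simp
  qed
  have T3: "\<bar>integral ?I (\<lambda>t. D t * E (disc_height (x - t)))\<bar> \<le> P * pi * (20 * pi) + 3 * P * 1 * pi\<^sup>2"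
  proof -
    have "\<bar>integral ?I (\<lambda>t. D t * (E (disc_height (x - t)) * 1))\<bar>
      \<le> \<bar>E (disc_height (x - 0))\<bar> * \<bar>integral ?I (\<lambda>t. D t * 1)\<bar> + 3 * P * 1 * pi\<^sup>2"
      unfolding D_def
    proof (rule dirichlet_lipschitz_mult)
      fix t :: real assume t: "\<bar>t\<bar> \<le> pi / 8"
      have "\<bar>E (disc_height (x - t)) - E (disc_height (x - 0))\<bar> \<le> P * \<bar>disc_height (x - t) - disc_height (x - 0)\<bar>"
        using h[OF t] h[of 0] by (intro Elip) auto
      also have "\<dots> \<le> P * (3 * \<bar>t\<bar>)" by (intro mult_left_mono hlip t P0)
      finally show "\<bar>E (disc_height (x - t)) - E (disc_height (x - 0))\<bar> \<le> 3 * P * \<bar>t\<bar>" by simp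
    qed (use contE in \<open>auto intro!: continuous_intros\<close>)
    also have "\<dots> \<le> P * pi * (20 * pi) + 3 * P * 1 * pi\<^sup>2"
    proof (intro add_mono mult_mono D0)
      have "\<bar>E (disc_height (x - 0)) - E 0\<bar> \<le> P * \<bar>disc_height (x - 0) - 0\<bar>"
        using h[of 0] by (intro Elip) auto
      also have "\<dots> \<le> P * pi" using h[of 0] P0 by (intro mult_left_mono) auto
      finally show "\<bar>E (disc_height (x - 0))\<bar> \<le> P * pi" by (simp add: E_def)
    qed (use P0 in simp_all)
    finally show ?thesis by simp
  qed
  have "integral ?I (\<lambda>t. D t * (k * integral {0..disc_height (x - t)} (\<lambda>y. y ^ j * cos (k * (c - y)))))
    = integral ?I (\<lambda>t. (D t * (disc_height (x - t) ^ j * sin (k * (disc_height (x - t) - c))) + D t * (0 ^ j * sin (k * c)))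
        + D t * E (disc_height (x - t)))"
  proof (intro integral_cong)
    fix t assume "t \<in> ?I"
    then have "\<bar>t\<bar> \<le> pi / 8" by auto
    from integral_power_cos_by_parts[OF h(1)[OF this], of k j c]
    show "D t * (k * integral {0..disc_height (x - t)} (\<lambda>y. y ^ j * cos (k * (c - y)))) =
      (D t * (disc_height (x - t) ^ j * sin (k * (disc_height (x - t) - c))) + D t * (0 ^ j * sin (k * c)))
        + D t * E (disc_height (x - t))"
      by (simp only: E_def distrib_left)
  qed
  also have "\<dots> = integral ?I (\<lambda>t. D t * (disc_height (x - t) ^ j * sin (k * (disc_height (x - t) - c))) + D t * (0 ^ j * sin (k * c)))
        + integral ?I (\<lambda>t. D t * E (disc_height (x - t)))"
    by (intro Henstock_Kurzweil_Integration.integral_add integrable_continuous_real continuous_intros contD contE)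
  also have "integral ?I (\<lambda>t. D t * (disc_height (x - t) ^ j * sin (k * (disc_height (x - t) - c))) + D t * (0 ^ j * sin (k * c)))
    = integral ?I (\<lambda>t. D t * (disc_height (x - t) ^ j * sin (k * (disc_height (x - t) - c)))) + integral ?I (\<lambda>t. D t * (0 ^ j * sin (k * c)))"
    by (intro Henstock_Kurzweil_Integration.integral_add integrable_continuous_real continuous_intros contD)
  finally show ?thesis
    using T1 T2 T3 unfolding D_def[symmetric] harmonic_bound_def P_def[symmetric] by linarith
qed

text \<open>\<open>S\<close> is nondecreasing because the Fejer kernel is nonnegative, and
  \<open>disc_height (x - t)\<close> increases up to \<open>t = x\<close> and decreases afterwards.
  So the composite is monotone on at most two pieces of the window, and the second mean value
  theorem reduces each to integrals of the Dirichlet kernel.\<close>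

lemma integral_dirichlet_fejer_bound:
  assumes x: "\<bar>x\<bar> \<le> 3 * pi / 4"
  shows "\<bar>integral {-(pi/8)..pi/8} (\<lambda>t. dirichlet_kernel M t *
      integral {0..disc_height (x - t)} (\<lambda>y. y ^ j * fejer_kernel N (c - y)))\<bar> \<le> 80 * pi ^ (j + 2)"
proof -
  define S where "S s = integral {0..s} (\<lambda>y. y ^ j * fejer_kernel N (c - y))" for s
  have contF: "continuous_on A (\<lambda>y. fejer_kernel N (c - y))" for A
    unfolding fejer_kernel_def by (intro continuous_intros)
  have int: "(\<lambda>y. y ^ j * fejer_kernel N (c - y)) integrable_on {u..v}" "(\<lambda>y. fejer_kernel N (c - y)) integrable_on {u..v}" for u v
    by (intro integrable_continuous_real continuous_intros contF)+
  have mono: "S u \<le> S v" if "0 \<le> u" "u \<le> v" for u v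
    unfolding S_def using that fejer_kernel_nonneg
    by (intro integral_subset_le int) auto
  have S0: "0 \<le> S u" for u
    unfolding S_def using fejer_kernel_nonneg by (intro integral_nonneg int) auto
  have Sle: "S u \<le> 2 * pi ^ Suc j" if "0 \<le> u" "u \<le> pi" for u
  proof -
    have "S u \<le> integral {0..u} (\<lambda>y. pi ^ j * fejer_kernel N (c - y))"
      unfolding S_def using that fejer_kernel_nonneg
      by (intro integral_le int integrable_on_mult_right mult_right_mono power_mono) auto
    also have "\<dots> = pi ^ j * integral {0..u} (\<lambda>y. fejer_kernel N (c - y))" by simp
    also have "\<dots> \<le> pi ^ j * (2 * pi)" using that by (intro mult_left_mono integral_fejer_bound) auto
    finally show ?thesis by (simp add: mult.commute mult.left_commute)
  qed
  \<comment> \<open>The turning point \<open>t = x\<close> of the height, clamped to the window. If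
    clamping moves it, one of the two pieces is a single point, which is why the monotonicity proofs
    below set \<open>s = t\<close> aside.\<close>
  define w where "w = max (- (pi/8)) (min (pi/8) x)"
  have w: "- (pi/8) \<le> w" "w \<le> pi/8" "w \<noteq> - (pi/8) \<longrightarrow> w \<le> x" "w \<noteq> pi/8 \<longrightarrow> x \<le> w"
    unfolding w_def using pi_gt_zero by (simp_all add: max_def min_def)
  have rng: "\<bar>x - t\<bar> \<le> pi" if "-(pi/8) \<le> t" "t \<le> pi/8" for t using that x pi_gt_zero by linarith
  have Sh: "\<bar>S (disc_height (x - t))\<bar> \<le> 2 * pi ^ Suc j" if "-(pi/8) \<le> t" "t \<le> pi/8" for t
    using S0[of "disc_height (x - t)"] Sle[of "disc_height (x - t)"] disc_height_nonneg[OF rng[OF that]] disc_height_le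
    by (auto simp del: power_Suc)
  have D: "\<bar>integral {u..v} (dirichlet_kernel M)\<bar> \<le> 10 * pi" if "-(pi/8) \<le> u" "u \<le> v" "v \<le> pi/8" for u v
    using that pi_gt_zero by (intro integral_dirichlet_bound) linarith+
  have intD: "dirichlet_kernel M integrable_on {u..v}" for u v
    using continuous_dirichlet[of "{u..v}" "\<lambda>t. t" M] by (intro integrable_continuous_real) simp
  have Sb: "\<bar>S (disc_height (x - - (pi/8)))\<bar> \<le> 2 * pi ^ Suc j" "\<bar>S (disc_height (x - w))\<bar> \<le> 2 * pi ^ Suc j"
    "\<bar>S (disc_height (x - pi/8))\<bar> \<le> 2 * pi ^ Suc j" "\<bar>- S (disc_height (x - w))\<bar> \<le> 2 * pi ^ Suc j"
    "\<bar>- S (disc_height (x - pi/8))\<bar> \<le> 2 * pi ^ Suc j"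
    unfolding abs_minus_cancel using w by (intro Sh; linarith)+
  have 1: "\<bar>integral {-(pi/8)..w} (\<lambda>t. S (disc_height (x - t)) * dirichlet_kernel M t)\<bar> \<le> 2 * (2 * pi ^ Suc j) * (10 * pi)"
  proof (rule integral_mono_mult_bound[OF intD w(1)])
    fix s t assume st: "- (pi/8) \<le> s" "s \<le> t" "t \<le> w"
    show "S (disc_height (x - s)) \<le> S (disc_height (x - t))"
    proof (cases "s = t")
      case False
      then have "w \<le> x" using w st by auto
      then show ?thesis using st w rng[of s]
        by (intro mono disc_height_nonneg disc_height_antimono) linarith+
    qed simp
    show "\<bar>integral {s..t} (dirichlet_kernel M)\<bar> \<le> 10 * pi"
      using st w by (intro D) linarith+
  qed (fact Sb)+
  \<comment> \<open>The height decreases on this piece, so the monotone factor is taken with a minus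
    sign.\<close>
  have 2: "\<bar>integral {w..pi/8} (\<lambda>t. - S (disc_height (x - t)) * dirichlet_kernel M t)\<bar> \<le> 2 * (2 * pi ^ Suc j) * (10 * pi)"
  proof (rule integral_mono_mult_bound[OF intD w(2)])
    fix s t assume st: "w \<le> s" "s \<le> t" "t \<le> pi/8"
    show "- S (disc_height (x - s)) \<le> - S (disc_height (x - t))"
    proof (cases "s = t")
      case False
      then have "x \<le> w" using w st by auto
      then have "S (disc_height (x - t)) \<le> S (disc_height (x - s))" using st w rng[of t]
        by (intro mono disc_height_nonneg disc_height_antimono) linarith+
      then show ?thesis by simp
    qed simp
    show "\<bar>integral {s..t} (dirichlet_kernel M)\<bar> \<le> 10 * pi"
      using st w by (intro D) linarith+
  qed (fact Sb)+
  have cont: "continuous_on {-(pi/8)..pi/8} (\<lambda>t. S (disc_height (x - t)) * dirichlet_kernel M t)"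
    unfolding S_def by (intro continuous_intros continuous_indefinite_height contF) (use rng in auto)
  have "integral {-(pi/8)..pi/8} (\<lambda>t. S (disc_height (x - t)) * dirichlet_kernel M t)
    = integral {-(pi/8)..w} (\<lambda>t. S (disc_height (x - t)) * dirichlet_kernel M t)
      + integral {w..pi/8} (\<lambda>t. S (disc_height (x - t)) * dirichlet_kernel M t)"
    using w by (intro Henstock_Kurzweil_Integration.integral_combine[symmetric] integrable_continuous_real cont) auto
  moreover have "\<bar>integral {w..pi/8} (\<lambda>t. S (disc_height (x - t)) * dirichlet_kernel M t)\<bar> \<le> 2 * (2 * pi ^ Suc j) * (10 * pi)"
    using 2 by (simp only: mult_minus_left Henstock_Kurzweil_Integration.integral_neg abs_minus_cancel)
  moreover have "\<bar>A + B\<bar> \<le> X + X" if "\<bar>A\<bar> \<le> X" "\<bar>B\<bar> \<le> X" for A B X :: real using that by linarith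
  ultimately have "\<bar>integral {-(pi/8)..pi/8} (\<lambda>t. S (disc_height (x - t)) * dirichlet_kernel M t)\<bar>
     \<le> 2 * (2 * pi ^ Suc j) * (10 * pi) + 2 * (2 * pi ^ Suc j) * (10 * pi)"
    using 1 by presburger
  then show ?thesis by (simp add: S_def mult.commute mult.left_commute)
qed

text \<open>Coefficientwise \<open>2 - 2 (1 - k / (N + 1)) = 2 k / (N + 1)\<close>, which is what
  the Dirichlet kernel has over the Fejer kernel at frequency \<open>k\<close>.\<close>

lemma slice_sum_decompose:
  assumes "0 \<le> s"
  shows "slice_sum j N c s = integral {0..s} (\<lambda>y. y ^ j * fejer_kernel N (c - y))
    + (\<Sum>k\<in>{1..N}. 2 / (real N + 1) * (real k * integral {0..s} (\<lambda>y. y ^ j * cos (real k * (c - y)))))"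
proof -
  have contF: "continuous_on A (\<lambda>y. fejer_kernel N (c - y))" for A
    unfolding fejer_kernel_def by (intro continuous_intros)
  have "y ^ j * dirichlet_kernel N (c - y) = y ^ j * fejer_kernel N (c - y)
      + (\<Sum>k\<in>{1..N}. 2 / (real N + 1) * (real k * (y ^ j * cos (real k * (c - y)))))" for y
    by (simp add: dirichlet_kernel_def fejer_kernel_def algebra_simps sum_distrib_left sum_subtractf)
  then have "slice_sum j N c s = integral {0..s} (\<lambda>y. y ^ j * fejer_kernel N (c - y)
      + (\<Sum>k\<in>{1..N}. 2 / (real N + 1) * (real k * (y ^ j * cos (real k * (c - y))))))"
    by (simp add: slice_sum_def)
  also have "\<dots> = integral {0..s} (\<lambda>y. y ^ j * fejer_kernel N (c - y))
    + integral {0..s} (\<lambda>y. \<Sum>k\<in>{1..N}. 2 / (real N + 1) * (real k * (y ^ j * cos (real k * (c - y)))))"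
    by (intro Henstock_Kurzweil_Integration.integral_add integrable_continuous_real continuous_intros contF)
  also have "integral {0..s} (\<lambda>y. \<Sum>k\<in>{1..N}. 2 / (real N + 1) * (real k * (y ^ j * cos (real k * (c - y)))))
    = (\<Sum>k\<in>{1..N}. integral {0..s} (\<lambda>y. 2 / (real N + 1) * (real k * (y ^ j * cos (real k * (c - y))))))"
    by (intro Henstock_Kurzweil_Integration.integral_sum integrable_continuous_real continuous_intros) auto
  finally show ?thesis by simp
qed

definition near_bound :: "nat \<Rightarrow> real"
  where "near_bound j = 80 * pi ^ (j + 2) + 2 * harmonic_bound j"

text \<open>The splitting leaves \<open>N\<close> harmonics, each at most
  \<open>harmonic_bound j\<close> and weighted by \<open>2 / (N + 1)\<close>, so together they stay
  below twice that bound for every \<open>N\<close>.\<close>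

lemma integral_dirichlet_slice_near:
  assumes x: "\<bar>x\<bar> \<le> 3 * pi / 4"
  shows "\<bar>integral {-(pi/8)..pi/8} (\<lambda>t. dirichlet_kernel M t * slice_sum j N c (disc_height (x - t)))\<bar> \<le> near_bound j"
proof -
  let ?I = "{-(pi/8)..pi/8}"
  define D where "D = dirichlet_kernel M"
  define F where "F t = integral {0..disc_height (x - t)} (\<lambda>y. y ^ j * fejer_kernel N (c - y))" for t
  define H where "H k t = integral {0..disc_height (x - t)} (\<lambda>y. y ^ j * cos (real k * (c - y)))" for k t
  have rng: "\<bar>x - t\<bar> \<le> pi" if "t \<in> ?I" for t using that x pi_gt_zero by (simp only: atLeastAtMost_iff) linarith
  have contF: "continuous_on ?I F"
    unfolding F_def fejer_kernel_def using rng by (intro continuous_indefinite_height continuous_intros)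
  have contH: "continuous_on ?I (H k)" for k
    unfolding H_def using rng by (intro continuous_indefinite_height continuous_intros)
  have contD: "continuous_on S D" for S unfolding D_def using continuous_dirichlet[of S "\<lambda>t. t" M] by simp
  have Hb: "\<bar>integral ?I (\<lambda>t. D t * (real k * H k t))\<bar> \<le> harmonic_bound j" if "k \<in> {1..N}" for k
    unfolding D_def H_def using that by (intro integral_dirichlet_harmonic_bound x) auto
  have Hb0: "0 \<le> harmonic_bound j"
    unfolding harmonic_bound_def osc_bound_def by simp
  have "integral ?I (\<lambda>t. D t * slice_sum j N c (disc_height (x - t)))
    = integral ?I (\<lambda>t. D t * F t + (\<Sum>k\<in>{1..N}. 2 / (real N + 1) * (D t * (real k * H k t))))"
  proof (intro integral_cong)
    fix t assume "t \<in> ?I"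
    have "slice_sum j N c (disc_height (x - t)) = F t + (\<Sum>k\<in>{1..N}. 2 / (real N + 1) * (real k * H k t))"
      unfolding F_def H_def by (intro slice_sum_decompose disc_height_nonneg rng \<open>t \<in> ?I\<close>)
    then show "D t * slice_sum j N c (disc_height (x - t)) = D t * F t + (\<Sum>k\<in>{1..N}. 2 / (real N + 1) * (D t * (real k * H k t)))"
      by (simp add: distrib_left sum_distrib_left mult.left_commute)
  qed
  also have "\<dots> = integral ?I (\<lambda>t. D t * F t) + integral ?I (\<lambda>t. \<Sum>k\<in>{1..N}. 2 / (real N + 1) * (D t * (real k * H k t)))"
    by (intro Henstock_Kurzweil_Integration.integral_add integrable_continuous_real continuous_intros contF contD contH)
  also have "integral ?I (\<lambda>t. \<Sum>k\<in>{1..N}. 2 / (real N + 1) * (D t * (real k * H k t)))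
    = (\<Sum>k\<in>{1..N}. integral ?I (\<lambda>t. 2 / (real N + 1) * (D t * (real k * H k t))))"
    by (intro Henstock_Kurzweil_Integration.integral_sum integrable_continuous_real continuous_intros contD contH) auto
  also have "\<dots> = (\<Sum>k\<in>{1..N}. 2 / (real N + 1) * integral ?I (\<lambda>t. D t * (real k * H k t)))"
    by (intro sum.cong refl Henstock_Kurzweil_Integration.integral_mult_right)
  finally have eq: "integral ?I (\<lambda>t. D t * slice_sum j N c (disc_height (x - t)))
    = integral ?I (\<lambda>t. D t * F t) + (\<Sum>k\<in>{1..N}. 2 / (real N + 1) * integral ?I (\<lambda>t. D t * (real k * H k t)))" .
  have "\<bar>\<Sum>k\<in>{1..N}. 2 / (real N + 1) * integral ?I (\<lambda>t. D t * (real k * H k t))\<bar>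
     \<le> (\<Sum>k\<in>{1..N}. 2 / (real N + 1) * harmonic_bound j)"
  proof (intro order_trans[OF sum_abs] sum_mono)
    fix k assume "k \<in> {1..N}"
    then show "\<bar>2 / (real N + 1) * integral ?I (\<lambda>t. D t * (real k * H k t))\<bar> \<le> 2 / (real N + 1) * harmonic_bound j"
      using mult_left_mono[OF Hb, of k "2 / (real N + 1)"] by (simp add: abs_mult)
  qed
  also have "\<dots> = 2 * harmonic_bound j * (real N / (real N + 1))" by simp
  also have "\<dots> \<le> 2 * harmonic_bound j * 1" using Hb0 by (intro mult_left_mono) auto
  finally have "\<bar>\<Sum>k\<in>{1..N}. 2 / (real N + 1) * integral ?I (\<lambda>t. D t * (real k * H k t))\<bar> \<le> 2 * harmonic_bound j" by simp
  moreover have "\<bar>integral ?I (\<lambda>t. D t * F t)\<bar> \<le> 80 * pi ^ (j + 2)"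
    unfolding D_def F_def by (rule integral_dirichlet_fejer_bound[OF x])
  ultimately show ?thesis
    unfolding D_def[symmetric] near_bound_def eq by linarith
qed

text \<open>On this range \<open>sin (t / 2) >= 1 / 8\<close>. The upper limit is
  \<open>3 pi / 4 + pi\<close>: with the point of evaluation at most \<open>3 pi / 4\<close> from
  the centre, \<open>x - y\<close> keeps distance \<open>pi / 4\<close> from the next peak of the
  kernel at \<open>2 pi\<close>.\<close>

lemma abs_dirichlet_far:
  assumes "pi / 8 \<le> \<bar>t\<bar>" "\<bar>t\<bar> \<le> 7 * pi / 4"
  shows "\<bar>dirichlet_kernel M t\<bar> \<le> 8"
proof -
  have *: "\<bar>dirichlet_kernel M t\<bar> \<le> 8" if t: "pi / 8 \<le> t" "t \<le> 7 * pi / 4" for t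
  proof -
    have "1 / 8 \<le> sin (t / 2)"
    proof (cases "t \<le> pi")
      case True
      then have "2 * (t/2) / pi \<le> sin (t/2)" using t pi_gt_zero by (intro sin_ge_chord) linarith+
      moreover have "1/8 \<le> 2 * (t/2) / pi" using t by (simp add: field_simps)
      ultimately show ?thesis by linarith
    next
      case False
      then have "2 * (pi - t/2) / pi \<le> sin (pi - t/2)" using t pi_gt_zero by (intro sin_ge_chord) linarith+
      moreover have "1/8 \<le> 2 * (pi - t/2) / pi" using t by (simp add: field_simps)
      ultimately have "1/8 \<le> sin (pi - t/2)" by linarith
      then show ?thesis by (simp only: sin_pi_minus)
    qed
    then have "\<bar>dirichlet_kernel M t\<bar> * (1/8) \<le> \<bar>dirichlet_kernel M t\<bar> * \<bar>sin (t/2)\<bar>"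
      by (intro mult_left_mono) auto
    also have "\<dots> = \<bar>sin ((real M + 1/2) * t)\<bar>"
      unfolding sin_half_dirichlet[symmetric] by (simp add: abs_mult)
    also have "\<dots> \<le> 1" by simp
    finally show ?thesis by simp
  qed
  show ?thesis using *[of t] *[of "- t"] assms by (cases "t \<ge> 0") (auto simp: dirichlet_minus)
qed

text \<open>Inside the window the power \<open>y^i\<close> is frozen at the point of evaluation,
  which gives the first two summands; the last is the trivial bound on the two remaining parts of
  the interval.\<close>

definition slice_bound :: "nat \<Rightarrow> nat \<Rightarrow> real"
  where "slice_bound i j = pi ^ i * near_bound j + real i * pi ^ (i - 1) * (20 * pi ^ Suc j) * pi\<^sup>2
    + 2 * ((8 * pi ^ i * (20 * pi ^ Suc j)) * (2 * pi))"

lemma integral_dirichlet_slice: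
  assumes x: "\<bar>x\<bar> \<le> 3 * pi / 4" and c: "\<bar>c\<bar> \<le> pi"
  shows "\<bar>integral {-pi..pi} (\<lambda>y. dirichlet_kernel M (x - y) * (y ^ i * slice_sum j N c (disc_height y)))\<bar>
    \<le> slice_bound i j"
proof -
  define f where "f y = slice_sum j N c (disc_height y)" for y
  define G where "G y = dirichlet_kernel M (x - y) * (y ^ i * f y)" for y
  have fb: "\<bar>f y\<bar> \<le> 20 * pi ^ Suc j" if "\<bar>y\<bar> \<le> pi" for y
    unfolding f_def by (intro slice_sum_bound c disc_height_nonneg disc_height_le that)
  have contf: "continuous_on {-pi..pi} f"
    unfolding f_def slice_sum_def by (intro continuous_indefinite_height continuous_intros) auto
  have contG: "continuous_on {-pi..pi} G" unfolding G_def by (intro continuous_intros contf)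
  have cont': "continuous_on {u..v} G" if "-pi \<le> u" "v \<le> pi" for u v
    by (rule continuous_on_subset[OF contG]) (use that in auto)
  have far: "\<bar>integral {u..v} G\<bar> \<le> (8 * pi ^ i * (20 * pi ^ Suc j)) * (2 * pi)"
    if uv: "-pi \<le> u" "u \<le> v" "v \<le> pi" and "\<And>y. u \<le> y \<Longrightarrow> y \<le> v \<Longrightarrow> pi / 8 \<le> \<bar>x - y\<bar>" for u v
  proof -
    have "norm (integral {u..v} G) \<le> (8 * pi ^ i * (20 * pi ^ Suc j)) * (v - u)"
    proof (rule integral_bound[OF uv(2) cont'[OF uv(1,3)]])
      fix y assume "y \<in> {u..v}"
      then have y: "u \<le> y" "y \<le> v" by auto
      then have ypi: "\<bar>y\<bar> \<le> pi" using uv by linarith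
      have "\<bar>y\<bar> ^ i \<le> pi ^ i" using ypi by (intro power_mono) auto
      then have "\<bar>y ^ i\<bar> \<le> pi ^ i" by (simp add: power_abs)
      moreover have "\<bar>dirichlet_kernel M (x - y)\<bar> \<le> 8"
        by (rule abs_dirichlet_far[OF that(4)[OF y]]) (use x ypi in linarith)
      ultimately have "\<bar>dirichlet_kernel M (x - y)\<bar> * (\<bar>y ^ i\<bar> * \<bar>f y\<bar>) \<le> 8 * (pi ^ i * (20 * pi ^ Suc j))"
        using fb[OF ypi] by (intro mult_mono) auto
      then show "norm (G y) \<le> 8 * pi ^ i * (20 * pi ^ Suc j)" by (simp add: G_def abs_mult mult.assoc)
    qed
    also have "\<dots> \<le> (8 * pi ^ i * (20 * pi ^ Suc j)) * (2 * pi)" using uv by (intro mult_left_mono) auto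
    finally show ?thesis by simp
  qed
  have px: "-pi \<le> x - pi/8" "x + pi/8 \<le> pi" using x pi_gt_zero by linarith+
  have mid: "\<bar>integral {x-pi/8..x+pi/8} G\<bar> \<le> pi ^ i * near_bound j + real i * pi ^ (i - 1) * (20 * pi ^ Suc j) * pi\<^sup>2"
  proof -
    have rng: "\<bar>x - t\<bar> \<le> pi" if "\<bar>t\<bar> \<le> pi/8" for t using that x pi_gt_zero by linarith
    have "integral {x-pi/8..x+pi/8} G = integral {-(pi/8)..pi/8} (\<lambda>t. G (t + x))"
      using integral_shift_real_ivl[of "x - pi/8" x "x+pi/8" G] by simp
    also have "\<dots> = integral {-(pi/8)..pi/8} (\<lambda>t. G (- t + x))"
      using Henstock_Kurzweil_Integration.integral_reflect_real[of "pi/8" "-(pi/8)" "\<lambda>t. G (t + x)"] by simp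
    also have "\<dots> = integral {-(pi/8)..pi/8} (\<lambda>t. dirichlet_kernel M t * ((x - t) ^ i * f (x - t)))"
      by (simp add: G_def)
    also have "\<bar>\<dots>\<bar> \<le> \<bar>(x - 0) ^ i\<bar> * \<bar>integral {-(pi/8)..pi/8} (\<lambda>t. dirichlet_kernel M t * f (x - t))\<bar>
        + (real i * pi ^ (i - 1)) * (20 * pi ^ Suc j) * pi\<^sup>2"
    proof (rule dirichlet_lipschitz_mult)
      show "continuous_on {- (pi / 8)..pi / 8} (\<lambda>t. f (x - t))"
        by (rule continuous_on_compose2[OF contf]) (use px in \<open>auto intro!: continuous_intros\<close>)
      fix t :: real assume t: "\<bar>t\<bar> \<le> pi/8"
      show "\<bar>f (x - t)\<bar> \<le> 20 * pi ^ Suc j" by (intro fb rng t)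
      show "\<bar>(x - t) ^ i - (x - 0) ^ i\<bar> \<le> (real i * pi ^ (i - 1)) * \<bar>t\<bar>"
        using power_lipschitz[OF rng[OF t] rng[of 0], of i] by simp
    qed (auto intro!: continuous_intros)
    also have "\<dots> \<le> pi ^ i * near_bound j + real i * pi ^ (i - 1) * (20 * pi ^ Suc j) * pi\<^sup>2"
    proof (intro add_mono[OF mult_mono order_refl])
      have "\<bar>x\<bar> ^ i \<le> pi ^ i" using x pi_gt_zero by (intro power_mono) linarith+
      then show "\<bar>(x - 0) ^ i\<bar> \<le> pi ^ i" by (simp add: power_abs)
      show "\<bar>integral {-(pi/8)..pi/8} (\<lambda>t. dirichlet_kernel M t * f (x - t))\<bar> \<le> near_bound j"
        unfolding f_def by (rule integral_dirichlet_slice_near[OF x])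
    qed auto
    finally show ?thesis .
  qed
  have "integral {-pi..pi} G = integral {-pi..x+pi/8} G + integral {x+pi/8..pi} G"
    using px pi_gt_zero x by (intro Henstock_Kurzweil_Integration.integral_combine[symmetric] integrable_continuous_real contG) linarith+
  also have "integral {-pi..x+pi/8} G = integral {-pi..x-pi/8} G + integral {x-pi/8..x+pi/8} G"
    using px pi_gt_zero by (intro Henstock_Kurzweil_Integration.integral_combine[symmetric] integrable_continuous_real cont') linarith+
  finally have "integral {-pi..pi} G = integral {-pi..x-pi/8} G + integral {x-pi/8..x+pi/8} G + integral {x+pi/8..pi} G" .
  moreover have "\<bar>integral {-pi..x-pi/8} G\<bar> \<le> (8 * pi ^ i * (20 * pi ^ Suc j)) * (2 * pi)"
    using px pi_gt_zero x by (intro far) linarith+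
  moreover have "\<bar>integral {x+pi/8..pi} G\<bar> \<le> (8 * pi ^ i * (20 * pi ^ Suc j)) * (2 * pi)"
    using px pi_gt_zero x by (intro far) linarith+
  ultimately show ?thesis using mid unfolding G_def f_def slice_bound_def by linarith
qed

text \<open>Substituting \<open>- y\<close> on the lower half chord and using that the kernel is
  even turns it into an upper half chord seen from \<open>- c\<close>.\<close>

lemma integral_symmetric_slice:
  assumes "0 \<le> h"
  shows "integral {-h..h} (\<lambda>y. y ^ j * dirichlet_kernel N (c - y))
    = slice_sum j N c h + (-1) ^ j * slice_sum j N (- c) h"
proof -
  have "integral {-h..h} (\<lambda>y. y ^ j * dirichlet_kernel N (c - y))
    = integral {0..h} (\<lambda>y. y ^ j * dirichlet_kernel N (c - y) + (- y) ^ j * dirichlet_kernel N (c - (- y)))"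
    by (intro integral_even_part continuous_intros assms)
  also have "\<dots> = integral {0..h} (\<lambda>y. y ^ j * dirichlet_kernel N (c - y) + (-1) ^ j * (y ^ j * dirichlet_kernel N (- c - y)))"
  proof (intro integral_cong)
    fix y :: real
    have "dirichlet_kernel N (c - (- y)) = dirichlet_kernel N (- c - y)"
      using dirichlet_minus[of N "c - (- y)"] by simp
    then show "y ^ j * dirichlet_kernel N (c - y) + (- y) ^ j * dirichlet_kernel N (c - (- y))
      = y ^ j * dirichlet_kernel N (c - y) + (-1) ^ j * (y ^ j * dirichlet_kernel N (- c - y))"
      by (simp add: power_minus[of y])
  qed
  also have "\<dots> = integral {0..h} (\<lambda>y. y ^ j * dirichlet_kernel N (c - y)) +
      integral {0..h} (\<lambda>y. (-1) ^ j * (y ^ j * dirichlet_kernel N (- c - y)))"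
    by (intro Henstock_Kurzweil_Integration.integral_add integrable_continuous_real continuous_intros)
  finally show ?thesis by (simp add: slice_sum_def)
qed

text \<open>The estimate for full chords. Only the first coordinate is kept away from the ends of
  its range; the opposite case is reached later by exchanging the coordinates.\<close>

proposition disc_partial_sum_bound:
  assumes x: "\<bar>x1\<bar> \<le> 3 * pi / 4" and c: "\<bar>x2\<bar> \<le> pi"
  shows "\<bar>integral {-pi..pi} (\<lambda>y1. dirichlet_kernel M (x1 - y1) * (y1 ^ i *
      integral {-disc_height y1..disc_height y1} (\<lambda>y2. y2 ^ j * dirichlet_kernel N (x2 - y2))))\<bar>
    \<le> 2 * slice_bound i j"
proof -
  define G where "G c y = dirichlet_kernel M (x1 - y) * (y ^ i * slice_sum j N c (disc_height y))" for c y
  have int: "G c integrable_on {-pi..pi}" for c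
    unfolding G_def slice_sum_def
    by (intro integrable_continuous_real continuous_intros continuous_indefinite_height) auto
  have "integral {-pi..pi} (\<lambda>y1. dirichlet_kernel M (x1 - y1) * (y1 ^ i *
      integral {-disc_height y1..disc_height y1} (\<lambda>y2. y2 ^ j * dirichlet_kernel N (x2 - y2))))
    = integral {-pi..pi} (\<lambda>y. G x2 y + (-1) ^ j * G (- x2) y)"
  proof (intro integral_cong)
    fix y assume "y \<in> {-pi..pi}"
    then have "0 \<le> disc_height y" by (intro disc_height_nonneg) auto
    then show "dirichlet_kernel M (x1 - y) * (y ^ i *
      integral {-disc_height y..disc_height y} (\<lambda>y2. y2 ^ j * dirichlet_kernel N (x2 - y2))) = G x2 y + (-1) ^ j * G (- x2) y"
      by (simp add: integral_symmetric_slice G_def algebra_simps)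
  qed
  also have "\<dots> = integral {-pi..pi} (G x2) + (-1) ^ j * integral {-pi..pi} (G (- x2))"
    unfolding Henstock_Kurzweil_Integration.integral_mult_right[symmetric]
    by (intro Henstock_Kurzweil_Integration.integral_add integrable_on_mult_right int)
  also have "\<bar>\<dots>\<bar> \<le> \<bar>integral {-pi..pi} (G x2)\<bar> + \<bar>integral {-pi..pi} (G (- x2))\<bar>"
    using abs_triangle_ineq[of "integral {-pi..pi} (G x2)" "(-1) ^ j * integral {-pi..pi} (G (- x2))"]
    by (simp add: abs_mult power_abs)
  also have "\<dots> \<le> slice_bound i j + slice_bound i j"
    unfolding G_def by (intro add_mono integral_dirichlet_slice x) (use c in auto)
  finally show ?thesis by simp
qed

section \<open>Polar coordinates\<close>

lemma borel_measurable_trig [measurable (raw)]: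
  fixes f :: "'a \<Rightarrow> real"
  assumes "f \<in> borel_measurable M"
  shows "(\<lambda>x. cos (f x)) \<in> borel_measurable M" "(\<lambda>x. sin (f x)) \<in> borel_measurable M"
    "(\<lambda>x. tan (f x)) \<in> borel_measurable M"
proof -
  have [measurable]: "(cos :: real \<Rightarrow> real) \<in> borel_measurable borel" "(sin :: real \<Rightarrow> real) \<in> borel_measurable borel"
    by (intro borel_measurable_continuous_onI continuous_intros)+
  note [measurable] = assms
  show "(\<lambda>x. cos (f x)) \<in> borel_measurable M" "(\<lambda>x. sin (f x)) \<in> borel_measurable M" by measurable
  show "(\<lambda>x. tan (f x)) \<in> borel_measurable M" unfolding tan_def by measurable
qed

lemma nn_integral_shift_Ico:
  fixes F :: "real \<Rightarrow> ennreal"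
  assumes [measurable]: "F \<in> borel_measurable borel"
  shows "(\<integral>\<^sup>+t. F (t + s) * indicator {a..<b} t \<partial>lborel) = (\<integral>\<^sup>+t. F t * indicator {a + s..<b + s} t \<partial>lborel)"
proof -
  have "(\<integral>\<^sup>+t. F t * indicator {a + s..<b + s} t \<partial>lborel)
    = ennreal \<bar>1::real\<bar> * (\<integral>\<^sup>+t. F (s + 1 * t) * indicator {a + s..<b + s} (s + 1 * t) \<partial>lborel)"
    by (rule nn_integral_real_affine) auto
  also have "\<dots> = (\<integral>\<^sup>+t. F (t + s) * indicator {a..<b} t \<partial>lborel)"
    by (auto simp: add.commute intro!: nn_integral_cong split: split_indicator)
  finally show ?thesis by simp
qed

text \<open>The shifted quarters cover \<open>[- pi / 4, 7 pi / 4)\<close>, and periodicity moves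
  the piece below 0 to the upper end.\<close>

lemma nn_integral_periodic_quarters:
  fixes F :: "real \<Rightarrow> ennreal"
  assumes [measurable]: "F \<in> borel_measurable borel" and per: "\<And>t. F (t + 2 * pi) = F t"
  shows "(\<integral>\<^sup>+t. F t * indicator {0..<2*pi} t \<partial>lborel)
    = (\<Sum>k<4. \<integral>\<^sup>+t. F (t + real k * (pi/2)) * indicator {-(pi/4)..<pi/4} t \<partial>lborel)"
proof -
  let ?I = "\<lambda>a b. \<integral>\<^sup>+t. F t * indicator {a..<b} t \<partial>lborel"
  have join: "?I a b + ?I b c = ?I a c" if "a \<le> b" "b \<le> c" for a b c :: real
    by (subst nn_integral_add[symmetric]) (use that in \<open>auto intro!: nn_integral_cong split: split_indicator\<close>)
  have "(\<Sum>k<4. \<integral>\<^sup>+t. F (t + real k * (pi/2)) * indicator {-(pi/4)..<pi/4} t \<partial>lborel)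
    = (\<Sum>k<4. ?I (-(pi/4) + real k * (pi/2)) (pi/4 + real k * (pi/2)))"
    by (intro sum.cong refl nn_integral_shift_Ico) auto
  also have "\<dots> = ?I (-(pi/4)) (pi/4) + ?I (pi/4) (3*pi/4) + ?I (3*pi/4) (5*pi/4) + ?I (5*pi/4) (7*pi/4)"
    by (simp add: eval_nat_numeral field_simps)
  also have "\<dots> = ?I (-(pi/4)) (7*pi/4)" by (simp add: join)
  also have "\<dots> = ?I (-(pi/4)) 0 + ?I 0 (7*pi/4)" by (simp add: join)
  also have "?I (-(pi/4)) 0 = (\<integral>\<^sup>+t. F (t + 2*pi) * indicator {-(pi/4)..<0} t \<partial>lborel)" by (simp add: per)
  also have "\<dots> = ?I (7*pi/4) (2*pi)" by (subst nn_integral_shift_Ico) auto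
  also have "?I (7*pi/4) (2*pi) + ?I 0 (7*pi/4) = ?I 0 (2*pi)" by (subst add.commute) (simp add: join)
  finally show ?thesis by simp
qed

text \<open>A quarter of the plane in which \<open>y = x tan t\<close> is a smooth substitution with
  bounded \<open>tan t\<close>. It contains exactly one of its two boundary rays, so that its four
  quarter turns tile the punctured plane without overlap.\<close>

definition sector :: "(real \<times> real) set"
  where "sector = {p. 0 < fst p \<and> - fst p \<le> snd p \<and> snd p < fst p}"

lemma sector_measurable [measurable]: "sector \<in> sets borel"
proof -
  have "sector = {p \<in> space borel. 0 < fst p \<and> - fst p \<le> snd p \<and> snd p < fst p}" by (simp add: sector_def)
  also have "\<dots> \<in> sets borel" unfolding borel_prod[symmetric] by measurable
  finally show ?thesis .
qed

text \<open>For fixed \<open>x\<close> the second coordinate is traded for the angle. The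
  substitution rule works on closed intervals, so the half open ones are closed and opened again at
  the cost of single points, which are null.\<close>

lemma nn_integral_polar_slice:
  fixes f :: "real \<times> real \<Rightarrow> ennreal"
  assumes [measurable]: "f \<in> borel_measurable borel" and x: "0 < x"
  shows "(\<integral>\<^sup>+y. f (x, y) * indicator {- x..<x} y \<partial>lborel)
    = (\<integral>\<^sup>+t. f (x, x * tan t) * ennreal (x / (cos t)\<^sup>2) * indicator {-(pi/4)..<pi/4} t \<partial>lborel)"
proof -
  have cospos: "0 < cos t" if "t \<in> {-(pi/4)..pi/4}" for t
    using that pi_gt_zero by (intro cos_gt_zero_pi) (simp_all only: atLeastAtMost_iff, linarith+)
  have "(\<integral>\<^sup>+y. f (x, y) * indicator {- x..<x} y \<partial>lborel) = (\<integral>\<^sup>+y. f (x, y) * indicator {x * tan (-(pi/4))..x * tan (pi/4)} y \<partial>lborel)"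
  proof -
    have tan: "x * tan (-(pi/4)) = - x" "x * tan (pi/4) = x" by (simp_all only: tan_minus tan_45 mult_minus_right mult_1_right)
    show ?thesis unfolding tan
    proof (rule nn_integral_cong_AE, rule AE_mp[OF AE_lborel_singleton[of x]], rule AE_I2, rule impI)
      fix y assume "y \<noteq> x"
      then have "indicator {- x..<x} y = (indicator {- x..x} y :: ennreal)" by (simp add: indicator_def) linarith
      then show "f (x, y) * indicator {- x..<x} y = f (x, y) * indicator {- x..x} y" by simp
    qed
  qed
  also have "\<dots> = (\<integral>\<^sup>+t. f (x, x * tan t) * ennreal (x / (cos t)\<^sup>2) * indicator {-(pi/4)..pi/4} t \<partial>lborel)"
  proof (rule nn_integral_substitution_aux)
    show "(\<lambda>y. f (x, y)) \<in> borel_measurable borel" by measurable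
    fix t assume t: "t \<in> {-(pi/4)..pi/4}"
    show "((\<lambda>t. x * tan t) has_real_derivative x / (cos t)\<^sup>2) (at t)"
      using cospos[OF t] by (auto intro!: derivative_eq_intros simp: field_simps)
    show "0 \<le> x / (cos t)\<^sup>2" using x by simp
  next
    have "\<forall>t\<in>{-(pi/4)..pi/4}. (cos t)\<^sup>2 \<noteq> 0" using cospos by force
    then show "continuous_on {-(pi/4)..pi/4} (\<lambda>t. x / (cos t)\<^sup>2)"
      by (intro continuous_intros)
  qed auto
  also have "\<dots> = (\<integral>\<^sup>+t. f (x, x * tan t) * ennreal (x / (cos t)\<^sup>2) * indicator {-(pi/4)..<pi/4} t \<partial>lborel)"
  proof (rule nn_integral_cong_AE, rule AE_mp[OF AE_lborel_singleton[of "pi/4"]], rule AE_I2, rule impI)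
    fix t :: real assume "t \<noteq> pi/4"
    then have "indicator {-(pi/4)..pi/4} t = (indicator {-(pi/4)..<pi/4} t :: ennreal)" by (simp add: indicator_def) linarith
    then show "f (x, x * tan t) * ennreal (x / (cos t)\<^sup>2) * indicator {-(pi/4)..pi/4} t
      = f (x, x * tan t) * ennreal (x / (cos t)\<^sup>2) * indicator {-(pi/4)..<pi/4} t" by simp
  qed
  finally show ?thesis .
qed

text \<open>With the angle fixed, \<open>x = r cos t\<close> is linear; its factor
  \<open>cos t\<close> and the earlier \<open>x / (cos t)^2\<close> combine to the Jacobian
  \<open>r\<close>. The order of integration is exchanged to fix the angle and exchanged back at the
  end.\<close>

lemma nn_integral_sector:
  fixes f :: "real \<times> real \<Rightarrow> ennreal"
  assumes f[measurable]: "f \<in> borel_measurable borel"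
  shows "(\<integral>\<^sup>+p. f p * indicator sector p \<partial>lborel)
    = (\<integral>\<^sup>+r. (\<integral>\<^sup>+t. f (r * cos t, r * sin t) * ennreal r * indicator {-(pi/4)..<pi/4} t \<partial>lborel) * indicator {0<..} r \<partial>lborel)"
proof -
  have [measurable]: "(\<lambda>p. f (fst p, fst p * tan (snd p))) \<in> borel_measurable (lborel \<Otimes>\<^sub>M lborel)" by measurable
  have "(\<integral>\<^sup>+p. f p * indicator sector p \<partial>lborel) = (\<integral>\<^sup>+p. f p * indicator sector p \<partial>(lborel \<Otimes>\<^sub>M lborel))"
    by (simp add: lborel_prod)
  also have "\<dots> = (\<integral>\<^sup>+x. \<integral>\<^sup>+y. f (x, y) * indicator sector (x, y) \<partial>lborel \<partial>lborel)"
    by (subst lborel.nn_integral_fst[symmetric]) (auto simp: lborel_prod)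
  also have "\<dots> = (\<integral>\<^sup>+x. (\<integral>\<^sup>+y. f (x, y) * indicator {- x..<x} y \<partial>lborel) * indicator {0<..} x \<partial>lborel)"
    by (intro nn_integral_cong, subst nn_integral_multc[symmetric])
       (auto simp: sector_def intro!: nn_integral_cong split: split_indicator)
  also have "\<dots> = (\<integral>\<^sup>+x. (\<integral>\<^sup>+t. f (x, x * tan t) * ennreal (x / (cos t)\<^sup>2) * indicator {-(pi/4)..<pi/4} t * indicator {0<..} x \<partial>lborel) \<partial>lborel)"
    by (intro nn_integral_cong, subst nn_integral_multc)
       (auto simp: nn_integral_polar_slice split: split_indicator)
  also have "\<dots> = (\<integral>\<^sup>+t. (\<integral>\<^sup>+x. f (x, x * tan t) * ennreal (x / (cos t)\<^sup>2) * indicator {-(pi/4)..<pi/4} t * indicator {0<..} x \<partial>lborel) \<partial>lborel)"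
    by (intro lborel_pair.Fubini') measurable
  also have "\<dots> = (\<integral>\<^sup>+t. (\<integral>\<^sup>+r. f (r * cos t, r * sin t) * ennreal r * indicator {-(pi/4)..<pi/4} t * indicator {0<..} r \<partial>lborel) \<partial>lborel)"
  proof (rule nn_integral_cong)
    fix t :: real
    show "(\<integral>\<^sup>+x. f (x, x * tan t) * ennreal (x / (cos t)\<^sup>2) * indicator {-(pi/4)..<pi/4} t * indicator {0<..} x \<partial>lborel)
      = (\<integral>\<^sup>+r. f (r * cos t, r * sin t) * ennreal r * indicator {-(pi/4)..<pi/4} t * indicator {0<..} r \<partial>lborel)"
    proof (cases "t \<in> {-(pi/4)..<pi/4}")
      case True
      then have c: "0 < cos t" using pi_gt_zero
        by (intro cos_gt_zero_pi) (simp_all only: atLeastLessThan_iff, linarith+)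
      have "(\<integral>\<^sup>+x. f (x, x * tan t) * ennreal (x / (cos t)\<^sup>2) * indicator {0<..} x \<partial>lborel)
        = \<bar>cos t\<bar> * (\<integral>\<^sup>+r. f (0 + cos t * r, (0 + cos t * r) * tan t) * ennreal ((0 + cos t * r) / (cos t)\<^sup>2) * indicator {0<..} (0 + cos t * r) \<partial>lborel)"
        using c by (intro nn_integral_real_affine) auto
      also have "\<dots> = (\<integral>\<^sup>+r. \<bar>cos t\<bar> * (f (0 + cos t * r, (0 + cos t * r) * tan t) * ennreal ((0 + cos t * r) / (cos t)\<^sup>2) * indicator {0<..} (0 + cos t * r)) \<partial>lborel)"
        by (subst nn_integral_cmult) auto
      also have "\<dots> = (\<integral>\<^sup>+r. f (r * cos t, r * sin t) * ennreal r * indicator {0<..} r \<partial>lborel)"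
      proof (rule nn_integral_cong)
        fix r :: real
        have 1: "(0 + cos t * r) * tan t = r * sin t" using c by (simp add: tan_def)
        have 2: "ennreal \<bar>cos t\<bar> * (A * ennreal ((0 + cos t * r) / (cos t)\<^sup>2)) = A * ennreal r" for A
        proof -
          have "ennreal \<bar>cos t\<bar> * (A * ennreal ((0 + cos t * r) / (cos t)\<^sup>2)) = A * (ennreal \<bar>cos t\<bar> * ennreal ((0 + cos t * r) / (cos t)\<^sup>2))"
            by (simp add: mult.left_commute)
          also have "ennreal \<bar>cos t\<bar> * ennreal ((0 + cos t * r) / (cos t)\<^sup>2) = ennreal r"
            using c by (subst ennreal_mult'[symmetric]) (auto simp: power2_eq_square)
          finally show ?thesis .
        qed
        have 3: "indicator {0<..} (0 + cos t * r) = (indicator {0<..} r :: ennreal)"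
          using c by (auto simp: zero_less_mult_iff split: split_indicator)
        show "ennreal \<bar>cos t\<bar> * (f (0 + cos t * r, (0 + cos t * r) * tan t) * ennreal ((0 + cos t * r) / (cos t)\<^sup>2) * indicator {0<..} (0 + cos t * r))
          = f (r * cos t, r * sin t) * ennreal r * indicator {0<..} r"
          unfolding 1 3 mult.assoc[of _ _ "indicator _ _", symmetric] 2 by (simp add: mult.commute)
      qed
      finally show ?thesis using True by simp
    qed simp
  qed
  also have "\<dots> = (\<integral>\<^sup>+r. (\<integral>\<^sup>+t. f (r * cos t, r * sin t) * ennreal r * indicator {-(pi/4)..<pi/4} t * indicator {0<..} r \<partial>lborel) \<partial>lborel)"
    by (intro lborel_pair.Fubini') measurable
  also have "\<dots> = (\<integral>\<^sup>+r. (\<integral>\<^sup>+t. f (r * cos t, r * sin t) * ennreal r * indicator {-(pi/4)..<pi/4} t \<partial>lborel) * indicator {0<..} r \<partial>lborel)"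
    by (intro nn_integral_cong, subst nn_integral_multc) auto
  finally show ?thesis .
qed

section \<open>Quarter turns and polar coordinates on the whole plane\<close>

definition quarter_turn :: "real \<times> real \<Rightarrow> real \<times> real"
  where "quarter_turn p = (- snd p, fst p)"

lemma quarter_turn_measurable [measurable]: "quarter_turn \<in> borel_measurable borel"
  unfolding quarter_turn_def[abs_def] borel_prod[symmetric] by measurable

lemma nn_integral_quarter_turn:
  fixes f :: "real \<times> real \<Rightarrow> ennreal"
  assumes [measurable]: "f \<in> borel_measurable borel"
  shows "(\<integral>\<^sup>+p. f (quarter_turn p) \<partial>lborel) = (\<integral>\<^sup>+p. f p \<partial>lborel)"
proof -
  have m: "(\<lambda>p. f (- snd p, fst p)) \<in> borel_measurable borel"
    using measurable_compose[OF quarter_turn_measurable assms] by (simp add: quarter_turn_def)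
  have "(\<integral>\<^sup>+p. f (quarter_turn p) \<partial>lborel) = (\<integral>\<^sup>+x. \<integral>\<^sup>+y. f (- y, x) \<partial>lborel \<partial>lborel)"
    unfolding lborel_prod[symmetric]
    by (subst lborel.nn_integral_fst[symmetric]) (use m in \<open>auto simp: quarter_turn_def lborel_prod\<close>)
  also have "\<dots> = (\<integral>\<^sup>+x. \<integral>\<^sup>+y. f (y, x) \<partial>lborel \<partial>lborel)"
  proof (rule nn_integral_cong)
    fix x :: real
    have "(\<integral>\<^sup>+y. f (y, x) \<partial>lborel) = ennreal \<bar>-1::real\<bar> * (\<integral>\<^sup>+y. f (0 + (-1) * y, x) \<partial>lborel)"
      by (rule nn_integral_real_affine) auto
    then show "(\<integral>\<^sup>+y. f (- y, x) \<partial>lborel) = (\<integral>\<^sup>+y. f (y, x) \<partial>lborel)" by simp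
  qed
  also have "\<dots> = (\<integral>\<^sup>+x. \<integral>\<^sup>+y. f (x, y) \<partial>lborel \<partial>lborel)"
    by (intro lborel_pair.Fubini') measurable
  also have "\<dots> = (\<integral>\<^sup>+p. f p \<partial>lborel)"
    unfolding lborel_prod[symmetric] by (subst lborel.nn_integral_fst[symmetric]) (auto simp: lborel_prod)
  finally show ?thesis .
qed

lemma quarter_turn_power_polar:
  "(quarter_turn ^^ k) (r * cos t, r * sin t) = (r * cos (t + real k * (pi/2)), r * sin (t + real k * (pi/2)))"
proof (induction k)
  case (Suc k)
  define u where "u = t + real k * (pi/2)"
  have "t + real (Suc k) * (pi/2) = u + pi/2" by (simp add: u_def field_simps)
  then show ?case using Suc unfolding u_def[symmetric] by (simp add: quarter_turn_def cos_add sin_add)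
qed simp

lemma quarter_turn_power_measurable [measurable]: "quarter_turn ^^ k \<in> borel_measurable borel"
  by (induction k) (auto intro: measurable_compose[OF _ quarter_turn_measurable] simp: o_def)

lemma nn_integral_quarter_turn_power:
  fixes f :: "real \<times> real \<Rightarrow> ennreal"
  assumes [measurable]: "f \<in> borel_measurable borel"
  shows "(\<integral>\<^sup>+p. f ((quarter_turn ^^ k) p) \<partial>lborel) = (\<integral>\<^sup>+p. f p \<partial>lborel)"
proof (induction k)
  case (Suc k)
  have "(\<integral>\<^sup>+p. f ((quarter_turn ^^ Suc k) p) \<partial>lborel) = (\<integral>\<^sup>+p. f ((quarter_turn ^^ k) (quarter_turn p)) \<partial>lborel)"
    by (simp only: funpow_Suc_right o_apply)
  also have "\<dots> = (\<integral>\<^sup>+p. f ((quarter_turn ^^ k) p) \<partial>lborel)"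
    by (rule nn_integral_quarter_turn) measurable
  finally show ?case using Suc by simp
qed simp

text \<open>The inverse of \<open>k\<close> quarter turns is written as \<open>4 - k\<close> further
  ones, so that only natural powers occur.\<close>

lemma sector_rotations:
  assumes "p \<noteq> (0, 0)"
  shows "(\<Sum>k<4. indicator sector ((quarter_turn ^^ (4 - k)) p)) = (1 :: ennreal)"
proof -
  obtain x y where p: "p = (x, y)" by (cases p)
  show ?thesis using assms unfolding p
    by (auto simp: eval_nat_numeral quarter_turn_def sector_def split: split_indicator)
qed

lemma quarter_turn_four: "(quarter_turn ^^ 4) p = p"
  by (simp add: quarter_turn_def eval_nat_numeral)

proposition nn_integral_polar:
  fixes f :: "real \<times> real \<Rightarrow> ennreal"
  assumes f[measurable]: "f \<in> borel_measurable borel"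
  shows "(\<integral>\<^sup>+p. f p \<partial>lborel)
    = (\<integral>\<^sup>+r. (\<integral>\<^sup>+t. f (r * cos t, r * sin t) * ennreal r * indicator {0..<2*pi} t \<partial>lborel) * indicator {0<..} r \<partial>lborel)"
proof -
  let ?R = "\<lambda>k. quarter_turn ^^ k"
  have "(\<integral>\<^sup>+p. f p \<partial>lborel) = (\<integral>\<^sup>+p. (\<Sum>k<4. f p * indicator sector (?R (4 - k) p)) \<partial>lborel)"
  proof (rule nn_integral_cong_AE, rule AE_mp[OF AE_lborel_singleton[of "(0,0)"]], rule AE_I2, rule impI)
    fix p :: "real \<times> real" assume "p \<noteq> (0, 0)"
    then show "f p = (\<Sum>k<4. f p * indicator sector (?R (4 - k) p))"
      using sector_rotations[of p] by (simp only: sum_distrib_left[symmetric] mult_1_right not_False_eq_True simp_thms)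
  qed
  also have "\<dots> = (\<Sum>k<4. \<integral>\<^sup>+p. f p * indicator sector (?R (4 - k) p) \<partial>lborel)"
    by (intro nn_integral_sum) measurable
  also have "\<dots> = (\<Sum>k<4. \<integral>\<^sup>+p. f (?R k p) * indicator sector p \<partial>lborel)"
  proof (intro sum.cong refl)
    fix k :: nat assume k: "k \<in> {..<4}"
    have "?R (4 - k) (?R k p) = p" for p
    proof -
      have "?R (4 - k) (?R k p) = ?R ((4 - k) + k) p" by (simp add: funpow_add del: diff_add_inverse2)
      then show ?thesis using k quarter_turn_four by simp
    qed
    then show "(\<integral>\<^sup>+p. f p * indicator sector (?R (4 - k) p) \<partial>lborel) = (\<integral>\<^sup>+p. f (?R k p) * indicator sector p \<partial>lborel)"
      using nn_integral_quarter_turn_power[of "\<lambda>p. f p * indicator sector (?R (4 - k) p)" k] by simp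
  qed
  also have "\<dots> = (\<Sum>k<4. \<integral>\<^sup>+r. (\<integral>\<^sup>+t. f (r * cos (t + real k * (pi/2)), r * sin (t + real k * (pi/2))) * ennreal r
      * indicator {-(pi/4)..<pi/4} t \<partial>lborel) * indicator {0<..} r \<partial>lborel)"
    by (intro sum.cong refl, subst nn_integral_sector) (simp_all add: quarter_turn_power_polar)
  also have "\<dots> = (\<integral>\<^sup>+r. (\<Sum>k<4. (\<integral>\<^sup>+t. f (r * cos (t + real k * (pi/2)), r * sin (t + real k * (pi/2))) * ennreal r
      * indicator {-(pi/4)..<pi/4} t \<partial>lborel) * indicator {0<..} r) \<partial>lborel)"
    by (intro nn_integral_sum[symmetric]) measurable
  also have "\<dots> = (\<integral>\<^sup>+r. (\<integral>\<^sup>+t. f (r * cos t, r * sin t) * ennreal r * indicator {0..<2*pi} t \<partial>lborel) * indicator {0<..} r \<partial>lborel)"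
  proof (rule nn_integral_cong)
    fix r :: real
    show "(\<Sum>k<4. (\<integral>\<^sup>+t. f (r * cos (t + real k * (pi/2)), r * sin (t + real k * (pi/2))) * ennreal r
      * indicator {-(pi/4)..<pi/4} t \<partial>lborel) * indicator {0<..} r)
      = (\<integral>\<^sup>+t. f (r * cos t, r * sin t) * ennreal r * indicator {0..<2*pi} t \<partial>lborel) * indicator {0<..} r"
      by (subst nn_integral_periodic_quarters) (auto simp: sum_distrib_right)
  qed
  finally show ?thesis .
qed

text \<open>As an equality of measures, the change of variables passes to complex Bochner integrals
  through the rules for \<open>distr\<close> and \<open>density\<close>. The closed interval
  \<open>[0, 2 pi]\<close> matches the integral in \<open>fz_coeff\<close>; its upper end is
  null.\<close>

lemma lborel_polar:
  "lborel = distr (density (lborel \<Otimes>\<^sub>M lborel) (\<lambda>(r, t). ennreal r * indicator {0..} r * indicator {0..2*pi} t))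
     borel (\<lambda>(r, t). (r * cos t, r * sin t))" (is "_ = distr ?M _ ?g")
proof (rule measure_eqI)
  show "sets lborel = sets (distr ?M borel ?g)" by simp
  fix A assume "A \<in> sets (lborel :: (real \<times> real) measure)"
  then have A[measurable]: "A \<in> sets borel" by simp
  have g[measurable]: "?g \<in> borel_measurable (lborel \<Otimes>\<^sub>M lborel)"
  proof -
    have "?g \<in> borel_measurable borel"
      by (intro borel_measurable_continuous_onI) (auto simp: split_beta' intro!: continuous_intros)
    then show ?thesis by (simp add: lborel_prod)
  qed
  have gM: "?g \<in> measurable ?M borel" using g by (subst measurable_cong_sets[OF sets_density refl])
  have dm: "(\<lambda>(r, t). ennreal r * indicator {0..} r * indicator {0..2*pi} t) \<in> borel_measurable (lborel \<Otimes>\<^sub>M (lborel :: real measure))"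
    by measurable
  have gA: "?g -` A \<inter> space ?M \<in> sets (lborel \<Otimes>\<^sub>M lborel)"
    using measurable_sets[OF g A] by simp
  have "emeasure (distr ?M borel ?g) A = emeasure ?M (?g -` A \<inter> space ?M)"
    by (rule emeasure_distr[OF gM A])
  also have "\<dots> = (\<integral>\<^sup>+p. (case p of (r, t) \<Rightarrow> ennreal r * indicator {0..} r * indicator {0..2*pi} t) * indicator (?g -` A \<inter> space ?M) p \<partial>(lborel \<Otimes>\<^sub>M lborel))"
    by (rule emeasure_density[OF dm gA])
  also have "\<dots> = (\<integral>\<^sup>+p. (case p of (r, t) \<Rightarrow> ennreal r * indicator {0..} r * indicator {0..2*pi} t) * indicator A (?g p) \<partial>(lborel \<Otimes>\<^sub>M lborel))"
    by (intro nn_integral_cong) (auto simp: space_pair_measure split: split_indicator)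
  also have "\<dots> = (\<integral>\<^sup>+r. \<integral>\<^sup>+t. ennreal r * indicator {0..} r * indicator {0..2*pi} t * indicator A (r * cos t, r * sin t) \<partial>lborel \<partial>lborel)"
  proof (subst lborel.nn_integral_fst[symmetric])
    have "(\<lambda>p. indicator A (?g p) :: ennreal) \<in> borel_measurable (lborel \<Otimes>\<^sub>M lborel)"
      by (rule measurable_compose[OF g]) simp
    then show "(\<lambda>p. (case p of (r, t) \<Rightarrow> ennreal r * indicator {0..} r * indicator {0..2*pi} t) * indicator A (?g p))
       \<in> borel_measurable (lborel \<Otimes>\<^sub>M lborel)"
      by (intro borel_measurable_times_ennreal dm)
  qed simp
  also have "\<dots> = (\<integral>\<^sup>+r. (\<integral>\<^sup>+t. indicator A (r * cos t, r * sin t) * ennreal r * indicator {0..<2*pi} t \<partial>lborel) * indicator {0<..} r \<partial>lborel)"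
  proof (rule nn_integral_cong_AE, rule AE_mp[OF AE_lborel_singleton[of 0]], rule AE_I2, rule impI)
    fix r :: real assume "r \<noteq> 0"
    have "(\<integral>\<^sup>+t. ennreal r * indicator {0..} r * indicator {0..2*pi} t * indicator A (r * cos t, r * sin t) \<partial>lborel)
      = (\<integral>\<^sup>+t. indicator A (r * cos t, r * sin t) * ennreal r * indicator {0..<2*pi} t * indicator {0<..} r \<partial>lborel)"
    proof (rule nn_integral_cong_AE, rule AE_mp[OF AE_lborel_singleton[of "2*pi"]], rule AE_I2, rule impI)
      fix t :: real assume "t \<noteq> 2 * pi"
      then show "ennreal r * indicator {0..} r * indicator {0..2*pi} t * indicator A (r * cos t, r * sin t)
        = indicator A (r * cos t, r * sin t) * ennreal r * indicator {0..<2*pi} t * indicator {0<..} r"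
        using \<open>r \<noteq> 0\<close> by (cases "0 < r"; cases "0 \<le> t \<and> t < 2 * pi") (auto simp: indicator_def)
    qed
    also have "\<dots> = (\<integral>\<^sup>+t. indicator A (r * cos t, r * sin t) * ennreal r * indicator {0..<2*pi} t \<partial>lborel) * indicator {0<..} r"
      by (subst nn_integral_multc) auto
    finally show "(\<integral>\<^sup>+t. ennreal r * indicator {0..} r * indicator {0..2*pi} t * indicator A (r * cos t, r * sin t) \<partial>lborel)
      = (\<integral>\<^sup>+t. indicator A (r * cos t, r * sin t) * ennreal r * indicator {0..<2*pi} t \<partial>lborel) * indicator {0<..} r" .
  qed
  also have "\<dots> = (\<integral>\<^sup>+p. indicator A p \<partial>lborel)" by (rule nn_integral_polar[symmetric]) simp
  also have "\<dots> = emeasure lborel A" by simp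
  finally show "emeasure lborel A = emeasure (distr ?M borel ?g) A" by simp
qed

proposition integral_polar:
  fixes G :: "real \<times> real \<Rightarrow> complex"
  assumes G: "integrable lborel G"
  shows "integrable (lborel \<Otimes>\<^sub>M lborel) (\<lambda>(r, t). indicator {0..} r *\<^sub>R indicator {0..2*pi} t *\<^sub>R (G (r * cos t, r * sin t) * of_real r))"
    and "(LINT r:{0..}|lborel. LINT t:{0..2*pi}|lborel. G (r * cos t, r * sin t) * of_real r) = integral\<^sup>L lborel G"
proof -
  let ?d = "\<lambda>(r::real, t::real). r * indicator {0..} r * indicator {0..2*pi} t :: real"
  let ?M = "density (lborel \<Otimes>\<^sub>M lborel) (\<lambda>p. ennreal (?d p))"
  let ?g = "\<lambda>(r::real, t::real). (r * cos t, r * sin t)"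
  let ?F = "\<lambda>(r, t). indicator {0..} r *\<^sub>R indicator {0..2*pi} t *\<^sub>R (G (r * cos t, r * sin t) * complex_of_real r)"
  have Gm[measurable]: "G \<in> borel_measurable borel" using borel_measurable_integrable[OF G] by simp
  have g[measurable]: "?g \<in> borel_measurable (lborel \<Otimes>\<^sub>M lborel)"
  proof -
    have "?g \<in> borel_measurable borel"
      by (intro borel_measurable_continuous_onI) (auto simp: split_beta' intro!: continuous_intros)
    then show ?thesis by (simp add: lborel_prod)
  qed
  have "(\<lambda>(r, t). ennreal r * indicator {0..} r * indicator {0..2*pi} t) = (\<lambda>p. ennreal (?d p))"
    by (auto simp: fun_eq_iff split: split_indicator)
  then have M: "lborel = distr ?M borel ?g" using lborel_polar by simp
  have gM: "?g \<in> measurable ?M borel" by simp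
  have Fd: "?F = (\<lambda>p. ?d p *\<^sub>R G (?g p))"
    by (auto simp: fun_eq_iff scaleR_conv_of_real split: split_indicator)
  have d0: "AE p in lborel \<Otimes>\<^sub>M lborel. 0 \<le> ?d p" by (auto split: split_indicator)
  have Ggm: "(\<lambda>p. G (?g p)) \<in> borel_measurable (lborel \<Otimes>\<^sub>M lborel)" by measurable
  have dm: "?d \<in> borel_measurable (lborel \<Otimes>\<^sub>M lborel)" by measurable
  have "integrable (distr ?M borel ?g) G" using G by (subst M[symmetric])
  then have "integrable ?M (\<lambda>p. G (?g p))" by (subst (asm) integrable_distr_eq[OF gM Gm])
  then have int: "integrable (lborel \<Otimes>\<^sub>M lborel) ?F"
    unfolding Fd by (subst (asm) integrable_density[OF Ggm dm d0])
  then show "integrable (lborel \<Otimes>\<^sub>M lborel) ?F" .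
  have "integral\<^sup>L lborel G = integral\<^sup>L (distr ?M borel ?g) G" by (subst M) simp
  also have "\<dots> = integral\<^sup>L ?M (\<lambda>p. G (?g p))" by (rule integral_distr[OF gM Gm])
  also have "\<dots> = integral\<^sup>L (lborel \<Otimes>\<^sub>M lborel) ?F"
    unfolding Fd by (rule integral_density[OF Ggm dm d0])
  also have "\<dots> = (\<integral>r. (\<integral>t. ?F (r, t) \<partial>lborel) \<partial>lborel)"
    by (rule lborel_pair.integral_fst'[symmetric, OF int])
  finally show "(LINT r:{0..}|lborel. LINT t:{0..2*pi}|lborel. G (r * cos t, r * sin t) * of_real r) = integral\<^sup>L lborel G"
    by (simp only: set_lebesgue_integral_def prod.case integral_scaleR_right)
qed

section \<open>Bessel functions and Zernike moments\<close>

text \<open>The terms of the series of the Bessel function of order \<open>n + 1\<close> at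
  \<open>pi x\<close>, divided by \<open>x\<close> with that power already cancelled, so that they
  make sense at \<open>x = 0\<close>.\<close>

definition bessel_series :: "nat \<Rightarrow> real \<Rightarrow> nat \<Rightarrow> real"
  where "bessel_series n x s = (- 1) ^ s / (fact s * fact (n + 1 + s)) * (pi / 2) ^ (n + 1 + 2 * s) * x ^ (n + 2 * s)"

text \<open>To be read with \<open>u = x^2\<close>: as a power series in \<open>u\<close> it
  converges everywhere, the factor \<open>1 / fact s\<close> alone giving comparison with an
  exponential series.\<close>

lemma summable_bessel_coeff: "summable (\<lambda>s. (- 1) ^ s / (fact s * fact (n + 1 + s)) * (pi / 2) ^ (n + 1 + 2 * s) * (u::real) ^ s)"
proof (rule summable_comparison_test')
  show "summable (\<lambda>s. (pi/2) ^ (n + 1) * (inverse (fact s) * ((pi/2)\<^sup>2 * \<bar>u\<bar>) ^ s))"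
    using summable_exp[of "(pi/2)\<^sup>2 * \<bar>u\<bar>"] by (intro summable_mult)
  fix s :: nat
  have pw: "y ^ (n + 1 + 2 * s) = y ^ (n + 1) * (y\<^sup>2) ^ s" for y :: real by (simp only: power_add power_mult)
  have "1 \<le> (fact (n + 1 + s) :: real)" by (rule fact_ge_1)
  then have "1 / (fact s * fact (n + 1 + s)) \<le> 1 / (fact s * 1 :: real)"
    by (intro divide_left_mono mult_left_mono) auto
  then have le: "1 / (fact s * fact (n + 1 + s)) * ((pi / 2) ^ (n + 1 + 2 * s) * \<bar>u\<bar> ^ s) \<le> 1 / (fact s * 1) * ((pi / 2) ^ (n + 1 + 2 * s) * \<bar>u\<bar> ^ s)"
    by (intro mult_right_mono) auto
  have "(pi / 2) ^ (n + 1 + 2 * s) * \<bar>u\<bar> ^ s = (pi/2) ^ (n + 1) * ((pi/2)\<^sup>2 * \<bar>u\<bar>) ^ s"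
    by (simp only: pw power_mult_distrib mult.assoc)
  moreover have "norm ((- 1) ^ s / (fact s * fact (n + 1 + s)) * (pi / 2) ^ (n + 1 + 2 * s) * u ^ s)
     = 1 / (fact s * fact (n + 1 + s)) * ((pi / 2) ^ (n + 1 + 2 * s) * \<bar>u\<bar> ^ s)"
    by (simp add: abs_mult power_abs)
  moreover have "(pi/2) ^ (n + 1) * (inverse (fact s) * ((pi/2)\<^sup>2 * \<bar>u\<bar>) ^ s)
     = 1 / (fact s * 1) * ((pi/2) ^ (n + 1) * ((pi/2)\<^sup>2 * \<bar>u\<bar>) ^ s)"
    by (simp add: inverse_eq_divide)
  ultimately show "norm ((- 1) ^ s / (fact s * fact (n + 1 + s)) * (pi / 2) ^ (n + 1 + 2 * s) * u ^ s)
     \<le> (pi/2) ^ (n + 1) * (inverse (fact s) * ((pi/2)\<^sup>2 * \<bar>u\<bar>) ^ s)"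
    using le by presburger
qed

lemma bessel_J_pi_sums:
  assumes "x \<noteq> 0"
  shows "bessel_series n x sums (bessel_J (int n + 1) (pi * x) / x)"
proof -
  let ?c = "\<lambda>s. (- 1) ^ s / (fact s * fact (n + 1 + s)) * (pi / 2) ^ (n + 1 + 2 * s) :: real"
  have eq: "(- 1) ^ s / fact s * rGamma (of_int (int n + 1) + of_nat s + 1) * (pi * x / 2) powi (int n + 1 + 2 * int s)
     = x ^ (n + 1) * (?c s * (x\<^sup>2) ^ s)" for s
  proof -
    have 1: "of_int (int n + 1) + of_nat s + 1 = 1 + (of_nat (n + 1 + s) :: real)" by simp
    have 2: "rGamma (1 + of_nat (n + 1 + s) :: real) = 1 / fact (n + 1 + s)"
      unfolding rGamma_inverse_Gamma Gamma_fact by (simp add: inverse_eq_divide)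
    have 3: "int n + 1 + 2 * int s = int (n + 1 + 2 * s)" by simp
    have 4: "(pi * x / 2) ^ (n + 1 + 2 * s) = (pi / 2) ^ (n + 1 + 2 * s) * (x ^ (n + 1) * (x\<^sup>2) ^ s)"
    proof -
      have "pi * x / 2 = (pi / 2) * x" by simp
      moreover have "x ^ (n + 1 + 2 * s) = x ^ (n + 1) * (x\<^sup>2) ^ s" by (simp only: power_add power_mult)
      ultimately show ?thesis by (simp only: power_mult_distrib)
    qed
    show ?thesis unfolding 1 2 3 power_int_of_nat 4 by simp
  qed
  have "(\<lambda>s. ?c s * (x\<^sup>2) ^ s) sums (\<Sum>s. ?c s * (x\<^sup>2) ^ s)"
    using summable_bessel_coeff by (rule summable_sums)
  then have s1: "(\<lambda>s. x ^ (n + 1) * (?c s * (x\<^sup>2) ^ s)) sums (x ^ (n + 1) * (\<Sum>s. ?c s * (x\<^sup>2) ^ s))"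
    by (rule sums_mult)
  then have BJ: "bessel_J (int n + 1) (pi * x) = x ^ (n + 1) * (\<Sum>s. ?c s * (x\<^sup>2) ^ s)"
    unfolding bessel_J_def eq by (rule sums_unique[symmetric])
  have "(\<lambda>s. x ^ (n + 1) * (?c s * (x\<^sup>2) ^ s) / x) sums (bessel_J (int n + 1) (pi * x) / x)"
    unfolding BJ by (rule sums_divide[OF s1])
  moreover have "x ^ (n + 1) * (?c s * (x\<^sup>2) ^ s) / x = bessel_series n x s" for s
  proof -
    have "x ^ (n + 1) * (C * (x\<^sup>2) ^ s) / x = C * x ^ (n + 2 * s)" for C
      using assms unfolding power_add[of x n] power_mult by simp
    then show ?thesis by (simp only: bessel_series_def)
  qed
  ultimately show ?thesis by simp
qed

text \<open>At the origin the quotient is a one-sided limit. It is evaluated by continuity of the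
  power series in \<open>x^2\<close>, which agrees with the quotient for
  \<open>x > 0\<close>.\<close>

lemma bessel_quotient_sums: "bessel_series n (lattice_abs k) sums bessel_quotient n k"
proof (cases "k = (0, 0)")
  case False
  then have "lattice_abs k \<noteq> 0"
    by (cases k) (auto simp: lattice_abs_def sum_power2_eq_zero_iff)
  then show ?thesis using bessel_J_pi_sums False by (simp add: bessel_quotient_def)
next
  case True
  let ?c = "\<lambda>s. (- 1) ^ s / (fact s * fact (n + 1 + s)) * (pi / 2) ^ (n + 1 + 2 * s) :: real"
  define h where "h u = (\<Sum>s. ?c s * u ^ s)" for u
  have h: "isCont h u" for u
    unfolding h_def[abs_def]
    by (rule isCont_powser[OF summable_bessel_coeff[of n "norm u + 1"]]) auto
  have sums: "bessel_series n x sums (x ^ n * h (x\<^sup>2))" for x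
  proof -
    have "(\<lambda>s. x ^ n * (?c s * (x\<^sup>2) ^ s)) sums (x ^ n * h (x\<^sup>2))"
      unfolding h_def by (intro sums_mult summable_sums summable_bessel_coeff)
    moreover have "x ^ n * (?c s * (x\<^sup>2) ^ s) = bessel_series n x s" for s
      by (simp only: bessel_series_def power_add[of x n] power_mult[of x 2] mult.left_commute)
    ultimately show ?thesis by simp
  qed
  have "isCont (\<lambda>x. x ^ n * h (x\<^sup>2)) 0"
  proof (intro isCont_mult)
    show "isCont (\<lambda>x. h (x\<^sup>2)) 0" by (rule isCont_o2[OF _ h]) (intro continuous_intros)
  qed (intro continuous_intros)
  then have "((\<lambda>x. x ^ n * h (x\<^sup>2)) \<longlongrightarrow> 0 ^ n * h (0\<^sup>2)) (at_right 0)"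
    by (auto simp: isCont_def intro: tendsto_within_subset)
  moreover have "eventually (\<lambda>x. x ^ n * h (x\<^sup>2) = bessel_J (int n + 1) (pi * x) / x) (at_right 0)"
    using eventually_at_right_less[of "0::real"]
    by eventually_elim (rule sums_unique2[OF sums bessel_J_pi_sums], simp)
  ultimately have "((\<lambda>x. bessel_J (int n + 1) (pi * x) / x) \<longlongrightarrow> 0 ^ n * h (0\<^sup>2)) (at_right 0)"
    by (rule Lim_transform_eventually)
  then have "bessel_quotient n k = 0 ^ n * h (0\<^sup>2)"
    using True by (simp add: bessel_quotient_def tendsto_Lim)
  moreover have "lattice_abs k = 0" using True by (simp add: lattice_abs_def)
  ultimately show ?thesis using sums[of 0] by simp
qed

section \<open>Partial fractions and moments of the radial polynomials\<close>

lemma prod_real_rising: "(\<Prod>i<p. real (t + 1 + i)) = fact (t + p) / fact t"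
proof (induction p)
  case (Suc p)
  have "fact (t + Suc p) = real (t + 1 + p) * fact (t + p)" by simp
  then show ?case unfolding prod.lessThan_Suc Suc by simp
qed simp

text \<open>After clearing denominators both sides are polynomials of degree at most
  \<open>p\<close>, and they agree at the \<open>p + 1\<close> nodes \<open>- (q + 1 - j)\<close>.
  At such a node only the summand with \<open>B j\<close> survives, and the Zernike coefficient is
  exactly the quotient of the values of \<open>L\<close> and \<open>B j\<close> there, that is, the
  residue.\<close>

lemma zernike_partial_fractions:
  fixes x :: real
  assumes "p \<le> q" and x: "0 \<le> x"
  shows "(\<Sum>j\<le>p. (- 1) ^ j * (fact (p + q - j) / (fact j * fact (q - j) * fact (p - j))) / (real (q + 1 - j) + x))
    = (\<Prod>i<p. x - real i) / (\<Prod>j\<le>p. real (q + 1 - j) + x)"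
proof -
  define A where "A j = (- 1) ^ j * (fact (p + q - j) / (fact j * fact (q - j) * fact (p - j)) :: real)" for j
  define L :: "real poly" where "L = (\<Prod>i<p. [:- real i, 1:])"
  define B :: "nat \<Rightarrow> real poly" where "B j = (\<Prod>i\<in>{..p} - {j}. [:real (q + 1 - i), 1:])" for j
  define R where "R = (\<Sum>j\<le>p. smult (A j) (B j))"
  define X where "X = (\<lambda>j. - real (q + 1 - j)) ` {..p}"
  have injX: "inj_on (\<lambda>j. - real (q + 1 - j)) {..p}" using assms by (auto simp: inj_on_def)
  then have cardX: "card X = Suc p" by (simp add: X_def card_image)
  have degL: "degree L \<le> p"
    using degree_prod_sum_le[of "{..<p}" "\<lambda>i. [:- real i, 1:]"] by (simp add: L_def)
  have degB: "degree (B j) \<le> p" if "j \<le> p" for j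
    using degree_prod_sum_le[of "{..p} - {j}" "\<lambda>i. [:real (q + 1 - i), 1:]"] that by (simp add: B_def)
  have degR: "degree R \<le> p"
    unfolding R_def using degB by (intro degree_sum_le) (auto intro: order_trans[OF degree_smult_le])
  have B0: "poly (B i) (- real (q + 1 - j)) = 0" if "j \<le> p" "i \<noteq> j" for i j
    unfolding B_def poly_prod by (rule prod_zero) (use that in auto)
  have Bj: "poly (B j) (- real (q + 1 - j)) = fact j * ((- 1) ^ (p - j) * fact (p - j))" if "j \<le> p" for j
  proof -
    have "poly (B j) (- real (q + 1 - j)) = (\<Prod>i\<in>{..p} - {j}. real j - real i)"
      unfolding B_def poly_prod using that assms by (intro prod.cong) (auto simp: of_nat_diff)
    \<comment> \<open>The factors \<open>j - i\<close> with \<open>i < j\<close> give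
      \<open>fact j\<close>; those with \<open>i > j\<close> are negative and give
      \<open>fact (p - j)\<close> with its sign.\<close>
    also have "{..p} - {j} = {..<j} \<union> {j<..p}" using that by auto
    also have "(\<Prod>i\<in>{..<j} \<union> {j<..p}. real j - real i) = (\<Prod>i<j. real j - real i) * (\<Prod>i\<in>{j<..p}. real j - real i)"
      by (intro prod.union_disjoint) auto
    also have "(\<Prod>i<j. real j - real i) = (\<Prod>i\<in>{1..j}. real i)"
      by (rule prod.reindex_bij_witness[of _ "\<lambda>i. j - i" "\<lambda>i. j - i"]) (auto simp: of_nat_diff)
    also have "\<dots> = fact j" by (simp add: fact_prod)
    also have "(\<Prod>i\<in>{j<..p}. real j - real i) = (\<Prod>i\<in>{1..p - j}. (- 1) * real i)"
      by (rule prod.reindex_bij_witness[of _ "\<lambda>i. i + j" "\<lambda>i. i - j"]) (auto simp: of_nat_diff)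
    also have "\<dots> = (- 1) ^ (p - j) * fact (p - j)" unfolding prod.distrib by (simp add: fact_prod)
    finally show ?thesis .
  qed
  have Lj: "poly L (- real (q + 1 - j)) = (- 1) ^ p * (fact (p + q - j) / fact (q - j))" if "j \<le> p" for j
  proof -
    have jq: "j \<le> q" using that assms by simp
    have "poly L (- real (q + 1 - j)) = (\<Prod>i<p. (- 1) * real (q - j + 1 + i))"
      unfolding L_def poly_prod using jq by (intro prod.cong) (auto simp: of_nat_diff)
    also have "\<dots> = (- 1) ^ p * (\<Prod>i<p. real (q - j + 1 + i))" unfolding prod.distrib by simp
    also have "(\<Prod>i<p. real (q - j + 1 + i)) = fact (p + q - j) / fact (q - j)"
      using prod_real_rising[of "q - j" p] jq by (simp add: add.commute)
    finally show ?thesis .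
  qed
  have "L = R"
  proof (rule poly_eqI_degree[where A = X])
    fix y assume "y \<in> X"
    then obtain j where j: "j \<le> p" "y = - real (q + 1 - j)" by (auto simp: X_def)
    have "poly R y = (\<Sum>i\<le>p. if i = j then A j * poly (B j) y else 0)"
      unfolding R_def poly_sum using B0 j by (intro sum.cong) auto
    also have "\<dots> = A j * poly (B j) y" using j by simp
    also have "\<dots> = ((- 1) ^ j * (- 1) ^ (p - j)) * (fact (p + q - j) / fact (q - j))"
      unfolding A_def j(2) Bj[OF j(1)] by (simp add: field_simps)
    also have "(- 1) ^ j * (- 1) ^ (p - j) = ((- 1) ^ p :: real)" using j by (simp flip: power_add)
    finally show "poly L y = poly R y" using Lj[OF j(1)] j by simp
  qed (use cardX degL degR in auto)
  then have "poly L x = poly R x" by simp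
  then have eq: "(\<Prod>i<p. x - real i) = (\<Sum>j\<le>p. A j * poly (B j) x)"
    unfolding L_def R_def poly_prod poly_sum by simp
  define D where "D = (\<Prod>j\<le>p. real (q + 1 - j) + x)"
  have "real (q + 1 - j) + x \<noteq> 0" if "j \<le> p" for j using that assms by auto
  then have D0: "D \<noteq> 0" by (auto simp: D_def)
  have DB: "D = (real (q + 1 - j) + x) * poly (B j) x" if "j \<le> p" for j
    unfolding D_def B_def poly_prod using that by (subst prod.remove[of _ j]) (auto simp: add.commute)
  have "A j / (real (q + 1 - j) + x) = A j * poly (B j) x / D" if "j \<le> p" for j
    using D0 DB[OF that] by auto
  then have "(\<Sum>j\<le>p. A j / (real (q + 1 - j) + x)) = (\<Sum>j\<le>p. A j * poly (B j) x / D)"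
    by (intro sum.cong) auto
  then show ?thesis unfolding eq D_def[symmetric] A_def sum_divide_distrib .
qed

lemma prod_real_diff_eq_0: "s < p \<Longrightarrow> (\<Prod>i<p. real s - real i) = 0"
  by (rule prod_zero) auto

lemma prod_real_diff_fact: "(\<Prod>i<p. real (p + t) - real i) = fact (p + t) / fact t"
proof -
  have "(\<Prod>i<p. real (p + t) - real i) = (\<Prod>i<p. real (t + 1 + i))"
    by (rule prod.reindex_bij_witness[of _ "\<lambda>i. p - 1 - i" "\<lambda>i. p - 1 - i"]) (auto simp: of_nat_diff)
  then show ?thesis using prod_real_rising[of t p] by (simp add: add.commute)
qed

lemma prod_real_add_fact:
  assumes "p \<le> q"
  shows "(\<Prod>j\<le>p. real (q + 1 - j) + real s) = fact (q + 1 + s) / fact (q - p + s)"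
proof -
  have "(\<Prod>j\<le>p. real (q + 1 - j) + real s) = (\<Prod>i<Suc p. real (q - p + s + 1 + i))"
    using assms by (intro prod.reindex_bij_witness[of _ "\<lambda>i. p - i" "\<lambda>i. p - i"]) (auto simp: of_nat_diff)
  also have "\<dots> = fact (q + 1 + s) / fact (q - p + s)"
    unfolding prod_real_rising using assms by (simp add: add.commute)
  finally show ?thesis .
qed

text \<open>The partial fractions at \<open>x = s\<close>. The denominators
  \<open>2 (q + 1 - j + s)\<close> arise from integrating \<open>r^(p + q - 2 j)\<close> against
  \<open>r^(q - p + 2 s + 1)\<close> over the unit interval. For \<open>s < p\<close> the numerator
  contains \<open>s - s\<close>, which expresses the orthogonality of the radial polynomial to lower
  powers.\<close>

lemma zernike_moment:
  assumes "p \<le> q"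
  shows "(\<Sum>j\<le>p. (- 1) ^ j * (fact (p + q - j) / (fact j * fact (q - j) * fact (p - j))) / (2 * (real (q + 1 - j) + real s)))
    = (if s < p then 0 else fact s * fact (q - p + s) / (2 * fact (s - p) * fact (q + 1 + s)) :: real)"
proof -
  have "(\<Sum>j\<le>p. (- 1) ^ j * (fact (p + q - j) / (fact j * fact (q - j) * fact (p - j))) / (2 * (real (q + 1 - j) + real s)))
    = (\<Sum>j\<le>p. (- 1) ^ j * (fact (p + q - j) / (fact j * fact (q - j) * fact (p - j))) / (real (q + 1 - j) + real s)) / 2"
    unfolding sum_divide_distrib by (intro sum.cong) auto
  also have "\<dots> = (\<Prod>i<p. real s - real i) / (\<Prod>j\<le>p. real (q + 1 - j) + real s) / 2"
    using zernike_partial_fractions[OF assms(1), of "real s"] by simp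
  also have "\<dots> = (if s < p then 0 else fact s * fact (q - p + s) / (2 * fact (s - p) * fact (q + 1 + s)) :: real)"
  proof (cases "s < p")
    case True then show ?thesis by (simp add: prod_real_diff_eq_0)
  next
    case False
    then show ?thesis using prod_real_diff_fact[of p "s - p"] prod_real_add_fact[OF assms(1), of s] by simp
  qed
  finally show ?thesis .
qed

section \<open>Angular integrals of powers of the cosine\<close>

lemma integral_exp_int:
  "(LINT t:{0..2*pi}|lborel. exp (\<i> * of_int d * of_real t)) = (if d = 0 then 2 * pi else 0)"
proof (cases "d = 0")
  case True
  then show ?thesis by (simp add: set_lebesgue_integral_def scaleR_conv_of_real)
next
  case False
  let ?F = "\<lambda>t. exp (\<i> * of_int d * complex_of_real t) / (\<i> * of_int d)"
  have "(LINT t:{0..2*pi}|lborel. exp (\<i> * of_int d * of_real t)) = ?F (2*pi) - ?F 0"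
    unfolding set_lebesgue_integral_def
  proof (rule integral_FTC_atLeastAtMost)
    fix x :: real
    show "(?F has_vector_derivative exp (\<i> * of_int d * of_real x)) (at x within {0..2*pi})"
    proof -
      have "((\<lambda>z. exp (\<i> * of_int d * z) / (\<i> * of_int d)) has_field_derivative exp (\<i> * of_int d * of_real x)) (at (of_real x))"
        using False by (auto intro!: derivative_eq_intros)
      then show ?thesis by (rule has_vector_derivative_real_field)
    qed
  qed (auto intro!: continuous_intros)
  also have "exp (\<i> * of_int d * complex_of_real (2*pi)) = 1"
    using exp_2pi_1_int[of d] by (simp add: mult_ac)
  finally show ?thesis using False by simp
qed

lemma cos_power_exp:
  "complex_of_real (cos x ^ Q) = (\<Sum>b\<le>Q. of_nat (Q choose b) * exp (\<i> * of_int (2 * int b - int Q) * of_real x)) / 2 ^ Q"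
proof -
  have "complex_of_real (cos x ^ Q) = ((exp (\<i> * of_real x) + exp (- (\<i> * of_real x))) / 2) ^ Q"
    by (simp add: cos_exp_eq cos_of_real[symmetric])
  also have "\<dots> = (\<Sum>b\<le>Q. of_nat (Q choose b) * exp (\<i> * of_real x) ^ b * exp (- (\<i> * of_real x)) ^ (Q - b)) / 2 ^ Q"
    unfolding power_divide binomial_ring by simp
  also have "(\<Sum>b\<le>Q. of_nat (Q choose b) * exp (\<i> * of_real x) ^ b * exp (- (\<i> * of_real x)) ^ (Q - b))
    = (\<Sum>b\<le>Q. of_nat (Q choose b) * exp (\<i> * of_int (2 * int b - int Q) * of_real x))"
  proof (intro sum.cong refl)
    fix b assume "b \<in> {..Q}"
    then have b: "of_nat (Q - b) = (of_nat Q - of_nat b :: complex)" by (simp add: of_nat_diff)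
    have "exp (\<i> * of_real x) ^ b * exp (- (\<i> * of_real x)) ^ (Q - b) = exp (of_nat b * (\<i> * of_real x) + of_nat (Q - b) * (- (\<i> * of_real x)))"
      by (simp only: exp_add exp_of_nat_mult)
    also have "of_nat b * (\<i> * of_real x) + of_nat (Q - b) * (- (\<i> * of_real x)) = \<i> * of_int (2 * int b - int Q) * of_real x"
      unfolding b by (simp add: algebra_simps)
    finally show "of_nat (Q choose b) * exp (\<i> * of_real x) ^ b * exp (- (\<i> * of_real x)) ^ (Q - b)
      = of_nat (Q choose b) * exp (\<i> * of_int (2 * int b - int Q) * of_real x)" by (simp add: mult.assoc)
  qed
  finally show ?thesis .
qed

text \<open>In the binomial expansion of the power only frequency \<open>m\<close> survives
  integration over a period, namely the index with \<open>2 b - Q = m\<close>; the shift by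
  \<open>u\<close> becomes a phase factor.\<close>

lemma integral_cos_power_exp:
  "(LINT t:{0..2*pi}|lborel. of_real (cos (t - u) ^ Q) * exp (- (\<i> * of_int m * of_real t)))
    = (\<Sum>b\<le>Q. if 2 * int b = int Q + m then of_nat (Q choose b) * 2 * pi / 2 ^ Q * exp (- (\<i> * of_int m * of_real u)) else 0)"
proof -
  have int: "set_integrable lborel {0..2*pi} (\<lambda>t. exp (\<i> * of_int d * complex_of_real t))" for d
    by (intro borel_integrable_atLeastAtMost' continuous_intros)
  define c where "c b = of_nat (Q choose b) / 2 ^ Q * exp (- (\<i> * of_int (2 * int b - int Q) * of_real u))" for b
  have eq: "of_real (cos (t - u) ^ Q) * exp (- (\<i> * of_int m * of_real t))
    = (\<Sum>b\<le>Q. c b * exp (\<i> * of_int (2 * int b - int Q - m) * of_real t))" for t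
  proof -
    have "exp (\<i> * of_int (2 * int b - int Q) * of_real (t - u)) * exp (- (\<i> * of_int m * of_real t))
      = exp (- (\<i> * of_int (2 * int b - int Q) * of_real u)) * exp (\<i> * of_int (2 * int b - int Q - m) * of_real t)" for b
      by (simp add: exp_add[symmetric] algebra_simps)
    then show ?thesis
      unfolding cos_power_exp c_def by (simp add: sum_distrib_right sum_divide_distrib mult.assoc)
  qed
  have "(LINT t:{0..2*pi}|lborel. of_real (cos (t - u) ^ Q) * exp (- (\<i> * of_int m * of_real t)))
    = (\<Sum>b\<le>Q. LINT t:{0..2*pi}|lborel. c b * exp (\<i> * of_int (2 * int b - int Q - m) * of_real t))"
    unfolding eq set_lebesgue_integral_def scaleR_sum_right
    by (rule Bochner_Integration.integral_sum)
      (rule set_integrable_mult_right[OF int, unfolded set_integrable_def])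
  also have "\<dots> = (\<Sum>b\<le>Q. c b * (if 2 * int b - int Q - m = 0 then 2 * pi else 0))"
    by (simp only: set_integral_mult_right integral_exp_int)
  also have "\<dots> = (\<Sum>b\<le>Q. if 2 * int b = int Q + m then of_nat (Q choose b) * 2 * pi / 2 ^ Q * exp (- (\<i> * of_int m * of_real u)) else 0)"
  proof (intro sum.cong refl)
    fix b
    show "c b * (if 2 * int b - int Q - m = 0 then 2 * pi else 0)
      = (if 2 * int b = int Q + m then of_nat (Q choose b) * 2 * pi / 2 ^ Q * exp (- (\<i> * of_int m * of_real u)) else 0)"
    proof (cases "2 * int b = int Q + m")
      case True
      then have "2 * int b - int Q = m" by simp
      then show ?thesis unfolding c_def by simp
    qed simp
  qed
  finally show ?thesis .
qed

definition zernike_weight :: "nat \<Rightarrow> nat \<Rightarrow> nat \<Rightarrow> real"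
  where "zernike_weight p q j = (- 1) ^ j * (fact (p + q - j) / (fact j * fact (q - j) * fact (p - j)))"

text \<open>Here \<open>p = (n - \<bar>m\<bar>) / 2\<close> and \<open>q = (n + \<bar>m\<bar>) / 2\<close>; the last factor is \<open>r\<^sup>q\<^sup>-\<^sup>p\<close> times the
  conjugate of the angular part.\<close>
definition conj_zernike :: "real \<Rightarrow> nat \<Rightarrow> nat \<Rightarrow> int \<Rightarrow> real \<times> real \<Rightarrow> complex"
  where "conj_zernike a p q m y = of_real (1 / a * sqrt ((real (p + q) + 1) / pi))
    * ((\<Sum>j\<le>p. of_real (zernike_weight p q j / a ^ (p + q - 2 * j)) * of_real ((fst y)\<^sup>2 + (snd y)\<^sup>2) ^ (p - j))
      * (of_real (fst y) + (if 0 \<le> m then - \<i> else \<i>) * of_real (snd y)) ^ (q - p))"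

lemma zernike_radial_eq:
  assumes "p \<le> q" "nat \<bar>m\<bar> = q - p"
  shows "zernike_radial (p + q) m r = (\<Sum>j\<le>p. zernike_weight p q j * r ^ (p + q - 2 * j))"
proof -
  have "(p + q - (q - p)) div 2 = p" "(p + q + (q - p)) div 2 = q" using assms by auto
  then show ?thesis unfolding zernike_radial_def Let_def assms(2) zernike_weight_def
    by (simp add: atLeast0AtMost)
qed

text \<open>The last factor of the Cartesian form supplies \<open>r^(q - p)\<close> together with
  the angle, and the exponents of \<open>r\<close> match because
  \<open>2 (p - j) + (q - p) = p + q - 2 j\<close>.\<close>

lemma conj_zernike_polar:
  assumes pq: "p \<le> q" and m: "nat \<bar>m\<bar> = q - p"
  shows "conj_zernike a p q m (r * cos t, r * sin t) = cnj (fourier_zernike a (p + q) m r t)"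
proof -
  have 1: "(r * cos t)\<^sup>2 + (r * sin t)\<^sup>2 = r\<^sup>2"
    by (simp add: power_mult_distrib distrib_left[symmetric])
  have 2: "(complex_of_real (r * cos t) + (if 0 \<le> m then - \<i> else \<i>) * complex_of_real (r * sin t)) ^ (q - p)
    = of_real (r ^ (q - p)) * exp (- (\<i> * of_int m * of_real t))"
  proof (cases "0 \<le> m")
    case True
    then have mm: "(of_int m :: complex) = of_nat (q - p)" using m by (metis abs_of_nonneg of_int_of_nat_eq int_nat_eq)
    have "complex_of_real (r * cos t) + (- \<i>) * complex_of_real (r * sin t) = of_real r * exp (- (\<i> * of_real t))"
      by (simp add: exp_eq_polar complex_eq_iff cis.ctr Re_exp Im_exp)
    moreover have "exp (- (\<i> * of_int m * of_real t)) = exp (- (\<i> * of_real t)) ^ (q - p)"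
      unfolding mm by (simp only: exp_of_nat_mult[symmetric]) (simp add: mult_ac)
    ultimately show ?thesis using True by (simp add: power_mult_distrib)
  next
    case False
    then have mm: "(of_int m :: complex) = - of_nat (q - p)" using m
      by (metis abs_of_neg linorder_not_le minus_minus int_nat_eq of_int_minus of_int_of_nat_eq abs_ge_zero)
    have "complex_of_real (r * cos t) + \<i> * complex_of_real (r * sin t) = of_real r * exp (\<i> * of_real t)"
      by (simp add: complex_eq_iff Re_exp Im_exp)
    moreover have "exp (- (\<i> * of_int m * of_real t)) = exp (\<i> * of_real t) ^ (q - p)"
      unfolding mm by (simp only: exp_of_nat_mult[symmetric]) (simp add: mult_ac)
    ultimately show ?thesis using False by (simp add: power_mult_distrib)
  qed
  have 3: "of_real (zernike_weight p q j / a ^ (p + q - 2 * j)) * (of_real (r\<^sup>2)) ^ (p - j) * complex_of_real (r ^ (q - p))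
     = of_real (zernike_weight p q j * (r / a) ^ (p + q - 2 * j))" if "j \<le> p" for j
  proof -
    have "p + q - 2 * j = 2 * (p - j) + (q - p)" using that pq by auto
    then have "(r\<^sup>2) ^ (p - j) * r ^ (q - p) = r ^ (p + q - 2 * j)" by (simp add: power_add power_mult)
    then have "complex_of_real ((r\<^sup>2) ^ (p - j) * r ^ (q - p)) = of_real (r ^ (p + q - 2 * j))" by (simp only:)
    then show ?thesis by (simp add: power_divide mult.assoc)
  qed
  have "(\<Sum>j\<le>p. of_real (zernike_weight p q j / a ^ (p + q - 2 * j)) * (of_real (r\<^sup>2)) ^ (p - j)) * complex_of_real (r ^ (q - p))
    = (\<Sum>j\<le>p. of_real (zernike_weight p q j * (r / a) ^ (p + q - 2 * j)))"
    unfolding sum_distrib_right using 3 by (intro sum.cong) auto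
  also have "\<dots> = of_real (zernike_radial (p + q) m (r / a))"
    unfolding zernike_radial_eq[OF assms] by simp
  finally have 4: "(\<Sum>j\<le>p. of_real (zernike_weight p q j / a ^ (p + q - 2 * j)) * (of_real (r\<^sup>2)) ^ (p - j)) * complex_of_real (r ^ (q - p))
    = of_real (zernike_radial (p + q) m (r / a))" .
  have "cnj (exp (\<i> * of_int m * of_real t)) = exp (- (\<i> * of_int m * of_real t))"
    by (simp add: exp_cnj)
  then have 5: "cnj (fourier_zernike a (p + q) m r t) = of_real (1 / a * sqrt ((real (p + q) + 1) / pi))
      * (of_real (zernike_radial (p + q) m (r / a)) * exp (- (\<i> * of_int m * of_real t)))"
    unfolding fourier_zernike_def by (simp only: complex_cnj_mult complex_cnj_complex_of_real of_real_mult mult.assoc)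
  show ?thesis unfolding 5 4[symmetric]
    unfolding conj_zernike_def fst_conv snd_conv 1 2 by (simp only: mult.assoc)
qed

lemma continuous_conj_zernike [continuous_intros]: "continuous_on S (conj_zernike a p q m)"
  unfolding conj_zernike_def[abs_def] by (intro continuous_intros)

lemma integral_zernike_radial_power:
  assumes pq: "p \<le> q" and a: "0 < a" and m: "nat \<bar>m\<bar> = q - p"
  shows "(LINT r:{0..a}|lborel. complex_of_real (zernike_radial (p + q) m (r / a) * r ^ Suc Q))
    = of_real (a ^ (Q + 2) * (\<Sum>j\<le>p. zernike_weight p q j / real (p + q - 2 * j + Q + 2)))"
proof -
  have eq: "zernike_radial (p + q) m (r / a) * r ^ Suc Q
     = (\<Sum>j\<le>p. (zernike_weight p q j / a ^ (p + q - 2 * j)) * r ^ (p + q - 2 * j + Suc Q))" for r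
    unfolding zernike_radial_eq[OF pq m] sum_distrib_right
    by (intro sum.cong refl) (simp only: power_divide power_add times_divide_eq_left times_divide_eq_right mult.assoc)
  have int: "integrable lborel (\<lambda>r. (zernike_weight p q j / a ^ (p + q - 2 * j)) * (r ^ N * indicator {0..a} r))" for j N
  proof (intro integrable_mult_right)
    have "set_integrable lborel {0..a} (\<lambda>r. r ^ N)"
      by (intro borel_integrable_atLeastAtMost' continuous_intros)
    then show "integrable lborel (\<lambda>r. r ^ N * indicator {0..a} r)" by (simp add: set_integrable_def mult.commute)
  qed
  have "(LINT r:{0..a}|lborel. complex_of_real (zernike_radial (p + q) m (r / a) * r ^ Suc Q))
    = of_real (LINT r|lborel. (\<Sum>j\<le>p. (zernike_weight p q j / a ^ (p + q - 2 * j)) * (r ^ (p + q - 2 * j + Suc Q) * indicator {0..a} r)))"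
    unfolding set_lebesgue_integral_def eq integral_complex_of_real[symmetric]
    by (intro Bochner_Integration.integral_cong refl) (simp add: scaleR_conv_of_real sum_distrib_right sum_distrib_left mult_ac)
  also have "(LINT r|lborel. (\<Sum>j\<le>p. (zernike_weight p q j / a ^ (p + q - 2 * j)) * (r ^ (p + q - 2 * j + Suc Q) * indicator {0..a} r)))
    = (\<Sum>j\<le>p. (zernike_weight p q j / a ^ (p + q - 2 * j)) * (LINT r|lborel. r ^ (p + q - 2 * j + Suc Q) * indicator {0..a} r))"
    unfolding Bochner_Integration.integral_sum[OF int] integral_mult_right_zero ..
  also have "\<dots> = (\<Sum>j\<le>p. a ^ (Q + 2) * (zernike_weight p q j / real (p + q - 2 * j + Q + 2)))"
  proof (intro sum.cong refl)
    fix j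
    have "(LINT r|lborel. r ^ (p + q - 2 * j + Suc Q) * indicator {0..a} r) = a ^ (p + q - 2 * j) * a ^ (Q + 2) / real (p + q - 2 * j + Q + 2)"
      using a integral_power[of 0 a "p + q - 2 * j + Suc Q"] by (simp add: power_add)
    then show "(zernike_weight p q j / a ^ (p + q - 2 * j)) * (LINT r|lborel. r ^ (p + q - 2 * j + Suc Q) * indicator {0..a} r)
      = a ^ (Q + 2) * (zernike_weight p q j / real (p + q - 2 * j + Q + 2))"
      using a by simp
  qed
  finally show ?thesis by (simp only: sum_distrib_left)
qed

text \<open>The inner product of two plane vectors through the angle between them; the shift by
  \<open>lattice_angle k\<close> ends up as the phase factor of the coefficient.\<close>

lemma lattice_phase: "real_of_int (fst k) * (r * cos t) + real_of_int (snd k) * (r * sin t) = r * lattice_abs k * cos (t - lattice_angle k)"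
proof -
  let ?z = "Complex (of_int (fst k)) (of_int (snd k))"
  have n: "norm ?z = lattice_abs k" by (simp add: cmod_def lattice_abs_def)
  have "?z = of_real (norm ?z) * exp (\<i> * of_real (lattice_angle k))"
    unfolding lattice_angle_def by (rule Arg2pi_eq)
  then have z: "?z = of_real (lattice_abs k) * exp (\<i> * of_real (lattice_angle k))" unfolding n .
  have "real_of_int (fst k) = lattice_abs k * cos (lattice_angle k)"
    using arg_cong[OF z, of Re] by (simp add: Re_exp Im_exp)
  moreover have "real_of_int (snd k) = lattice_abs k * sin (lattice_angle k)"
    using arg_cong[OF z, of Im] by (simp add: Re_exp Im_exp)
  ultimately show ?thesis by (simp add: cos_diff algebra_simps)
qed

text \<open>One term of the exponential series of the character. In polar coordinates it separates:
  the phase contributes a power of \<open>r\<close> and the same power of a shifted cosine, so an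
  angular integral multiplies a moment of the radial polynomial.\<close>

lemma disc_moment:
  assumes pq: "p \<le> q" and a: "0 < a" and m: "nat \<bar>m\<bar> = q - p"
  shows "(\<integral>y. indicator (cball 0 a) y *\<^sub>R (conj_zernike a p q m y
      * ((\<i> * of_real (K * (of_int (fst k) * fst y + of_int (snd k) * snd y))) ^ Q /\<^sub>R fact Q)) \<partial>lborel)
    = of_real (1 / a * sqrt ((real (p + q) + 1) / pi)) * ((\<i> * of_real (K * lattice_abs k)) ^ Q / fact Q)
      * (LINT t:{0..2*pi}|lborel. of_real (cos (t - lattice_angle k) ^ Q) * exp (- (\<i> * of_int m * of_real t)))
      * of_real (a ^ (Q + 2) * (\<Sum>j\<le>p. zernike_weight p q j / real (p + q - 2 * j + Q + 2)))"
proof -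
  define G where "G y = indicator (cball 0 a) y *\<^sub>R (conj_zernike a p q m y
      * ((\<i> * of_real (K * (of_int (fst k) * fst y + of_int (snd k) * snd y))) ^ Q /\<^sub>R fact Q))" for y :: "real \<times> real"
  define A where "A = (LINT t:{0..2*pi}|lborel. of_real (cos (t - lattice_angle k) ^ Q) * exp (- (\<i> * of_int m * of_real t)))"
  define B where "B = complex_of_real (1 / a * sqrt ((real (p + q) + 1) / pi)) * ((\<i> * of_real (K * lattice_abs k)) ^ Q / fact Q)"
  have "integrable lborel G"
    unfolding G_def by (rule borel_integrable_compact) (auto intro!: continuous_intros)
  then have "integral\<^sup>L lborel G = (LINT r:{0..}|lborel. LINT t:{0..2*pi}|lborel. G (r * cos t, r * sin t) * of_real r)"
    by (rule integral_polar(2)[symmetric])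
  also have "\<dots> = (LINT r:{0..}|lborel. indicator {0..a} r *\<^sub>R (B * A * complex_of_real (zernike_radial (p + q) m (r / a) * r ^ Suc Q)))"
  proof (rule set_lebesgue_integral_cong)
    show "\<forall>r. r \<in> {0..} \<longrightarrow> (LINT t:{0..2*pi}|lborel. G (r * cos t, r * sin t) * of_real r)
      = indicator {0..a} r *\<^sub>R (B * A * complex_of_real (zernike_radial (p + q) m (r / a) * r ^ Suc Q))"
    proof (intro allI impI)
      fix r :: real assume "r \<in> {0..}"
      then have r: "0 \<le> r" by simp
      have "norm (r * cos t, r * sin t) = r" for t
      proof -
        have "(r * cos t)\<^sup>2 + (r * sin t)\<^sup>2 = r\<^sup>2"
          by (simp add: power_mult_distrib distrib_left[symmetric])
        then show ?thesis using r by (simp add: norm_prod_def)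
      qed
      then have ind: "indicator (cball 0 a) (r * cos t, r * sin t) = (indicator {0..a} r :: real)" for t
        using r by (simp add: indicator_def)
      have "G (r * cos t, r * sin t) * of_real r
        = (indicator {0..a} r *\<^sub>R (B * complex_of_real (zernike_radial (p + q) m (r / a) * r ^ Suc Q)))
          * (of_real (cos (t - lattice_angle k) ^ Q) * exp (- (\<i> * of_int m * of_real t)))" for t
      proof -
        have "\<i> * complex_of_real (K * (of_int (fst k) * (r * cos t) + of_int (snd k) * (r * sin t)))
          = (\<i> * of_real (K * lattice_abs k)) * of_real r * of_real (cos (t - lattice_angle k))"
          unfolding lattice_phase by (simp add: mult_ac)
        then have "(\<i> * complex_of_real (K * (of_int (fst k) * (r * cos t) + of_int (snd k) * (r * sin t)))) ^ Q
          = (\<i> * of_real (K * lattice_abs k)) ^ Q * of_real (r ^ Q) * of_real (cos (t - lattice_angle k) ^ Q)"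
          by (simp only: power_mult_distrib of_real_power)
        moreover have "cnj (exp (\<i> * of_int m * of_real t)) = exp (- (\<i> * of_int m * of_real t))"
          by (simp add: exp_cnj)
        ultimately show ?thesis
          unfolding G_def ind fst_conv snd_conv conj_zernike_polar[OF pq m] fourier_zernike_def B_def
          by (simp add: scaleR_conv_of_real divide_inverse mult_ac)
      qed
      then show "(LINT t:{0..2*pi}|lborel. G (r * cos t, r * sin t) * of_real r)
        = indicator {0..a} r *\<^sub>R (B * A * complex_of_real (zernike_radial (p + q) m (r / a) * r ^ Suc Q))"
        by (simp only: set_integral_mult_right A_def[symmetric]) (simp add: mult_ac)
    qed
  qed simp
  also have "\<dots> = (LINT r:{0..a}|lborel. B * A * complex_of_real (zernike_radial (p + q) m (r / a) * r ^ Suc Q))"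
    unfolding set_lebesgue_integral_def by (intro Bochner_Integration.integral_cong refl) (auto split: split_indicator)
  also have "\<dots> = B * A * of_real (a ^ (Q + 2) * (\<Sum>j\<le>p. zernike_weight p q j / real (p + q - 2 * j + Q + 2)))"
    unfolding set_integral_mult_right integral_zernike_radial_power[OF pq a m] ..
  finally show ?thesis unfolding G_def A_def B_def .
qed

text \<open>The surviving index is \<open>l + s\<close> for \<open>m >= 0\<close> and
  \<open>s\<close> for \<open>m < 0\<close>; by symmetry of the binomial coefficients both give the
  same value.\<close>

lemma angular_moment_eq:
  assumes "nat \<bar>m\<bar> = l"
  shows "(LINT t:{0..2*pi}|lborel. of_real (cos (t - u) ^ (l + 2 * s)) * exp (- (\<i> * of_int m * of_real t)))
    = of_nat ((l + 2 * s) choose s) * 2 * pi / 2 ^ (l + 2 * s) * exp (- (\<i> * of_int m * of_real u))"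
proof -
  define b where "b = (if 0 \<le> m then l + s else s)"
  have iff: "2 * int b' = int (l + 2 * s) + m \<longleftrightarrow> b' = b" for b'
    using assms by (auto simp: b_def)
  have "(l + 2 * s) choose b = (l + 2 * s) choose s"
    using binomial_symmetric[of s "l + 2 * s"] by (auto simp: b_def add.commute)
  moreover have "b \<le> l + 2 * s" by (auto simp: b_def)
  ultimately show ?thesis unfolding integral_cos_power_exp iff by simp
qed

lemma angular_moment_zero:
  assumes "\<And>s. Q \<noteq> nat \<bar>m\<bar> + 2 * s"
  shows "(LINT t:{0..2*pi}|lborel. of_real (cos (t - u) ^ Q) * exp (- (\<i> * of_int m * of_real t))) = 0"
proof -
  have "2 * int b \<noteq> int Q + m" if "b \<le> Q" for b
  proof
    assume eq: "2 * int b = int Q + m"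
    show False
    proof (cases "0 \<le> m")
      case True
      then have "Q = nat \<bar>m\<bar> + 2 * (Q - b)" using eq that by linarith
      then show False using assms by blast
    next
      case False
      then have "Q = nat \<bar>m\<bar> + 2 * b" using eq by linarith
      then show False using assms by blast
    qed
  qed
  then show ?thesis unfolding integral_cos_power_exp by (intro sum.neutral) auto
qed

text \<open>Term by term integration of the exponential series leaves the powers
  \<open>Q = p + q + 2 t\<close>: the angular moment vanishes unless \<open>Q = |m| + 2 s\<close>,
  and then the radial moment vanishes for \<open>s < p\<close>. On the remaining powers
  \<open>i^Q = i^(p + q) (-1)^t\<close> supplies the alternating sign of the Bessel series.\<close>

proposition disc_fourier_sums:
  assumes pq: "p \<le> q" and a: "0 < a" and m: "nat \<bar>m\<bar> = q - p"
  defines "c0 \<equiv> complex_of_real (1 / a * sqrt ((real (p + q) + 1) / pi))"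
  shows "(\<integral>y. indicator (cball 0 a) y *\<^sub>R (conj_zernike a p q m y
      * exp (\<i> * of_real (pi / a * (of_int (fst k) * fst y + of_int (snd k) * snd y)))) \<partial>lborel)
    = 2 * c0 * of_real (a\<^sup>2) * \<i> ^ (p + q) * exp (- (\<i> * of_int m * of_real (lattice_angle k))) * of_real (bessel_quotient (p + q) k)"
proof -
  define ph where "ph y = \<i> * complex_of_real (pi / a * (of_int (fst k) * fst y + of_int (snd k) * snd y))" for y :: "real \<times> real"
  define G where "G Q y = indicator (cball 0 a) y *\<^sub>R (conj_zernike a p q m y * (ph y ^ Q /\<^sub>R fact Q))" for Q and y :: "real \<times> real"
  have contph: "continuous_on S ph" for S unfolding ph_def by (intro continuous_intros)
  \<comment> \<open>Bounds on the compact disc turn a multiple of an exponential series into a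
    majorant for exchanging sum and integral.\<close>
  have "compact (conj_zernike a p q m ` cball 0 a)" "compact (ph ` cball 0 a)"
    by (intro compact_continuous_image continuous_intros contph compact_cball)+
  then obtain C1 C2 where C: "\<And>y. y \<in> cball 0 a \<Longrightarrow> norm (conj_zernike a p q m y) \<le> C1" "\<And>y. y \<in> cball 0 a \<Longrightarrow> norm (ph y) \<le> C2"
    unfolding compact_eq_bounded_closed bounded_iff by blast
  have C0: "0 \<le> C1" "0 \<le> C2" using C[of 0] a by (auto intro: order_trans[OF norm_ge_zero])
  have int: "integrable lborel (G Q)" for Q
    unfolding G_def[abs_def] by (rule borel_integrable_compact) (auto intro!: continuous_intros contph)
  have nG: "norm (G Q y) \<le> indicator (cball 0 a) y * (C1 * (C2 ^ Q /\<^sub>R fact Q))" for Q y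
  proof (cases "y \<in> cball 0 a")
    case True
    have "norm (conj_zernike a p q m y) * norm (ph y ^ Q /\<^sub>R fact Q) \<le> C1 * (C2 ^ Q /\<^sub>R fact Q)"
      using C(1)[OF True] C(2)[OF True] C0
      by (intro mult_mono) (auto simp: norm_power divide_inverse intro!: mult_left_mono power_mono)
    then show ?thesis using True by (simp add: G_def norm_mult)
  qed (simp add: G_def)
  have sexp: "summable (\<lambda>Q. C1 * (C2 ^ Q /\<^sub>R fact Q))"
    by (intro summable_mult summable_exp_generic)
  have "(\<lambda>Q. integral\<^sup>L lborel (G Q)) sums (\<integral>y. (\<Sum>Q. G Q y) \<partial>lborel)"
  proof (rule sums_integral[OF int])
    show "AE y in lborel. summable (\<lambda>Q. norm (G Q y))"
    proof (intro AE_I2 summable_comparison_test'[OF summable_mult[OF sexp]])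
      show "norm (norm (G Q y)) \<le> indicator (cball 0 a) y * (C1 * (C2 ^ Q /\<^sub>R fact Q))" for Q y
        using nG[of Q y] by simp
    qed
    show "summable (\<lambda>Q. \<integral>y. norm (G Q y) \<partial>lborel)"
    proof (rule summable_comparison_test'[OF summable_mult[OF sexp]])
      fix Q :: nat
      have "(\<integral>y. norm (G Q y) \<partial>lborel) \<le> (\<integral>y. indicator (cball 0 a) y * (C1 * (C2 ^ Q /\<^sub>R fact Q)) \<partial>(lborel :: (real \<times> real) measure))"
        by (intro integral_mono integrable_norm int nG integrable_mult_left)
          (auto simp: integrable_indicator_iff intro!: emeasure_bounded_finite[unfolded infinity_ennreal_def])
      also have "\<dots> = measure lborel (cball 0 a :: (real \<times> real) set) * (C1 * (C2 ^ Q /\<^sub>R fact Q))"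
        by simp
      finally show "norm (\<integral>y. norm (G Q y) \<partial>lborel) \<le> measure lborel (cball 0 a :: (real \<times> real) set) * (C1 * (C2 ^ Q /\<^sub>R fact Q))"
        by simp
    qed
  qed
  moreover have "(\<Sum>Q. G Q y) = indicator (cball 0 a) y *\<^sub>R (conj_zernike a p q m y * exp (ph y))" for y
    unfolding G_def by (intro sums_unique[symmetric] sums_scaleR_right sums_mult exp_converges)
  ultimately have sums: "(\<lambda>Q. integral\<^sup>L lborel (G Q)) sums (\<integral>y. indicator (cball 0 a) y *\<^sub>R (conj_zernike a p q m y * exp (ph y)) \<partial>lborel)"
    by simp
  have moment_eq: "integral\<^sup>L lborel (G Q) = c0 * ((\<i> * of_real (pi / a * lattice_abs k)) ^ Q / fact Q)
      * (LINT t:{0..2*pi}|lborel. of_real (cos (t - lattice_angle k) ^ Q) * exp (- (\<i> * of_int m * of_real t)))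
      * of_real (a ^ (Q + 2) * (\<Sum>j\<le>p. zernike_weight p q j / real (p + q - 2 * j + Q + 2)))" for Q
    unfolding G_def ph_def c0_def by (rule disc_moment[OF pq a m])
  have moment: "(\<Sum>j\<le>p. zernike_weight p q j / real (p + q - 2 * j + (q - p + 2 * s) + 2))
    = (if s < p then 0 else fact s * fact (q - p + s) / (2 * fact (s - p) * fact (q + 1 + s)))" for s
  proof -
    have "real (p + q - 2 * j + (q - p + 2 * s) + 2) = 2 * (real (q + 1 - j) + real s)" if "j \<le> p" for j
      using that pq by (simp add: of_nat_diff)
    then show ?thesis
      unfolding zernike_moment[OF pq, symmetric] zernike_weight_def by (intro sum.cong) auto
  qed
  have zero: "integral\<^sup>L lborel (G Q) = 0" if "Q \<notin> range (\<lambda>t. p + q + 2 * t)" for Q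
  proof (cases "\<exists>s. Q = q - p + 2 * s")
    case True
    then obtain s where s: "Q = q - p + 2 * s" by blast
    have "s < p"
    proof (rule ccontr)
      assume "\<not> s < p"
      then have "Q = p + q + 2 * (s - p)" using s pq by auto
      then show False using that by blast
    qed
    then show ?thesis unfolding moment_eq s moment by simp
  next
    case False
    then have "\<And>s. Q \<noteq> nat \<bar>m\<bar> + 2 * s" using m by auto
    then show ?thesis unfolding moment_eq using angular_moment_zero[of Q m "lattice_angle k"] by simp
  qed
  have eval: "integral\<^sup>L lborel (G (p + q + 2 * t))
    = 2 * c0 * of_real (a\<^sup>2) * \<i> ^ (p + q) * exp (- (\<i> * of_int m * of_real (lattice_angle k))) * of_real (bessel_series (p + q) (lattice_abs k) t)" for t
  proof -
    define Q where "Q = p + q + 2 * t"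
    define e where "e = exp (- (\<i> * of_int m * of_real (lattice_angle k)))"
    define x where "x = lattice_abs k"
    \<comment> \<open>With \<open>q - p = |m|\<close>, the index \<open>s\<close> in both moment
      formulas is \<open>p + t\<close>.\<close>
    have Q: "Q = q - p + 2 * (p + t)" using pq by (simp add: Q_def)
    have ang: "(LINT t:{0..2*pi}|lborel. of_real (cos (t - lattice_angle k) ^ Q) * exp (- (\<i> * of_int m * of_real t)))
      = of_real (real (Q choose (p + t)) * 2 * pi / 2 ^ Q) * e"
      unfolding Q angular_moment_eq[OF m] e_def by simp
    have rad: "(\<Sum>j\<le>p. zernike_weight p q j / real (p + q - 2 * j + Q + 2)) = fact (p + t) * fact (q + t) / (2 * fact t * fact (p + q + 1 + t))"
    proof -
      have *: "q - p + (p + t) = q + t" "q + 1 + (p + t) = p + q + 1 + t" "p + t - p = t" "\<not> p + t < p" using pq by auto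
      show ?thesis unfolding Q moment * by simp
    qed
    have ch: "real (Q choose (p + t)) = fact Q / (fact (p + t) * fact (q + t))"
    proof -
      have "p + t \<le> Q" "Q - (p + t) = q + t" by (auto simp: Q_def)
      then show ?thesis using binomial_fact[of "p + t" Q, where 'a = real] by simp
    qed
    have "\<i> ^ Q = \<i> ^ (p + q) * (- 1) ^ t" by (simp add: Q_def power_add power_mult)
    then have ip: "(\<i> * complex_of_real y) ^ Q = \<i> ^ (p + q) * of_real ((- 1) ^ t * y ^ Q)" for y
      by (simp add: power_mult_distrib)
    \<comment> \<open>The factorials of \<open>Q\<close>, \<open>p + t\<close> and
      \<open>q + t\<close> cancel between the exponential series, the binomial coefficient and the
      radial moment; those of the Bessel series remain.\<close>
    have "(- 1) ^ t * (pi / a * x) ^ Q / fact Q * (fact Q / (fact (p + t) * fact (q + t)) * 2 * pi / 2 ^ Q)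
       * (a ^ (Q + 2) * (fact (p + t) * fact (q + t) / (2 * fact t * fact (p + q + 1 + t))))
      = (- 1) ^ t * (pi / a * x) ^ Q * pi / 2 ^ Q * a ^ (Q + 2) / (fact t * fact (p + q + 1 + t))"
      by (simp add: field_simps del: fact_Suc)
    also have "\<dots> = 2 * a\<^sup>2 * bessel_series (p + q) x t"
    proof -
      have "(pi / a * x) ^ Q * a ^ (Q + 2) = (pi * x) ^ Q * a\<^sup>2"
        using a by (simp add: power_divide power_mult_distrib power_add power2_eq_square)
      then have "(- 1) ^ t * (pi / a * x) ^ Q * pi / 2 ^ Q * a ^ (Q + 2) / F = (- 1) ^ t * pi / (2 ^ Q * F) * ((pi * x) ^ Q * a\<^sup>2)" for F
      proof -
        assume eq: "(pi / a * x) ^ Q * a ^ (Q + 2) = (pi * x) ^ Q * a\<^sup>2"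
        have "(- 1) ^ t * X * pi / P * Y / F = (- 1) ^ t * pi / (P * F) * (X * Y)" for X P Y :: real by simp
        then show ?thesis unfolding eq[symmetric] .
      qed
      moreover have "(- 1) ^ t * pi / (2 ^ Q * F) * ((pi * x) ^ Q * a\<^sup>2) = 2 * a\<^sup>2 * ((- 1) ^ t / F * ((pi / 2) * (pi / 2) ^ Q) * x ^ Q)" for F
        by (simp add: power_mult_distrib power_divide mult_ac)
      moreover have "(pi / 2) ^ (p + q + 1 + 2 * t) = (pi / 2) * (pi / 2) ^ Q" "x ^ (p + q + 2 * t) = x ^ Q" by (simp_all add: Q_def)
      ultimately show ?thesis unfolding bessel_series_def by (simp only:)
    qed
    finally have real_eq: "(- 1) ^ t * (pi / a * x) ^ Q / fact Q * (fact Q / (fact (p + t) * fact (q + t)) * 2 * pi / 2 ^ Q)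
       * (a ^ (Q + 2) * (fact (p + t) * fact (q + t) / (2 * fact t * fact (p + q + 1 + t)))) = 2 * a\<^sup>2 * bessel_series (p + q) x t" .
    have "integral\<^sup>L lborel (G Q) = c0 * \<i> ^ (p + q) * e * of_real ((- 1) ^ t * (pi / a * x) ^ Q / fact Q * (fact Q / (fact (p + t) * fact (q + t)) * 2 * pi / 2 ^ Q)
       * (a ^ (Q + 2) * (fact (p + t) * fact (q + t) / (2 * fact t * fact (p + q + 1 + t)))))"
      unfolding moment_eq ang rad x_def[symmetric] ip ch by (simp add: mult_ac)
    also note real_eq
    finally show ?thesis unfolding Q_def e_def x_def by (simp add: mult_ac)
  qed
  \<comment> \<open>All other terms vanish, so the series may be summed along this increasing
    sequence of exponents.\<close>
  have "strict_mono (\<lambda>t. p + q + 2 * t)" by (auto simp: strict_mono_def)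
  then have "(\<lambda>t. integral\<^sup>L lborel (G (p + q + 2 * t))) sums (\<integral>y. indicator (cball 0 a) y *\<^sub>R (conj_zernike a p q m y * exp (ph y)) \<partial>lborel)"
    using sums sums_mono_reindex[of "\<lambda>t. p + q + 2 * t" "\<lambda>Q. integral\<^sup>L lborel (G Q)"] zero by blast
  moreover have "(\<lambda>t. integral\<^sup>L lborel (G (p + q + 2 * t))) sums
    (2 * c0 * of_real (a\<^sup>2) * \<i> ^ (p + q) * exp (- (\<i> * of_int m * of_real (lattice_angle k))) * of_real (bessel_quotient (p + q) k))"
    unfolding eval by (intro sums_mult sums_of_real bessel_quotient_sums)
  ultimately show ?thesis unfolding ph_def by (rule sums_unique2)
qed

section \<open>Uniform boundedness of the partial sums\<close>

lemma sum_exp_dirichlet: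
  "(\<Sum>k\<in>{- int M..int M}. exp (\<i> * of_int k * of_real t)) = complex_of_real (dirichlet_kernel M t)"
proof (induction M)
  case (Suc M)
  have "{- int (Suc M)..int (Suc M)} = insert (int (Suc M)) (insert (- int (Suc M)) {- int M..int M})" by auto
  then have "(\<Sum>k\<in>{- int (Suc M)..int (Suc M)}. exp (\<i> * of_int k * of_real t))
    = exp (\<i> * of_int (int (Suc M)) * of_real t) + (exp (\<i> * of_int (- int (Suc M)) * of_real t) + complex_of_real (dirichlet_kernel M t))"
    using Suc by simp
  also have "exp (\<i> * of_int (int (Suc M)) * of_real t) + (exp (\<i> * of_int (- int (Suc M)) * of_real t) + complex_of_real (dirichlet_kernel M t))
    = complex_of_real (2 * cos (real (Suc M) * t)) + complex_of_real (dirichlet_kernel M t)"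
  proof -
    have "exp (\<i> * of_real r) + exp (- (\<i> * of_real r)) = complex_of_real (2 * cos r)" for r
      by (simp add: complex_eq_iff Re_exp Im_exp)
    from this[of "real (Suc M) * t"] show ?thesis by (simp add: mult.assoc add.assoc[symmetric] del: of_nat_Suc)
  qed
  also have "\<dots> = complex_of_real (dirichlet_kernel (Suc M) t)"
    by (simp add: dirichlet_kernel_def)
  finally show ?case .
qed (simp add: dirichlet_kernel_def)

lemma borel_measurable_dirichlet [measurable]: "dirichlet_kernel M \<in> borel_measurable borel"
  using continuous_dirichlet[of UNIV "\<lambda>t. t" M] by (intro borel_measurable_continuous_onI) simp

lemma mem_disc_iff: "(x, y) \<in> cball (0 :: real \<times> real) pi \<longleftrightarrow> \<bar>x\<bar> \<le> pi \<and> \<bar>y\<bar> \<le> disc_height x"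
proof -
  have "(x, y) \<in> cball (0 :: real \<times> real) pi \<longleftrightarrow> x\<^sup>2 + y\<^sup>2 \<le> pi\<^sup>2"
    using real_sqrt_le_iff[of "x\<^sup>2 + y\<^sup>2" "pi\<^sup>2"] by (simp add: norm_prod_def)
  also have "\<dots> \<longleftrightarrow> \<bar>x\<bar> \<le> pi \<and> \<bar>y\<bar> \<le> disc_height x"
  proof
    assume le: "x\<^sup>2 + y\<^sup>2 \<le> pi\<^sup>2"
    then have "x\<^sup>2 \<le> pi\<^sup>2" using zero_le_power2[of y] by linarith
    then have "\<bar>x\<bar> \<le> pi" using abs_le_square_iff[of x pi] by simp
    moreover have "\<bar>y\<bar> \<le> disc_height x" unfolding disc_height_def using le by (intro real_le_rsqrt) simp
    ultimately show "\<bar>x\<bar> \<le> pi \<and> \<bar>y\<bar> \<le> disc_height x" by simp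
  next
    assume a: "\<bar>x\<bar> \<le> pi \<and> \<bar>y\<bar> \<le> disc_height x"
    then have "x\<^sup>2 \<le> pi\<^sup>2" using abs_le_square_iff[of x pi] by simp
    moreover have "\<bar>y\<bar>\<^sup>2 \<le> (disc_height x)\<^sup>2" using a by (intro power_mono) auto
    ultimately show "x\<^sup>2 + y\<^sup>2 \<le> pi\<^sup>2" by (simp add: disc_height_def)
  qed
  finally show ?thesis .
qed

text \<open>Passes from the planar Bochner integral to the iterated Henstock-Kurzweil integral over
  chords, the form in which the kernel estimates are stated.\<close>

lemma integral_disc_iterated:
  fixes A B :: "real \<Rightarrow> real"
  assumes A: "continuous_on UNIV A" and B: "continuous_on UNIV B"
  shows "(\<integral>u. indicator (cball 0 pi) u * (A (fst u) * B (snd u)) \<partial>lborel)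
    = integral {-pi..pi} (\<lambda>x. A x * integral {-disc_height x..disc_height x} B)"
proof -
  let ?G = "\<lambda>u::real \<times> real. indicator (cball 0 pi) u * (A (fst u) * B (snd u))"
  have int: "integrable lborel ?G"
  proof -
    have "continuous_on (cball 0 pi) (\<lambda>u::real \<times> real. A (fst u) * B (snd u))"
      by (intro continuous_on_mult continuous_on_compose2[OF A] continuous_on_compose2[OF B] continuous_intros subset_UNIV)
    from borel_integrable_compact[OF compact_cball this] show ?thesis by simp
  qed
  then have int': "integrable (lborel \<Otimes>\<^sub>M lborel) ?G" by (simp add: lborel_prod)
  have contJ: "continuous_on {-pi..pi} (\<lambda>x. integral {-disc_height x..disc_height x} B)"
  proof -
    have "integral {-disc_height x..disc_height x} B = integral {0..disc_height x} (\<lambda>t. B t + B (- t))" if "x \<in> {-pi..pi}" for x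
      using that by (intro integral_even_part continuous_on_subset[OF B] disc_height_nonneg) auto
    moreover have "continuous_on {-pi..pi} (\<lambda>x. integral {0..disc_height x} (\<lambda>t. B t + B (- t)))"
      by (intro continuous_indefinite_height continuous_intros continuous_on_compose2[OF B]) auto
    ultimately show ?thesis using continuous_on_cong[OF refl, of "{-pi..pi}" "\<lambda>x. integral {-disc_height x..disc_height x} B"
        "\<lambda>x. integral {0..disc_height x} (\<lambda>t. B t + B (- t))"] by blast
  qed
  have "(\<integral>u. ?G u \<partial>lborel) = (\<integral>x. (\<integral>y. ?G (x, y) \<partial>lborel) \<partial>lborel)"
    unfolding lborel_prod[symmetric] by (rule lborel_pair.integral_fst'[symmetric, OF int'])
  also have "\<dots> = (LINT x:{-pi..pi}|lborel. A x * integral {-disc_height x..disc_height x} B)"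
    unfolding set_lebesgue_integral_def
  proof (intro Bochner_Integration.integral_cong refl)
    fix x :: real
    show "(\<integral>y. ?G (x, y) \<partial>lborel) = indicator {-pi..pi} x *\<^sub>R (A x * integral {-disc_height x..disc_height x} B)"
    proof (cases "\<bar>x\<bar> \<le> pi")
      case True
      have "(\<integral>y. ?G (x, y) \<partial>lborel) = (\<integral>y. A x * (indicator {-disc_height x..disc_height x} y *\<^sub>R B y) \<partial>lborel)"
        using True by (intro Bochner_Integration.integral_cong refl) (auto simp: indicator_def mem_disc_iff simp del: mem_cball mem_cball_0)
      also have "\<dots> = A x * (LINT y:{-disc_height x..disc_height x}|lborel. B y)"
        by (simp add: set_lebesgue_integral_def)
      also have "(LINT y:{-disc_height x..disc_height x}|lborel. B y) = integral {-disc_height x..disc_height x} B"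
        by (intro set_borel_integral_eq_integral borel_integrable_atLeastAtMost' continuous_on_subset[OF B]) auto
      finally show ?thesis using True by (auto simp: indicator_def)
    next
      case False
      then have z: "?G (x, y) = 0" for y by (auto simp: indicator_def mem_disc_iff simp del: mem_cball mem_cball_0)
      have "indicator {-pi..pi} x = (0::real)" using False by (auto simp: indicator_def)
      then show ?thesis by (simp only: z Bochner_Integration.integral_zero scaleR_zero_left)
    qed
  qed
  also have "\<dots> = integral {-pi..pi} (\<lambda>x. A x * integral {-disc_height x..disc_height x} B)"
    by (intro set_borel_integral_eq_integral borel_integrable_atLeastAtMost' continuous_intros contJ continuous_on_subset[OF A]) auto
  finally show ?thesis .
qed

lemma integral_swap_plane:
  fixes G :: "real \<times> real \<Rightarrow> real"
  assumes "G \<in> borel_measurable borel"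
  shows "(\<integral>u. G (snd u, fst u) \<partial>lborel) = (\<integral>u. G u \<partial>lborel)"
  using lborel_pair.integral_product_swap[of G] assms by (simp add: lborel_prod split_beta')

text \<open>The two coordinates of a point of the disc cannot both exceed \<open>3 pi / 4\<close> in
  absolute value, as \<open>9 / 16 + 9 / 16 > 1\<close>. If the good one is the second, the
  coordinates are exchanged, and with them \<open>i\<close> and \<open>j\<close>, \<open>M\<close>
  and \<open>N\<close>; hence the symmetric bound.\<close>

lemma monomial_sum_bound_pi:
  assumes x: "(x1, x2) \<in> cball (0 :: real \<times> real) pi"
  shows "\<bar>\<integral>u. indicator (cball 0 pi) u * ((fst u ^ i * dirichlet_kernel M (x1 - fst u)) * (snd u ^ j * dirichlet_kernel N (x2 - snd u))) \<partial>lborel\<bar>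
    \<le> 2 * slice_bound i j + 2 * slice_bound j i"
proof -
  have iter: "(\<integral>u. indicator (cball 0 pi) u * ((fst u ^ i * dirichlet_kernel M (x1 - fst u)) * (snd u ^ j * dirichlet_kernel N (x2 - snd u))) \<partial>lborel)
    = integral {-pi..pi} (\<lambda>y1. dirichlet_kernel M (x1 - y1) * (y1 ^ i *
      integral {-disc_height y1..disc_height y1} (\<lambda>y2. y2 ^ j * dirichlet_kernel N (x2 - y2))))" for x1 x2 i j M N
    by (subst integral_disc_iterated) (auto intro!: continuous_intros simp: mult_ac)
  \<comment> \<open>The estimate itself shows this: at the origin with \<open>M = N = 0\<close> the
    bound dominates an absolute value.\<close>
  have nonneg: "0 \<le> slice_bound i j" for i j
    using order_trans[OF abs_ge_zero disc_partial_sum_bound[of 0 0 0 i j 0]] by simp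
  have le: "\<bar>x1\<bar> \<le> pi" "\<bar>x2\<bar> \<le> pi"
    using x mem_disc_iff[of x1 x2] disc_height_le[of x1] by auto
  show ?thesis
  proof (cases "\<bar>x1\<bar> \<le> 3 * pi / 4")
    case True
    show ?thesis unfolding iter using disc_partial_sum_bound[OF True le(2), of M i j N] nonneg[of j i] by linarith
  next
    case False
    have "\<bar>x2\<bar> \<le> 3 * pi / 4"
    proof (rule ccontr)
      assume "\<not> \<bar>x2\<bar> \<le> 3 * pi / 4"
      then have "(3 * pi / 4)\<^sup>2 \<le> \<bar>x1\<bar>\<^sup>2" "(3 * pi / 4)\<^sup>2 \<le> \<bar>x2\<bar>\<^sup>2" using False pi_gt_zero by (intro power_mono; simp)+
      moreover have "sqrt (x1\<^sup>2 + x2\<^sup>2) \<le> pi" using x by (simp add: norm_prod_def)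
      then have "x1\<^sup>2 + x2\<^sup>2 \<le> pi\<^sup>2" using real_sqrt_le_iff[of "x1\<^sup>2 + x2\<^sup>2" "pi\<^sup>2"] by simp
      moreover have "0 < pi\<^sup>2" by simp
      ultimately show False by (simp add: power_divide power_mult_distrib)
    qed
    note bound = disc_partial_sum_bound[OF this le(1), of N j i M]
    let ?H = "\<lambda>u. indicator (cball 0 pi) u * ((fst u ^ j * dirichlet_kernel N (x2 - fst u)) * (snd u ^ i * dirichlet_kernel M (x1 - snd u)))"
    have "?H \<in> borel_measurable (borel \<Otimes>\<^sub>M borel)"
    proof -
      have [measurable]: "cball (0::real \<times> real) pi \<in> sets (borel \<Otimes>\<^sub>M borel)" unfolding borel_prod by simp
      then show ?thesis by measurable
    qed
    then have "(\<integral>u. ?H (snd u, fst u) \<partial>lborel) = (\<integral>u. ?H u \<partial>lborel)"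
      by (intro integral_swap_plane) (simp add: borel_prod)
    moreover have "?H (snd u, fst u) = indicator (cball 0 pi) u * ((fst u ^ i * dirichlet_kernel M (x1 - fst u)) * (snd u ^ j * dirichlet_kernel N (x2 - snd u)))" for u
      by (cases u) (simp add: indicator_def norm_prod_def add.commute mult_ac)
    ultimately have eq: "(\<integral>u. indicator (cball 0 pi) u * ((fst u ^ i * dirichlet_kernel M (x1 - fst u)) * (snd u ^ j * dirichlet_kernel N (x2 - snd u))) \<partial>lborel)
      = (\<integral>u. ?H u \<partial>lborel)" by (simp only:)
    show ?thesis unfolding eq iter using bound nonneg[of i j] by linarith
  qed
qed

section \<open>Scaling from radius \<open>pi\<close> to radius \<open>a\<close>, and
  polynomials\<close>

lemma integral_scale_plane:
  fixes f :: "real \<times> real \<Rightarrow> 'b :: {banach, second_countable_topology}"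
  assumes f: "f \<in> borel_measurable borel" and c: "c \<noteq> 0"
  shows "(\<integral>u. f u \<partial>lborel) = c\<^sup>2 *\<^sub>R (\<integral>u. f (c *\<^sub>R u) \<partial>lborel)"
proof -
  have m: "(\<lambda>x. 0 + c *\<^sub>R x :: real \<times> real) \<in> lborel \<rightarrow>\<^sub>M borel"
    by (simp add: borel_measurable_continuous_onI continuous_intros)
  have "(\<integral>u. f u \<partial>lborel) = (\<integral>u. f u \<partial>(density (distr lborel borel (\<lambda>x. 0 + c *\<^sub>R x)) (\<lambda>_. ennreal (\<bar>c\<bar> ^ DIM(real \<times> real)))))"
    using lborel_affine[OF c, of "0 :: real \<times> real"] by (simp add: ennreal_power)
  also have "\<dots> = (\<integral>u. \<bar>c\<bar> ^ DIM(real \<times> real) *\<^sub>R f u \<partial>distr lborel borel (\<lambda>x. 0 + c *\<^sub>R x))"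
    using f by (intro integral_density) auto
  also have "\<dots> = \<bar>c\<bar> ^ DIM(real \<times> real) *\<^sub>R (\<integral>u. f u \<partial>distr lborel borel (\<lambda>x. 0 + c *\<^sub>R x))"
    by simp
  also have "(\<integral>u. f u \<partial>distr lborel borel (\<lambda>x. 0 + c *\<^sub>R x)) = (\<integral>u. f (0 + c *\<^sub>R u) \<partial>lborel)"
    by (rule integral_distr[OF m f])
  finally show ?thesis by (simp add: power2_eq_square numeral_2_eq_2)
qed

text \<open>This is \<open>4 a^2\<close>, the area of the period square, times the rectangular
  partial sum at \<open>x\<close> of the Fourier series of \<open>W\<close> cut off to the disc and
  continued with period \<open>2 a\<close>. The area is divided out at the very end.\<close>

definition partial_sum_integral :: "real \<Rightarrow> (real \<times> real \<Rightarrow> complex) \<Rightarrow> nat \<Rightarrow> nat \<Rightarrow> real \<times> real \<Rightarrow> complex"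
  where "partial_sum_integral a W M N x = (\<integral>y. indicator (cball 0 a) y *\<^sub>R (W y *
    of_real (dirichlet_kernel M (pi / a * (fst x - fst y)) * dirichlet_kernel N (pi / a * (snd x - snd y)))) \<partial>lborel)"

lemma continuous_dirichlet_plane:
  "continuous_on S (\<lambda>y :: real \<times> real. complex_of_real (dirichlet_kernel M (c * (u - fst y)) * dirichlet_kernel N (c * (v - snd y))))"
  by (intro continuous_intros)

text \<open>Scaling by \<open>K = a / pi\<close> brings the disc to radius \<open>pi\<close> and the
  kernels to period \<open>2 pi\<close>; the monomial gives \<open>K^(i + j)\<close> and the area
  element \<open>K^2\<close>.\<close>

lemma partial_sum_monomial_bound:
  assumes a: "0 < a" and x: "x \<in> cball 0 a"
  shows "norm (partial_sum_integral a (\<lambda>y. c * of_real (fst y ^ i * snd y ^ j)) M N x)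
    \<le> norm c * (a / pi) ^ (i + j + 2) * (2 * slice_bound i j + 2 * slice_bound j i)"
proof -
  define K where "K = a / pi"
  have K: "0 < K" using a by (simp add: K_def)
  have Kinv: "pi / a * (K * t) = t" "pi / a * t = t / K" "K * pi = a" for t using a by (auto simp: K_def field_simps)
  let ?D = "\<lambda>M t. dirichlet_kernel M t"
  let ?f = "\<lambda>y :: real \<times> real. indicator (cball 0 a) y *\<^sub>R (c * of_real (fst y ^ i * snd y ^ j) * of_real (?D M (pi / a * (fst x - fst y)) * ?D N (pi / a * (snd x - snd y))))"
  define I where "I = (\<integral>u. indicator (cball 0 pi) u * ((fst u ^ i * ?D M (fst x / K - fst u)) * (snd u ^ j * ?D N (snd x / K - snd u))) \<partial>lborel)"
  have fm: "?f \<in> borel_measurable borel"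
  proof -
    have "integrable lborel ?f"
      by (intro borel_integrable_compact continuous_intros continuous_dirichlet_plane compact_cball)
    then show ?thesis using borel_measurable_integrable by fastforce
  qed
  have "(\<integral>u. ?f u \<partial>lborel) = K\<^sup>2 *\<^sub>R (\<integral>u. ?f (K *\<^sub>R u) \<partial>lborel)"
    using K by (intro integral_scale_plane fm) auto
  also have "(\<integral>u. ?f (K *\<^sub>R u) \<partial>lborel) = (\<integral>u. (c * of_real (K ^ (i + j))) * of_real (indicator (cball 0 pi) u * ((fst u ^ i * ?D M (fst x / K - fst u)) * (snd u ^ j * ?D N (snd x / K - snd u)))) \<partial>lborel)"
  proof (intro Bochner_Integration.integral_cong refl)
    fix u :: "real \<times> real"
    have "K *\<^sub>R u \<in> cball 0 a \<longleftrightarrow> u \<in> cball 0 pi" using K Kinv(3) mult_le_cancel_left_pos[OF K, of "norm u" pi] by simp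
    then have "indicator (cball 0 a) (K *\<^sub>R u) = (indicator (cball 0 pi) u :: real)" by (simp add: indicator_def del: mem_cball mem_cball_0)
    moreover have "pi / a * (fst x - fst (K *\<^sub>R u)) = fst x / K - fst u" "pi / a * (snd x - snd (K *\<^sub>R u)) = snd x / K - snd u"
      using Kinv by (simp_all add: right_diff_distrib)
    moreover have "fst (K *\<^sub>R u) ^ i * snd (K *\<^sub>R u) ^ j = K ^ (i + j) * (fst u ^ i * snd u ^ j)"
      by (simp add: power_mult_distrib power_add)
    ultimately show "?f (K *\<^sub>R u) = (c * of_real (K ^ (i + j))) * of_real (indicator (cball 0 pi) u * ((fst u ^ i * ?D M (fst x / K - fst u)) * (snd u ^ j * ?D N (snd x / K - snd u))))"
      by (simp only: scaleR_conv_of_real of_real_mult mult_ac)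
  qed
  also have "\<dots> = (c * of_real (K ^ (i + j))) * of_real I"
    unfolding I_def by (simp only: integral_mult_right_zero integral_complex_of_real)
  finally have "partial_sum_integral a (\<lambda>y. c * of_real (fst y ^ i * snd y ^ j)) M N x = K\<^sup>2 *\<^sub>R ((c * of_real (K ^ (i + j))) * of_real I)"
    unfolding partial_sum_integral_def .
  then have "norm (partial_sum_integral a (\<lambda>y. c * of_real (fst y ^ i * snd y ^ j)) M N x) = norm c * K ^ (i + j + 2) * \<bar>I\<bar>"
    using K by (simp add: norm_mult norm_power power_add power2_eq_square mult_ac)
  also have "\<dots> \<le> norm c * K ^ (i + j + 2) * (2 * slice_bound i j + 2 * slice_bound j i)"
  proof (intro mult_left_mono)
    have "x = K *\<^sub>R (fst x / K, snd x / K)" using K by (simp add: prod_eq_iff)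
    then have "norm x = K * norm (fst x / K, snd x / K)" using K by (metis abs_of_pos norm_scaleR)
    then have "K * norm (fst x / K, snd x / K) \<le> K * pi" using x Kinv(3) by simp
    then have "(fst x / K, snd x / K) \<in> cball 0 pi" using K by simp
    then show "\<bar>I\<bar> \<le> 2 * slice_bound i j + 2 * slice_bound j i"
      unfolding I_def by (rule monomial_sum_bound_pi)
  qed (use K in auto)
  finally show ?thesis unfolding K_def .
qed

text \<open>Polynomial functions of the two coordinates with complex coefficients. Monomials and
  sums are the only constructors because the bound to be proved is additive; closure under products
  is derived.\<close>

inductive bipoly :: "(real \<times> real \<Rightarrow> complex) \<Rightarrow> bool" where
  monom: "bipoly (\<lambda>y. c * of_real (fst y ^ i * snd y ^ j))"
| add: "bipoly f \<Longrightarrow> bipoly g \<Longrightarrow> bipoly (\<lambda>y. f y + g y)"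

lemma bipoly_mult_monom: "bipoly g \<Longrightarrow> bipoly (\<lambda>y. c * of_real (fst y ^ i * snd y ^ j) * g y)"
proof (induction rule: bipoly.induct)
  case (monom d k l)
  have "(\<lambda>y :: real \<times> real. c * of_real (fst y ^ i * snd y ^ j) * (d * of_real (fst y ^ k * snd y ^ l)))
    = (\<lambda>y. (c * d) * of_real (fst y ^ (i + k) * snd y ^ (j + l)))"
    by (simp add: fun_eq_iff power_add mult_ac)
  then show ?case by (simp only: bipoly.monom)
next
  case (add f g)
  then show ?case using bipoly.add by (simp only: distrib_left)
qed

lemma bipoly_mult: "bipoly f \<Longrightarrow> bipoly g \<Longrightarrow> bipoly (\<lambda>y. f y * g y)"
proof (induction rule: bipoly.induct)
  case (add f1 f2)
  then show ?case using bipoly.add by (simp only: distrib_right)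
qed (rule bipoly_mult_monom)

lemma bipoly_const: "bipoly (\<lambda>y. c)"
  using bipoly.monom[of c 0 0] by simp

lemma bipoly_power: "bipoly f \<Longrightarrow> bipoly (\<lambda>y. f y ^ n)"
  by (induction n) (simp_all add: bipoly_const bipoly_mult)

lemma bipoly_sum: "finite I \<Longrightarrow> (\<And>i. i \<in> I \<Longrightarrow> bipoly (f i)) \<Longrightarrow> bipoly (\<lambda>y. \<Sum>i\<in>I. f i y)"
  by (induction I rule: finite_induct) (simp_all add: bipoly_const bipoly.add)

lemma bipoly_conj_zernike: "bipoly (conj_zernike a p q m)"
proof -
  have x: "bipoly (\<lambda>y. of_real (fst y))" and y: "bipoly (\<lambda>y. of_real (snd y))"
    using bipoly.monom[of 1 1 0] bipoly.monom[of 1 0 1] by simp_all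
  have "bipoly (\<lambda>y. of_real ((fst y)\<^sup>2 + (snd y)\<^sup>2))"
    using bipoly.add[OF bipoly_power[OF x, of 2] bipoly_power[OF y, of 2]] by simp
  then show ?thesis unfolding conj_zernike_def[abs_def]
    by (intro bipoly_mult bipoly_sum bipoly_power bipoly.add bipoly_const x y) auto
qed

lemma continuous_bipoly: "bipoly f \<Longrightarrow> continuous_on S f"
  by (induction rule: bipoly.induct) (auto intro!: continuous_intros)

proposition partial_sum_bipoly_bound:
  assumes a: "0 < a" and W: "bipoly W"
  shows "\<exists>C. \<forall>M N. \<forall>x \<in> cball 0 a. norm (partial_sum_integral a W M N x) \<le> C"
  using W
proof (induction rule: bipoly.induct)
  case (monom c i j)
  then show ?case using partial_sum_monomial_bound[OF a] by blast
next
  case (add f g)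
  then obtain C D where C: "\<forall>M N. \<forall>x \<in> cball 0 a. norm (partial_sum_integral a f M N x) \<le> C"
    and D: "\<forall>M N. \<forall>x \<in> cball 0 a. norm (partial_sum_integral a g M N x) \<le> D" by blast
  have int: "integrable lborel (\<lambda>y :: real \<times> real. indicator (cball 0 a) y *\<^sub>R (h y * complex_of_real (dirichlet_kernel M (pi / a * (fst x - fst y)) * dirichlet_kernel N (pi / a * (snd x - snd y)))))"
    if "bipoly h" for h M N x
    by (intro borel_integrable_compact continuous_intros continuous_bipoly[OF that] continuous_dirichlet_plane compact_cball)
  have "partial_sum_integral a (\<lambda>y. f y + g y) M N x = partial_sum_integral a f M N x + partial_sum_integral a g M N x" for M N x
    unfolding partial_sum_integral_def using add.hyps int
    by (simp only: distrib_right scaleR_add_right Bochner_Integration.integral_add)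
  then have "\<forall>M N. \<forall>x \<in> cball 0 a. norm (partial_sum_integral a (\<lambda>y. f y + g y) M N x) \<le> C + D"
    using C D by (simp add: norm_triangle_mono)
  then show ?case by blast
qed

section \<open>Weak convergence of the partial sums\<close>

text \<open>If the limit fails, there is a bad pair beyond every \<open>n\<close>, hence two
  sequences tending to infinity along which it fails. The reduction to sequences makes dominated
  convergence available for the double limit.\<close>

lemma double_limit_sequentially:
  fixes f :: "nat \<Rightarrow> nat \<Rightarrow> 'a :: metric_space"
  assumes "\<And>X Y. filterlim X sequentially sequentially \<Longrightarrow> filterlim Y sequentially sequentially
    \<Longrightarrow> (\<lambda>n. f (X n) (Y n)) \<longlonglongrightarrow> l"
  shows "((\<lambda>(M, N). f M N) \<longlongrightarrow> l) (sequentially \<times>\<^sub>F sequentially)"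
proof (rule tendstoI, rule ccontr)
  fix e :: real assume e: "0 < e" and not: "\<not> (\<forall>\<^sub>F x in sequentially \<times>\<^sub>F sequentially. dist (case x of (M, N) \<Rightarrow> f M N) l < e)"
  have "\<exists>M N. n \<le> M \<and> n \<le> N \<and> \<not> dist (f M N) l < e" for n
    using not unfolding eventually_prod_sequentially by fastforce
  then obtain X Y where XY: "\<And>n. n \<le> X n" "\<And>n. n \<le> Y n" "\<And>n. \<not> dist (f (X n) (Y n)) l < e"
    by metis
  have "filterlim X sequentially sequentially" "filterlim Y sequentially sequentially"
    using XY(1,2) by (auto intro: filterlim_at_top_mono[OF filterlim_ident])
  from tendstoD[OF assms[OF this] e] obtain n where "dist (f (X n) (Y n)) l < e"
    by (auto simp: eventually_sequentially)
  then show False using XY(3) by blast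
qed

section \<open>Integrals of a bounded sequence against \<open>L1\<close> functions\<close>

lemma integrable_complex_indicator:
  assumes "B \<in> sets M" "emeasure M B < \<infinity>"
  shows "integrable M (indicator B :: 'a \<Rightarrow> complex)"
proof -
  have "integrable M (\<lambda>x. complex_of_real (indicator B x))"
    using assms by (intro integrable_of_real) (simp add: integrable_indicator_iff)
  moreover have "(\<lambda>x. complex_of_real (indicator B x)) = indicator B" by (auto simp: indicator_def)
  ultimately show ?thesis by simp
qed

text \<open>\<open>U\<close> will be the difference between partial sums along two index sequences
  and their expected limit, cut off to the open disc. The uniform bound \<open>C\<close> is what
  carries convergence from boxes to all integrable functions.\<close>

context
  fixes U :: "nat \<Rightarrow> real \<times> real \<Rightarrow> complex" and C :: real
  assumes U: "\<And>n. U n \<in> borel_measurable borel" and bound: "\<And>n x. norm (U n x) \<le> C"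
begin

lemma integrable_mult_bounded:
  assumes "integrable lborel g" shows "integrable lborel (\<lambda>x. g x * U n x)"
proof (rule Bochner_Integration.integrable_bound)
  show "integrable lborel (\<lambda>x. C * norm (g x))" using assms by (intro integrable_mult_right integrable_norm)
  show "(\<lambda>x. g x * U n x) \<in> borel_measurable lborel"
    using U borel_measurable_integrable[OF assms] by simp
  have "0 \<le> C" using order_trans[OF norm_ge_zero bound] .
  then show "AE x in lborel. norm (g x * U n x) \<le> norm (C * norm (g x))"
  proof (intro AE_I2)
    fix x
    have "norm (g x) * norm (U n x) \<le> norm (g x) * C" by (intro mult_left_mono bound norm_ge_zero)
    then show "norm (g x * U n x) \<le> norm (C * norm (g x))" using \<open>0 \<le> C\<close> by (simp add: norm_mult mult.commute)
  qed
qed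

text \<open>Replacing \<open>g\<close> by \<open>h i\<close> changes the integrals by at most
  \<open>C\<close> times the \<open>L1\<close> distance, for all \<open>n\<close> at once.\<close>

lemma tendsto_zero_L1_closure:
  assumes h: "\<And>i. integrable lborel (h i)" and g: "integrable lborel g"
    and L1: "(\<lambda>i. \<integral>x. norm (g x - h i x) \<partial>lborel) \<longlonglongrightarrow> 0"
    and zero: "\<And>i. (\<lambda>n. \<integral>x. h i x * U n x \<partial>lborel) \<longlonglongrightarrow> 0"
  shows "(\<lambda>n. \<integral>x. g x * U n x \<partial>lborel) \<longlonglongrightarrow> 0"
proof (rule LIMSEQ_I)
  fix e :: real assume e: "0 < e"
  have C: "0 \<le> C" using order_trans[OF norm_ge_zero bound] .
  \<comment> \<open>\<open>C + 1\<close> rather than \<open>C\<close> guards against division by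
    zero.\<close>
  then have "0 < e / (2 * (C + 1))" using e by simp
  then obtain i where "norm ((\<integral>x. norm (g x - h i x) \<partial>lborel) - 0) < e / (2 * (C + 1))"
    using LIMSEQ_D[OF L1] by blast
  then have "(\<integral>x. norm (g x - h i x) \<partial>lborel) < e / (2 * (C + 1))" by simp
  then have "(C + 1) * (\<integral>x. norm (g x - h i x) \<partial>lborel) < e / 2" using C by (simp add: field_simps)
  moreover have "C * (\<integral>x. norm (g x - h i x) \<partial>lborel) \<le> (C + 1) * (\<integral>x. norm (g x - h i x) \<partial>lborel)"
    by (intro mult_right_mono) auto
  ultimately have small: "C * (\<integral>x. norm (g x - h i x) \<partial>lborel) < e / 2" by linarith
  have diff: "norm ((\<integral>x. g x * U n x \<partial>lborel) - (\<integral>x. h i x * U n x \<partial>lborel)) \<le> C * (\<integral>x. norm (g x - h i x) \<partial>lborel)" for n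
  proof -
    have int: "integrable lborel (\<lambda>x. g x - h i x)" using g h by simp
    have "(\<integral>x. g x * U n x \<partial>lborel) - (\<integral>x. h i x * U n x \<partial>lborel) = (\<integral>x. (g x - h i x) * U n x \<partial>lborel)"
      using integrable_mult_bounded[OF g] integrable_mult_bounded[OF h] by (simp add: left_diff_distrib)
    also have "norm \<dots> \<le> (\<integral>x. norm ((g x - h i x) * U n x) \<partial>lborel)" by (rule integral_norm_bound)
    also have "\<dots> \<le> (\<integral>x. C * norm (g x - h i x) \<partial>lborel)"
    proof (intro integral_mono integrable_norm integrable_mult_bounded integrable_mult_right int)
      show "norm ((g x - h i x) * U n x) \<le> C * norm (g x - h i x)" for x
        using mult_left_mono[OF bound[of n x], of "norm (g x - h i x)"] by (simp add: norm_mult mult.commute)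
    qed
    finally show ?thesis by simp
  qed
  obtain n0 where n0: "\<forall>n\<ge>n0. norm ((\<integral>x. h i x * U n x \<partial>lborel) - 0) < e / 2"
    using LIMSEQ_D[OF zero, of "e/2"] e by auto
  have "norm ((\<integral>x. g x * U n x \<partial>lborel) - 0) < e" if "n \<ge> n0" for n
  proof -
    have "norm (\<integral>x. g x * U n x \<partial>lborel)
      \<le> norm ((\<integral>x. g x * U n x \<partial>lborel) - (\<integral>x. h i x * U n x \<partial>lborel)) + norm (\<integral>x. h i x * U n x \<partial>lborel)"
      using norm_triangle_sub[of "\<integral>x. g x * U n x \<partial>lborel" "\<integral>x. h i x * U n x \<partial>lborel"] by linarith
    moreover have "norm (\<integral>x. h i x * U n x \<partial>lborel) < e / 2" using n0 that by simp
    ultimately show ?thesis unfolding diff_zero using diff[of n] small by linarith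
  qed
  then show "\<exists>n0. \<forall>n\<ge>n0. norm ((\<integral>x. g x * U n x \<partial>lborel) - 0) < e" by blast
qed

text \<open>Finite partial unions are sums of indicators; inside \<open>S\<close>, of finite
  measure, they exhaust the whole union in \<open>L1\<close> by dominated convergence.\<close>

lemma tendsto_zero_disjoint_union:
  fixes A :: "nat \<Rightarrow> (real \<times> real) set"
  assumes A: "\<And>i. A i \<in> sets borel" and dis: "disjoint_family A"
    and S: "S \<in> sets borel" "emeasure lborel S < \<infinity>"
    and zero: "\<And>i. (\<lambda>n. \<integral>x. indicator (A i \<inter> S) x * U n x \<partial>lborel) \<longlonglongrightarrow> 0"
  shows "(\<lambda>n. \<integral>x. indicator ((\<Union>i. A i) \<inter> S) x * U n x \<partial>lborel) \<longlonglongrightarrow> 0"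
proof -
  have int: "integrable lborel (indicator B :: real \<times> real \<Rightarrow> complex)" if "B \<in> sets borel" "B \<subseteq> S" for B
    using that S by (intro integrable_complex_indicator) (auto intro: le_less_trans[OF emeasure_mono])
  define h :: "nat \<Rightarrow> real \<times> real \<Rightarrow> complex" where "h k x = (\<Sum>i<k. indicator (A i \<inter> S) x)" for k x
  have hk: "h k x = indicator ((\<Union>i<k. A i) \<inter> S) x" for k x
  proof -
    have "h k x = (\<Sum>i<k. indicator (A i) x) * indicator S x" by (simp add: h_def indicator_inter_arith sum_distrib_right)
    also have "(\<Sum>i<k. indicator (A i) x) = (indicator (\<Union>i<k. A i) x :: complex)"
      using dis by (intro indicator_UN_disjoint[symmetric]) (auto simp: disjoint_family_on_def)
    finally show ?thesis by (simp add: indicator_inter_arith)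
  qed
  have inth: "integrable lborel (h k)" for k
    unfolding h_def by (intro Bochner_Integration.integrable_sum int) (use A S in auto)
  show ?thesis
  proof (rule tendsto_zero_L1_closure[of h])
    show "integrable lborel (h k)" for k by (rule inth)
    show g: "integrable lborel (indicator ((\<Union>i. A i) \<inter> S) :: real \<times> real \<Rightarrow> complex)" by (intro int) (use A S in auto)
    show "(\<lambda>n. \<integral>x. h k x * U n x \<partial>lborel) \<longlonglongrightarrow> 0" for k
    proof -
      have "(\<integral>x. h k x * U n x \<partial>lborel) = (\<Sum>i<k. \<integral>x. indicator (A i \<inter> S) x * U n x \<partial>lborel)" for n
        unfolding h_def sum_distrib_right
        by (intro Bochner_Integration.integral_sum integrable_mult_bounded int) (use A S in auto)
      then show ?thesis using tendsto_sum[of "{..<k}" "\<lambda>i n. \<integral>x. indicator (A i \<inter> S) x * U n x \<partial>lborel" "\<lambda>_. 0"] zero by simp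
    qed
    have "(\<lambda>k. \<integral>x. norm (indicator ((\<Union>i. A i) \<inter> S) x - h k x) \<partial>lborel) \<longlonglongrightarrow> (\<integral>x. 0 \<partial>(lborel :: (real \<times> real) measure))"
    proof (rule integral_dominated_convergence)
      show "integrable lborel (indicator S :: real \<times> real \<Rightarrow> real)" using S by (simp add: integrable_indicator_iff)
      show "(\<lambda>x. norm (indicator ((\<Union>i. A i) \<inter> S) x - h k x)) \<in> borel_measurable lborel" for k
        using borel_measurable_integrable[OF g] borel_measurable_integrable[OF inth] by simp
      show "AE x in lborel. norm (norm (indicator ((\<Union>i. A i) \<inter> S) x - h k x)) \<le> indicator S x" for k
        unfolding hk by (auto simp: indicator_def)
      show "AE x in lborel. (\<lambda>k. norm (indicator ((\<Union>i. A i) \<inter> S) x - h k x)) \<longlonglongrightarrow> 0"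
      proof (rule AE_I2)
        fix x
        have "eventually (\<lambda>k. norm (indicator ((\<Union>i. A i) \<inter> S) x - h k x) = 0) sequentially"
        proof (cases "\<exists>i. x \<in> A i")
          case True
          then obtain i where "x \<in> A i" by blast
          then have "norm (indicator ((\<Union>i. A i) \<inter> S) x - h k x) = 0" if "Suc i \<le> k" for k
            unfolding hk using that by (auto simp: indicator_def)
          then show ?thesis unfolding eventually_sequentially by blast
        qed (auto simp: hk indicator_def)
        then show "(\<lambda>k. norm (indicator ((\<Union>i. A i) \<inter> S) x - h k x)) \<longlonglongrightarrow> 0" by (rule tendsto_eventually)
      qed
    qed simp
    then show "(\<lambda>k. \<integral>x. norm (indicator ((\<Union>i. A i) \<inter> S) x - h k x) \<partial>lborel) \<longlonglongrightarrow> 0" by simp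
  qed
qed

text \<open>Simple functions are dense. In the limit step the approximants satisfy
  \<open>norm (s i x) <= 2 norm (f x)\<close>, which makes \<open>3 norm (f x)\<close> a
  majorant.\<close>

lemma tendsto_zero_integrable:
  assumes base: "\<And>A. A \<in> sets borel \<Longrightarrow> emeasure lborel A < \<infinity> \<Longrightarrow> (\<lambda>n. \<integral>x. indicator A x * U n x \<partial>lborel) \<longlonglongrightarrow> 0"
    and g: "integrable lborel g"
  shows "(\<lambda>n. \<integral>x. g x * U n x \<partial>lborel) \<longlonglongrightarrow> 0"
  using g
proof (induction rule: integrable_induct)
  case (base A c)
  have "(\<lambda>n. c * (\<integral>x. indicator A x * U n x \<partial>lborel)) \<longlonglongrightarrow> c * 0"
    by (intro tendsto_mult_left assms(1)) (use base in auto)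
  moreover have "(\<integral>x. (indicator A x *\<^sub>R c) * U n x \<partial>lborel) = c * (\<integral>x. indicator A x * U n x \<partial>lborel)" for n
    unfolding integral_mult_right_zero[symmetric]
    by (intro Bochner_Integration.integral_cong refl) (simp add: indicator_def)
  ultimately show ?case by simp
next
  case (add f g)
  have "(\<integral>x. (f x + g x) * U n x \<partial>lborel) = (\<integral>x. f x * U n x \<partial>lborel) + (\<integral>x. g x * U n x \<partial>lborel)" for n
    using integrable_mult_bounded[OF add(1)] integrable_mult_bounded[OF add(2)] by (simp add: distrib_right)
  then show ?case using tendsto_add[OF add.IH] by simp
next
  case (lim f s)
  show ?case
  proof (rule tendsto_zero_L1_closure[of s])
    have "(\<lambda>i. \<integral>x. norm (f x - s i x) \<partial>lborel) \<longlonglongrightarrow> (\<integral>x. 0 \<partial>(lborel :: (real \<times> real) measure))"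
    proof (rule integral_dominated_convergence)
      show "integrable lborel (\<lambda>x. 3 * norm (f x))" using lim by (intro integrable_mult_right integrable_norm)
      show "(\<lambda>x. norm (f x - s i x)) \<in> borel_measurable lborel" for i
        using borel_measurable_integrable[OF lim(4)] borel_measurable_integrable[OF lim(1)] by simp
      show "AE x in lborel. norm (norm (f x - s i x)) \<le> 3 * norm (f x)" for i
      proof (rule AE_I2)
        fix x
        have "norm (f x - s i x) \<le> norm (f x) + norm (s i x)" by (rule norm_triangle_ineq4)
        also have "norm (s i x) \<le> 2 * norm (f x)" by (rule lim(3)) simp
        finally show "norm (norm (f x - s i x)) \<le> 3 * norm (f x)" by simp
      qed
      show "AE x in lborel. (\<lambda>i. norm (f x - s i x)) \<longlonglongrightarrow> 0"
      proof (rule AE_I2)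
        fix x
        have "(\<lambda>i. f x - s i x) \<longlonglongrightarrow> f x - f x" by (intro tendsto_diff tendsto_const lim(2)) simp
        then show "(\<lambda>i. norm (f x - s i x)) \<longlonglongrightarrow> 0" using tendsto_norm_zero by simp
      qed
    qed simp
    then show "(\<lambda>i. \<integral>x. norm (f x - s i x) \<partial>lborel) \<longlonglongrightarrow> 0" by simp
  qed (use lim in auto)
qed

text \<open>Dynkin's argument: boxes are stable under intersection and generate the Borel sets.
  Intersecting with the fixed box \<open>S\<close> keeps measures finite, so complements can be
  taken inside \<open>S\<close>, and keeps the generating boxes where convergence is
  assumed.\<close>

lemma tendsto_zero_in_box:
  fixes S :: "(real \<times> real) set"
  assumes box: "\<And>a b. box a b \<subseteq> S \<Longrightarrow> (\<lambda>n. \<integral>x. indicator (box a b) x * U n x \<partial>lborel) \<longlonglongrightarrow> 0"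
    and S: "S = box c d" and A: "A \<in> sets borel"
  shows "(\<lambda>n. \<integral>x. indicator (A \<inter> S) x * U n x \<partial>lborel) \<longlonglongrightarrow> 0"
proof -
  let ?G = "range (\<lambda>(a, b). box a b :: (real \<times> real) set)"
  have Sm: "S \<in> sets borel" "emeasure lborel S < \<infinity>" using S by (auto simp: emeasure_lborel_box_eq)
  have "Int_stable ?G" by (auto simp: Int_stable_def box_Int_box)
  moreover have "?G \<subseteq> Pow UNIV" by simp
  moreover have "A \<in> sigma_sets UNIV ?G" using A unfolding borel_eq_box by simp
  ultimately show ?thesis
  proof (induction rule: sigma_sets_induct_disjoint)
    case (basic B)
    then obtain a b where "B = box a b" by auto
    then have eq: "B \<inter> S = box (\<Sum>i\<in>Basis. max (a \<bullet> i) (c \<bullet> i) *\<^sub>R i) (\<Sum>i\<in>Basis. min (b \<bullet> i) (d \<bullet> i) *\<^sub>R i)"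
      using S by (simp add: box_Int_box)
    have "box (\<Sum>i\<in>Basis. max (a \<bullet> i) (c \<bullet> i) *\<^sub>R i) (\<Sum>i\<in>Basis. min (b \<bullet> i) (d \<bullet> i) *\<^sub>R i) \<subseteq> S"
      unfolding eq[symmetric] by blast
    then show ?case unfolding eq by (rule box)
  next
    case (compl B)
    have B: "B \<in> sets borel" using compl(1) unfolding borel_eq_box by simp
    have int: "integrable lborel (indicator (B \<inter> S) :: real \<times> real \<Rightarrow> complex)" "integrable lborel (indicator S :: real \<times> real \<Rightarrow> complex)"
      using Sm B by (auto intro!: integrable_complex_indicator intro: le_less_trans[OF emeasure_mono])
    have "(\<integral>x. indicator ((UNIV - B) \<inter> S) x * U n x \<partial>lborel) = (\<integral>x. indicator S x * U n x \<partial>lborel) - (\<integral>x. indicator (B \<inter> S) x * U n x \<partial>lborel)" for n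
    proof -
      have "(\<integral>x. indicator ((UNIV - B) \<inter> S) x * U n x \<partial>lborel) = (\<integral>x. indicator S x * U n x - indicator (B \<inter> S) x * U n x \<partial>lborel)"
        by (intro Bochner_Integration.integral_cong refl) (simp add: indicator_def)
      then show ?thesis
        by (simp only: Bochner_Integration.integral_diff[OF integrable_mult_bounded[OF int(2)] integrable_mult_bounded[OF int(1)]])
    qed
    moreover have "(\<lambda>n. \<integral>x. indicator S x * U n x \<partial>lborel) \<longlonglongrightarrow> 0" using box[of c d] S by simp
    ultimately show ?case using tendsto_diff[of _ 0 sequentially, OF _ compl(2)] by (simp only: diff_zero)
  next
    case (union B)
    have "B i \<in> sets borel" for i using union(2) unfolding borel_eq_box by auto
    then show ?case by (intro tendsto_zero_disjoint_union Sm union)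
  qed simp
qed

text \<open>An open set is a countable union of open boxes; made disjoint, they cut \<open>A\<close>
  into countably many pieces, each inside one box.\<close>

proposition tendsto_zero_weak:
  fixes S :: "(real \<times> real) set"
  assumes box: "\<And>a b. box a b \<subseteq> S \<Longrightarrow> (\<lambda>n. \<integral>x. indicator (box a b) x * U n x \<partial>lborel) \<longlonglongrightarrow> 0"
    and S: "open S" and off: "\<And>n x. x \<notin> S \<Longrightarrow> U n x = 0" and g: "integrable lborel g"
  shows "(\<lambda>n. \<integral>x. g x * U n x \<partial>lborel) \<longlonglongrightarrow> 0"
proof (rule tendsto_zero_integrable[OF _ g])
  fix A :: "(real \<times> real) set" assume A: "A \<in> sets borel" "emeasure lborel A < \<infinity>"
  obtain \<D> where D: "countable \<D>" "\<D> \<subseteq> Pow S" "\<And>X. X \<in> \<D> \<Longrightarrow> \<exists>a b. X = box a b" "\<Union>\<D> = S"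
    using open_countable_Union_open_box[OF S] by blast
  \<comment> \<open>The empty set, itself a box, is added so that the countable family is nonempty
    and can be enumerated by the naturals.\<close>
  define R where "R = from_nat_into (insert {} \<D>)"
  have range: "range R = insert {} \<D>" unfolding R_def using D(1) by (intro range_from_nat_into) auto
  have Rbox: "\<exists>c d. R i = box c d" for i
  proof -
    have "R i \<in> insert {} \<D>" using range by blast
    then show ?thesis using D(3) box_eq_empty(1)[of "(0, 0) :: real \<times> real" "(0, 0)"]
      by (metis box_idem insert_iff)
  qed
  have RS: "R i \<subseteq> S" for i using range D(2) by blast
  have UR: "(\<Union>i. disjointed R i) = S" using range D(4) by (simp add: UN_disjointed_eq)
  have Rm: "R i \<in> sets borel" for i using Rbox[of i] by auto
  then have dm: "disjointed R i \<in> sets borel" for i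
    using sets.range_disjointed_sets[of R borel] by auto
  have "(\<lambda>n. \<integral>x. indicator ((\<Union>i. disjointed R i) \<inter> A) x * U n x \<partial>lborel) \<longlonglongrightarrow> 0"
  proof (rule tendsto_zero_disjoint_union[OF dm disjoint_family_disjointed A])
    fix i
    obtain c d where cd: "R i = box c d" using Rbox by blast
    have "(\<lambda>n. \<integral>x. indicator ((disjointed R i \<inter> A) \<inter> R i) x * U n x \<partial>lborel) \<longlonglongrightarrow> 0"
    proof (rule tendsto_zero_in_box[OF _ cd])
      show "(\<lambda>n. \<integral>x. indicator (box a b) x * U n x \<partial>lborel) \<longlonglongrightarrow> 0" if "box a b \<subseteq> R i" for a b
        using box RS that by blast
    qed (use dm A in auto)
    moreover have "(disjointed R i \<inter> A) \<inter> R i = disjointed R i \<inter> A" using disjointed_subset[of R i] by blast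
    ultimately show "(\<lambda>n. \<integral>x. indicator (disjointed R i \<inter> A) x * U n x \<partial>lborel) \<longlonglongrightarrow> 0" by simp
  qed
  moreover have "(\<integral>x. indicator ((\<Union>i. disjointed R i) \<inter> A) x * U n x \<partial>lborel) = (\<integral>x. indicator A x * U n x \<partial>lborel)" for n
    unfolding UR using off[of _ n] by (intro Bochner_Integration.integral_cong refl) (auto simp: indicator_def)
  ultimately show "(\<lambda>n. \<integral>x. indicator A x * U n x \<partial>lborel) \<longlonglongrightarrow> 0" by simp
qed

end

section \<open>Pointwise convergence for indicators of intervals\<close>

lemma dirichlet_primitive_pi: "dirichlet_primitive M pi = pi"
  by (simp add: dirichlet_primitive_def sin_npi)

text \<open>For \<open>t <= pi\<close> the distance to the limit is the integral of the kernel from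
  \<open>t\<close> to \<open>pi\<close>, where \<open>1 / sin (s / 2)\<close> is bounded and
  decreasing; the second mean value theorem makes it of order \<open>1 / M\<close>. Larger arguments
  follow from oddness and periodicity.\<close>

lemma dirichlet_primitive_tendsto:
  assumes "0 < t" "t < 2 * pi"
  shows "(\<lambda>M. dirichlet_primitive M t) \<longlonglongrightarrow> pi"
proof -
  have *: "(\<lambda>M. dirichlet_primitive M t) \<longlonglongrightarrow> pi" if t: "0 < t" "t \<le> pi" for t
  proof -
    have pos: "0 < sin (s / 2)" if "t \<le> s" "s \<le> pi" for s
      using that t pi_gt_zero by (intro sin_gt_zero) linarith+
    have bd: "\<forall>M. norm (dirichlet_primitive M t - pi) \<le> (1 / sin (t / 2)) * (2 / (real M + 1 / 2))"
    proof
      fix M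
      have "integral {t..pi} (dirichlet_kernel M) = pi - dirichlet_primitive M t"
        using has_integral_dirichlet[of t pi M] t by (auto simp: integral_unique dirichlet_primitive_pi)
      moreover have "integral {t..pi} (dirichlet_kernel M) = integral {t..pi} (\<lambda>s. (1 / sin (s / 2)) * sin ((real M + 1 / 2) * s))"
      proof (intro integral_cong)
        fix s assume "s \<in> {t..pi}"
        then have "0 < sin (s / 2)" using pos by auto
        then show "dirichlet_kernel M s = (1 / sin (s / 2)) * sin ((real M + 1 / 2) * s)"
          unfolding sin_half_dirichlet[symmetric] by simp
      qed
      moreover have "\<bar>integral {t..pi} (\<lambda>s. (1 / sin (s / 2)) * sin ((real M + 1 / 2) * s))\<bar> \<le> (1 / sin (t / 2)) * (2 / (real M + 1 / 2))"
      proof (rule integral_antimono_mult_bound)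
        show "(\<lambda>s. sin ((real M + 1 / 2) * s)) integrable_on {t..pi}"
          by (intro integrable_continuous_real continuous_intros)
        show "1 / sin (y / 2) \<le> 1 / sin (x / 2)" if "t \<le> x" "x \<le> y" "y \<le> pi" for x y
          using that t pos[of x] by (intro frac_le sin_monotone_2pi_le) linarith+
        show "0 \<le> 1 / sin (pi / 2)" by simp
        show "\<bar>integral {t..c} (\<lambda>s. sin ((real M + 1 / 2) * s))\<bar> \<le> 2 / (real M + 1 / 2)" if "t \<le> c" "c \<le> pi" for c
        proof -
          let ?n = "real M + 1 / 2"
          have "integral {t..c} (\<lambda>s. sin (?n * s)) = (cos (?n * t) - cos (?n * c)) / ?n"
            using integral_sin_scale[of ?n t c] that by (auto simp: integral_unique)
          moreover have "\<bar>cos (?n * t) - cos (?n * c)\<bar> \<le> 2"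
            using abs_cos_le_one[of "?n * t"] abs_cos_le_one[of "?n * c"] by linarith
          moreover have "0 < ?n" by simp
          ultimately show ?thesis by (simp only: abs_divide) (simp add: divide_right_mono)
        qed
      qed (use t in auto)
      ultimately show "norm (dirichlet_primitive M t - pi) \<le> (1 / sin (t / 2)) * (2 / (real M + 1 / 2))"
        by (simp add: abs_minus_commute)
    qed
    have "(\<lambda>M. (1 / sin (t / 2)) * (2 / (real M + 1 / 2))) \<longlonglongrightarrow> (1 / sin (t / 2)) * 0"
    proof (intro tendsto_mult_left tendsto_divide_0[OF tendsto_const] filterlim_at_top_imp_at_infinity)
      show "filterlim (\<lambda>M. real M + 1 / 2) at_top sequentially"
        by (rule filterlim_at_top_mono[OF filterlim_real_sequentially]) simp
    qed
    then have "(\<lambda>M. dirichlet_primitive M t - pi) \<longlonglongrightarrow> 0"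
      by (intro Lim_null_comparison[OF always_eventually[OF bd]]) simp
    then show ?thesis by (simp add: LIM_zero_iff)
  qed
  show ?thesis
  proof (cases "t \<le> pi")
    case True then show ?thesis using * assms by simp
  next
    case False
    then have "(\<lambda>M. dirichlet_primitive M (2 * pi - t)) \<longlonglongrightarrow> pi" using assms by (intro *) auto
    then have "(\<lambda>M. 2 * pi - dirichlet_primitive M (2 * pi - t)) \<longlonglongrightarrow> 2 * pi - pi" by (intro tendsto_diff tendsto_const)
    moreover have "2 * pi - dirichlet_primitive M (2 * pi - t) = dirichlet_primitive M t" for M
      using dirichlet_primitive_periodic[of M "t - 2 * pi"] dirichlet_primitive_minus[of M "2 * pi - t"] by simp
    ultimately show ?thesis by simp
  qed
qed

lemma dirichlet_primitive_tendsto_neg: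
  assumes "- (2 * pi) < t" "t < 0"
  shows "(\<lambda>M. dirichlet_primitive M t) \<longlonglongrightarrow> - pi"
  using tendsto_minus[OF dirichlet_primitive_tendsto[of "- t"]] assms by (simp add: dirichlet_primitive_minus)

text \<open>\<open>2 a\<close> times the partial Fourier sum, with period \<open>2 a\<close>, of the
  indicator of \<open>(u, v)\<close>, evaluated at \<open>y\<close>.\<close>

definition interval_sum :: "real \<Rightarrow> real \<Rightarrow> real \<Rightarrow> nat \<Rightarrow> real \<Rightarrow> real"
  where "interval_sum a u v M y = (dirichlet_primitive M (pi / a * (y - u)) - dirichlet_primitive M (pi / a * (y - v))) / (pi / a)"

lemma integral_scaled_dirichlet:
  assumes K: "K \<noteq> 0" and "u \<le> v"
  shows "(\<integral>x. indicator {u<..<v} x *\<^sub>R complex_of_real (dirichlet_kernel M (K * (y - x))) \<partial>lborel) = of_real ((dirichlet_primitive M (K * (y - u)) - dirichlet_primitive M (K * (y - v))) / K)"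
proof -
  have "(\<integral>x. indicator {u<..<v} x *\<^sub>R complex_of_real (dirichlet_kernel M (K * (y - x))) \<partial>lborel)
    = (\<integral>x. indicator {u..v} x *\<^sub>R complex_of_real (dirichlet_kernel M (K * (y - x))) \<partial>lborel)"
  proof (rule integral_cong_AE)
    have "AE x in lborel. x \<noteq> u" "AE x in lborel. x \<noteq> v" by (rule AE_lborel_singleton)+
    then show "AE x in lborel. indicator {u<..<v} x *\<^sub>R complex_of_real (dirichlet_kernel M (K * (y - x)))
        = indicator {u..v} x *\<^sub>R complex_of_real (dirichlet_kernel M (K * (y - x)))"
    proof eventually_elim
      case (elim x)
      then have "indicator {u<..<v} x = (indicator {u..v} x :: real)" by (auto simp: indicator_def)
      then show ?case by simp
    qed
  qed measurable
  also have "\<dots> = complex_of_real (- dirichlet_primitive M (K * (y - v)) / K) - complex_of_real (- dirichlet_primitive M (K * (y - u)) / K)"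
  proof (rule integral_FTC_atLeastAtMost[OF \<open>u \<le> v\<close>])
    fix x assume "u \<le> x" "x \<le> v"
    have "((\<lambda>x. - dirichlet_primitive M (K * (y - x)) / K) has_real_derivative - (dirichlet_kernel M (K * (y - x)) * (- K)) / K) (at x within {u..v})"
      by (intro DERIV_cdivide DERIV_minus DERIV_chain'[where f = "\<lambda>x. K * (y - x)" and g = "dirichlet_primitive M"] dirichlet_primitive_deriv)
         (auto intro!: derivative_eq_intros)
    then have "((\<lambda>x. - dirichlet_primitive M (K * (y - x)) / K) has_real_derivative dirichlet_kernel M (K * (y - x))) (at x within {u..v})"
      using K by simp
    then show "((\<lambda>x. complex_of_real (- dirichlet_primitive M (K * (y - x)) / K)) has_vector_derivative complex_of_real (dirichlet_kernel M (K * (y - x)))) (at x within {u..v})"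
      by (intro has_vector_derivative_of_real) (simp add: has_real_derivative_iff_has_vector_derivative)
  qed (intro continuous_intros)
  also have "\<dots> = of_real ((dirichlet_primitive M (K * (y - u)) - dirichlet_primitive M (K * (y - v))) / K)"
  proof -
    have "- A / K - - B / K = (B - A) / K" for A B by (simp add: diff_divide_distrib)
    then show ?thesis by (simp only: of_real_diff[symmetric])
  qed
  finally show ?thesis .
qed

lemma interval_sum_integral:
  assumes "0 < a" "u \<le> v"
  shows "(\<integral>x. indicator {u<..<v} x *\<^sub>R complex_of_real (dirichlet_kernel M (pi / a * (y - x))) \<partial>lborel) = of_real (interval_sum a u v M y)"
  unfolding interval_sum_def using assms by (intro integral_scaled_dirichlet) auto

lemma scaled_abs_le: "0 < a \<Longrightarrow> \<bar>y\<bar> \<le> a \<Longrightarrow> \<bar>u\<bar> \<le> a \<Longrightarrow> \<bar>pi / a * (y - u)\<bar> \<le> 2 * pi"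
proof -
  assume a: "0 < a" "\<bar>y\<bar> \<le> a" "\<bar>u\<bar> \<le> a"
  have "\<bar>pi / a * (y - u)\<bar> = pi / a * \<bar>y - u\<bar>" using a by (simp add: abs_mult)
  also have "\<dots> \<le> pi / a * (2 * a)" using a by (intro mult_left_mono) auto
  finally show ?thesis using a by simp
qed

lemma interval_sum_bound:
  assumes "0 < a" "\<bar>u\<bar> \<le> a" "\<bar>v\<bar> \<le> a" "\<bar>y\<bar> \<le> a"
  shows "\<bar>interval_sum a u v M y\<bar> \<le> 10 * a"
proof -
  have "\<bar>pi / a * (y - u)\<bar> \<le> 3 * pi" "\<bar>pi / a * (y - v)\<bar> \<le> 3 * pi"
    using scaled_abs_le[of a y u] scaled_abs_le[of a y v] assms pi_gt_zero by linarith+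
  then have "\<bar>dirichlet_primitive M (pi / a * (y - u)) - dirichlet_primitive M (pi / a * (y - v))\<bar> \<le> 10 * pi"
    using dirichlet_primitive_bound[of "pi / a * (y - u)" M] dirichlet_primitive_bound[of "pi / a * (y - v)" M] by linarith
  then have "\<bar>interval_sum a u v M y\<bar> \<le> 10 * pi / (pi / a)"
    unfolding interval_sum_def abs_divide using assms(1) by (intro frac_le) auto
  then show ?thesis by simp
qed

text \<open>Each primitive tends to \<open>pi\<close> or \<open>- pi\<close> according to the side
  of its end point on which \<open>y\<close> lies; between the end points the signs differ. As
  \<open>|y| < a\<close>, the arguments stay inside \<open>(- 2 pi, 2 pi)\<close>, where 0 is the
  only jump.\<close>

lemma interval_sum_tendsto:
  assumes a: "0 < a" "\<bar>u\<bar> \<le> a" "\<bar>v\<bar> \<le> a" "u < v" and y: "\<bar>y\<bar> < a" "y \<noteq> u" "y \<noteq> v"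
  shows "(\<lambda>M. interval_sum a u v M y) \<longlonglongrightarrow> 2 * a * indicator {u<..<v} y"
proof -
  have lim: "(\<lambda>M. dirichlet_primitive M (pi / a * (y - w))) \<longlonglongrightarrow> (if w < y then pi else - pi)" if "\<bar>w\<bar> \<le> a" "y \<noteq> w" for w
  proof -
    have lt: "\<bar>y - w\<bar> < 2 * a" using that y by linarith
    have "\<bar>pi / a * (y - w)\<bar> = pi / a * \<bar>y - w\<bar>" using a by (simp add: abs_mult)
    also have "\<dots> < pi / a * (2 * a)" using lt a by (intro mult_strict_left_mono) auto
    finally have "\<bar>pi / a * (y - w)\<bar> < 2 * pi" using a by simp
    then have "pi / a * (y - w) < 2 * pi" "- (2 * pi) < pi / a * (y - w)" by linarith+
    moreover have "0 < pi / a" using a by simp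
    then have "0 < pi / a * (y - w) \<longleftrightarrow> w < y" "pi / a * (y - w) < 0 \<longleftrightarrow> y < w"
      by (simp_all only: zero_less_mult_iff mult_less_0_iff) auto
    moreover have "y < w" if "\<not> w < y" using that \<open>y \<noteq> w\<close> by simp
    ultimately show ?thesis
      using dirichlet_primitive_tendsto[of "pi / a * (y - w)"] dirichlet_primitive_tendsto_neg[of "pi / a * (y - w)"]
      by (cases "w < y") (simp_all only: if_True if_False simp_thms)
  qed
  have "(\<lambda>M. interval_sum a u v M y) \<longlonglongrightarrow> ((if u < y then pi else - pi) - (if v < y then pi else - pi)) / (pi / a)"
    unfolding interval_sum_def using a y by (intro tendsto_divide tendsto_diff lim tendsto_const) auto
  moreover have "((if u < y then pi else - pi) - (if v < y then pi else - pi)) / (pi / a) = 2 * a * indicator {u<..<v} y"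
    using a y by (auto simp: indicator_def)
  ultimately show ?thesis by simp
qed

section \<open>Lattice characters; the partial sums as trigonometric polynomials\<close>

lemma integral_sum_mult:
  fixes f :: "'i \<Rightarrow> 'a \<Rightarrow> complex"
  assumes "\<And>k. integrable M (f k)"
  shows "(\<integral>x. (\<Sum>k\<in>I. f k x * c k) \<partial>M) = (\<Sum>k\<in>I. (\<integral>x. f k x \<partial>M) * c k)"
    and "(\<integral>x. (\<Sum>k\<in>I. c k * f k x) \<partial>M) = (\<Sum>k\<in>I. c k * (\<integral>x. f k x \<partial>M))"
  using assms by (simp_all add: Bochner_Integration.integral_sum)

definition lattice_exp :: "real \<Rightarrow> int \<times> int \<Rightarrow> real \<times> real \<Rightarrow> complex"
  where "lattice_exp a k x = exp (\<i> * of_real (pi / a * (of_int (fst k) * fst x + of_int (snd k) * snd x)))"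

lemma lattice_exp_minus: "lattice_exp a k (- x) = exp (- (\<i> * of_real (pi / a * (of_int (fst k) * fst x + of_int (snd k) * snd x))))"
  by (simp add: lattice_exp_def algebra_simps)

lemma lattice_exp_add: "lattice_exp a k (x + y) = lattice_exp a k x * lattice_exp a k y"
  by (simp add: lattice_exp_def exp_add[symmetric] algebra_simps add_divide_distrib)

lemma continuous_lattice_exp [continuous_intros]: "continuous_on S f \<Longrightarrow> continuous_on S (\<lambda>x. lattice_exp a k (f x))"
  unfolding lattice_exp_def by (intro continuous_intros)

lemma norm_lattice_exp: "norm (lattice_exp a k x) = 1"
  by (simp add: lattice_exp_def)

lemma sum_lattice_exp:
  "(\<Sum>k\<in>{- int M..int M} \<times> {- int N..int N}. lattice_exp a k x)
    = of_real (dirichlet_kernel M (pi / a * fst x) * dirichlet_kernel N (pi / a * snd x))"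
proof -
  have "lattice_exp a k x = exp (\<i> * of_int (fst k) * of_real (pi / a * fst x)) * exp (\<i> * of_int (snd k) * of_real (pi / a * snd x))" for k
    unfolding lattice_exp_def exp_add[symmetric] by (simp add: algebra_simps add_divide_distrib)
  then show ?thesis
    unfolding of_real_mult sum_exp_dirichlet[symmetric] sum_product sum.cartesian_product by (simp add: split_beta')
qed

text \<open>Summing the characters at \<open>y - x\<close> over the rectangle gives the product of
  Dirichlet kernels, which are even. The integrals on the right are later identified with
  \<open>4 a^2\<close> times the coefficients of the theorem.\<close>

lemma partial_sum_integral_eq:
  assumes W: "bipoly W"
  shows "partial_sum_integral a W M N x = (\<Sum>k\<in>{- int M..int M} \<times> {- int N..int N}.
    (\<integral>y. indicator (cball 0 a) y *\<^sub>R (W y * lattice_exp a k y) \<partial>lborel) * lattice_exp a k (- x))"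
proof -
  let ?R = "{- int M..int M} \<times> {- int N..int N}"
  have int: "integrable lborel (\<lambda>y. indicator (cball 0 a) y *\<^sub>R (W y * lattice_exp a k y))" for k
    by (intro borel_integrable_compact compact_cball continuous_intros continuous_bipoly[OF W])
  have "(\<Sum>k\<in>?R. (\<integral>y. indicator (cball 0 a) y *\<^sub>R (W y * lattice_exp a k y) \<partial>lborel) * lattice_exp a k (- x))
    = (\<integral>y. (\<Sum>k\<in>?R. indicator (cball 0 a) y *\<^sub>R (W y * lattice_exp a k y) * lattice_exp a k (- x)) \<partial>lborel)"
    by (rule integral_sum_mult(1)[OF int, symmetric])
  also have "\<dots> = partial_sum_integral a W M N x"
    unfolding partial_sum_integral_def
  proof (intro Bochner_Integration.integral_cong refl)
    fix y
    have "(\<Sum>k\<in>?R. indicator (cball 0 a) y *\<^sub>R (W y * lattice_exp a k y) * lattice_exp a k (- x))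
      = indicator (cball 0 a) y *\<^sub>R (W y * (\<Sum>k\<in>?R. lattice_exp a k (y + - x)))"
      unfolding lattice_exp_add by (simp add: sum_distrib_left scaleR_sum_right mult.assoc)
    also have "(\<Sum>k\<in>?R. lattice_exp a k (y + - x)) = of_real (dirichlet_kernel M (pi / a * (fst x - fst y)) * dirichlet_kernel N (pi / a * (snd x - snd y)))"
    proof -
      have "pi / a * fst (y + - x) = - (pi / a * (fst x - fst y))" "pi / a * snd (y + - x) = - (pi / a * (snd x - snd y))"
        by (simp_all add: algebra_simps)
      then show ?thesis unfolding sum_lattice_exp by (simp only: dirichlet_minus)
    qed
    finally show "(\<Sum>k\<in>?R. indicator (cball 0 a) y *\<^sub>R (W y * lattice_exp a k y) * lattice_exp a k (- x))
      = indicator (cball 0 a) y *\<^sub>R (W y * of_real (dirichlet_kernel M (pi / a * (fst x - fst y)) * dirichlet_kernel N (pi / a * (snd x - snd y))))" .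
  qed
  finally show ?thesis ..
qed

lemma box_pair: "box (a1, a2) (b1, b2) = {a1<..<b1 :: real} \<times> {a2<..<b2 :: real}"
  by (auto simp: mem_box Basis_prod_def)

lemma integrable_compact_times:
  fixes f :: "real \<times> real \<Rightarrow> complex"
  assumes "continuous_on UNIV f"
  shows "integrable lborel (\<lambda>x. indicator (box u v) x *\<^sub>R f x)"
proof -
  have "integrable lborel (\<lambda>x. indicator (cbox u v) x *\<^sub>R f x)"
    by (intro borel_integrable_compact compact_cbox continuous_on_subset[OF assms]) auto
  then have "set_integrable lborel (cbox u v) f" by (simp add: set_integrable_def)
  then have "set_integrable lborel (box u v) f" by (rule set_integrable_subset) (auto simp: box_subset_cbox)
  then show ?thesis by (simp add: set_integrable_def)
qed

lemma integral_box_product: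
  assumes "0 < a" "u1 \<le> v1" "u2 \<le> v2"
  shows "(\<integral>x. indicator (box (u1, u2) (v1, v2)) x *\<^sub>R complex_of_real (dirichlet_kernel M (pi / a * (y1 - fst x)) * dirichlet_kernel N (pi / a * (y2 - snd x))) \<partial>lborel)
    = of_real (interval_sum a u1 v1 M y1 * interval_sum a u2 v2 N y2)"
proof -
  let ?G = "\<lambda>x. indicator (box (u1, u2) (v1, v2)) x *\<^sub>R complex_of_real (dirichlet_kernel M (pi / a * (y1 - fst x)) * dirichlet_kernel N (pi / a * (y2 - snd x)))"
  let ?A = "\<lambda>x. indicator {u1<..<v1} x *\<^sub>R complex_of_real (dirichlet_kernel M (pi / a * (y1 - x)))"
  let ?B = "\<lambda>x. indicator {u2<..<v2} x *\<^sub>R complex_of_real (dirichlet_kernel N (pi / a * (y2 - x)))"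
  have "integrable lborel ?G" by (intro integrable_compact_times continuous_dirichlet_plane)
  then have int: "integrable (lborel \<Otimes>\<^sub>M lborel) ?G" by (simp add: lborel_prod)
  have "(\<integral>x. ?G x \<partial>lborel) = (\<integral>s. (\<integral>t. ?G (s, t) \<partial>lborel) \<partial>lborel)"
    unfolding lborel_prod[symmetric] by (rule lborel_pair.integral_fst'[symmetric, OF int])
  also have "\<dots> = (\<integral>s. (\<integral>t. ?A s * ?B t \<partial>lborel) \<partial>lborel)"
  proof -
    have "?G (s, t) = ?A s * ?B t" for s t by (auto simp: box_pair indicator_def)
    then show ?thesis by (simp only:)
  qed
  also have "\<dots> = (\<integral>s. ?A s \<partial>lborel) * (\<integral>t. ?B t \<partial>lborel)"
    by (simp only: integral_mult_right_zero integral_mult_left_zero)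
  also have "\<dots> = of_real (interval_sum a u1 v1 M y1 * interval_sum a u2 v2 N y2)"
    using assms by (simp only: interval_sum_integral of_real_mult)
  finally show ?thesis .
qed

text \<open>Taking partial sums is a symmetric operation, so it is moved from \<open>W\<close> to
  the indicator of the box. That indicator is a product of indicators of intervals, and its partial
  sums factor accordingly, which reduces convergence to one variable.\<close>

lemma integral_box_partial_sum:
  assumes a: "0 < a" and W: "bipoly W" and uv: "u1 \<le> v1" "u2 \<le> v2"
  shows "(\<integral>x. indicator (box (u1, u2) (v1, v2)) x *\<^sub>R partial_sum_integral a W M N x \<partial>lborel)
    = (\<integral>y. indicator (cball 0 a) y *\<^sub>R (W y * of_real (interval_sum a u1 v1 M (fst y) * interval_sum a u2 v2 N (snd y))) \<partial>lborel)"
proof -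
  let ?R = "{- int M..int M} \<times> {- int N..int N}"
  let ?box = "box (u1, u2) (v1, v2)"
  define c where "c k = (\<integral>y. indicator (cball 0 a) y *\<^sub>R (W y * lattice_exp a k y) \<partial>lborel)" for k
  define E where "E k = (\<integral>x. indicator ?box x *\<^sub>R lattice_exp a k (- x) \<partial>lborel)" for k
  have intW: "integrable lborel (\<lambda>y. indicator (cball 0 a) y *\<^sub>R (W y * lattice_exp a k y))" for k
    by (intro borel_integrable_compact compact_cball continuous_intros continuous_bipoly[OF W])
  have intE: "integrable lborel (\<lambda>x. indicator ?box x *\<^sub>R lattice_exp a k (- x))" for k
    by (intro integrable_compact_times continuous_intros)
  have "(\<integral>x. indicator ?box x *\<^sub>R partial_sum_integral a W M N x \<partial>lborel)
    = (\<integral>x. (\<Sum>k\<in>?R. c k * (indicator ?box x *\<^sub>R lattice_exp a k (- x))) \<partial>lborel)"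
    unfolding partial_sum_integral_eq[OF W] c_def by (simp add: scaleR_sum_right)
  also have "\<dots> = (\<Sum>k\<in>?R. c k * E k)"
    unfolding E_def by (rule integral_sum_mult(2)[OF intE])
  also have "\<dots> = (\<integral>y. (\<Sum>k\<in>?R. (indicator (cball 0 a) y *\<^sub>R (W y * lattice_exp a k y)) * E k) \<partial>lborel)"
    unfolding c_def by (rule integral_sum_mult(1)[OF intW, symmetric])
  also have "\<dots> = (\<integral>y. indicator (cball 0 a) y *\<^sub>R (W y * of_real (interval_sum a u1 v1 M (fst y) * interval_sum a u2 v2 N (snd y))) \<partial>lborel)"
  proof (intro Bochner_Integration.integral_cong refl)
    fix y :: "real \<times> real"
    have "(\<Sum>k\<in>?R. lattice_exp a k y * E k) = (\<integral>x. (\<Sum>k\<in>?R. lattice_exp a k y * (indicator ?box x *\<^sub>R lattice_exp a k (- x))) \<partial>lborel)"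
      unfolding E_def by (rule integral_sum_mult(2)[OF intE, symmetric])
    also have "\<dots> = (\<integral>x. indicator ?box x *\<^sub>R complex_of_real (dirichlet_kernel M (pi / a * (fst y - fst x)) * dirichlet_kernel N (pi / a * (snd y - snd x))) \<partial>lborel)"
    proof (intro Bochner_Integration.integral_cong refl)
      fix x :: "real \<times> real"
      have "(\<Sum>k\<in>?R. lattice_exp a k y * (indicator ?box x *\<^sub>R lattice_exp a k (- x))) = indicator ?box x *\<^sub>R (\<Sum>k\<in>?R. lattice_exp a k (y + - x))"
        unfolding lattice_exp_add by (simp add: scaleR_sum_right)
      then show "(\<Sum>k\<in>?R. lattice_exp a k y * (indicator ?box x *\<^sub>R lattice_exp a k (- x)))
        = indicator ?box x *\<^sub>R complex_of_real (dirichlet_kernel M (pi / a * (fst y - fst x)) * dirichlet_kernel N (pi / a * (snd y - snd x)))"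
        unfolding sum_lattice_exp by simp
    qed
    also have "\<dots> = of_real (interval_sum a u1 v1 M (fst y) * interval_sum a u2 v2 N (snd y))"
      by (rule integral_box_product[OF a uv])
    finally have "(\<Sum>k\<in>?R. lattice_exp a k y * E k) = of_real (interval_sum a u1 v1 M (fst y) * interval_sum a u2 v2 N (snd y))" .
    then show "(\<Sum>k\<in>?R. (indicator (cball 0 a) y *\<^sub>R (W y * lattice_exp a k y)) * E k)
      = indicator (cball 0 a) y *\<^sub>R (W y * of_real (interval_sum a u1 v1 M (fst y) * interval_sum a u2 v2 N (snd y)))"
      by (simp add: scaleR_sum_right[symmetric] sum_distrib_left[symmetric] mult.assoc del: of_real_mult)
  qed
  finally show ?thesis .
qed

lemma AE_lborel_coordinates:
  fixes c :: real
  shows "AE y in (lborel :: (real \<times> real) measure). fst y \<noteq> c" "AE y in (lborel :: (real \<times> real) measure). snd y \<noteq> c"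
proof -
  have 1: "{c} \<times> UNIV \<in> null_sets (lborel \<Otimes>\<^sub>M (lborel :: real measure))"
    by (intro null_setsI) (auto simp: lborel.emeasure_pair_measure_Times)
  have 2: "UNIV \<times> {c} \<in> null_sets ((lborel :: real measure) \<Otimes>\<^sub>M lborel)"
    by (intro null_setsI) (auto simp: lborel.emeasure_pair_measure_Times)
  show "AE y in (lborel :: (real \<times> real) measure). fst y \<noteq> c"
    using AE_not_in[OF 1] unfolding lborel_prod by eventually_elim auto
  show "AE y in (lborel :: (real \<times> real) measure). snd y \<noteq> c"
    using AE_not_in[OF 2] unfolding lborel_prod by eventually_elim auto
qed

lemma box_in_ball_bounds:
  assumes "box (u1, u2) (v1, v2) \<subseteq> ball (0 :: real \<times> real) a" "u1 < v1" "u2 < v2"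
  shows "\<bar>u1\<bar> \<le> a" "\<bar>v1\<bar> \<le> a" "\<bar>u2\<bar> \<le> a" "\<bar>v2\<bar> \<le> a"
proof -
  have "closure (box (u1, u2) (v1, v2)) \<subseteq> closure (ball (0 :: real \<times> real) a)" by (rule closure_mono[OF assms(1)])
  moreover have "(u1 + v1) / 2 \<in> {u1<..<v1}" "(u2 + v2) / 2 \<in> {u2<..<v2}" using assms by auto
  then have "box (u1, u2) (v1, v2) \<noteq> {}" unfolding box_pair by blast
  ultimately have "cbox (u1, u2) (v1, v2) \<subseteq> cball 0 a"
    using closure_minimal[OF ball_subset_cball closed_cball, of "0 :: real \<times> real" a] by (simp add: closure_box)
  then have "(u1, u2) \<in> cball 0 a" "(v1, v2) \<in> cball 0 a" using assms by (auto simp: cbox_Pair_eq subset_iff)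
  then have "norm (u1, u2) \<le> a" "norm (v1, v2) \<le> a" by simp_all
  then show "\<bar>u1\<bar> \<le> a" "\<bar>v1\<bar> \<le> a" "\<bar>u2\<bar> \<le> a" "\<bar>v2\<bar> \<le> a"
    using norm_fst_le[of u1 u2] norm_fst_le[of v1 v2] norm_snd_le[of u2 u1] norm_snd_le[of v2 v1] by auto
qed

text \<open>With the partial sums moved to the box, the integrand converges off the null set where a
  coordinate hits an end of the box or one of \<open>a\<close> and \<open>- a\<close>, and is
  dominated through the bound \<open>10 a\<close> on each factor. Each variable contributes
  \<open>2 a\<close> to the limit.\<close>

lemma box_partial_sum_tendsto:
  assumes a: "0 < a" and W: "bipoly W" and sub: "box u v \<subseteq> ball (0 :: real \<times> real) a"
    and X: "filterlim X sequentially sequentially" and Y: "filterlim Y sequentially sequentially"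
  shows "(\<lambda>n. \<integral>x. indicator (box u v) x *\<^sub>R partial_sum_integral a W (X n) (Y n) x \<partial>lborel)
    \<longlonglongrightarrow> (\<integral>x. indicator (box u v) x *\<^sub>R (of_real (4 * a\<^sup>2) * W x) \<partial>lborel)"
proof -
  obtain u1 u2 v1 v2 where uv: "u = (u1, u2)" "v = (v1, v2)" by (metis surj_pair)
  show ?thesis
  proof (cases "u1 < v1 \<and> u2 < v2")
    case False
    then have "box u v = {}" unfolding uv box_pair by auto
    then show ?thesis by simp
  next
    case True
    note bd = box_in_ball_bounds[OF sub[unfolded uv]]
    have lim: "(\<lambda>n. \<integral>y. indicator (cball 0 a) y *\<^sub>R (W y * of_real (interval_sum a u1 v1 (X n) (fst y) * interval_sum a u2 v2 (Y n) (snd y))) \<partial>lborel)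
      \<longlonglongrightarrow> (\<integral>y. indicator (cball 0 a) y *\<^sub>R (W y * of_real ((2 * a * indicator {u1<..<v1} (fst y)) * (2 * a * indicator {u2<..<v2} (snd y)))) \<partial>lborel)"
    proof (rule integral_dominated_convergence)
      have contI: "continuous_on S (\<lambda>y. interval_sum a u v M (f y))" if "continuous_on S f" for S :: "(real \<times> real) set" and f u v M
        unfolding interval_sum_def dirichlet_primitive_def using a that by (intro continuous_intros) auto
      show "(\<lambda>y. indicator (cball 0 a) y *\<^sub>R (W y * of_real (interval_sum a u1 v1 (X n) (fst y) * interval_sum a u2 v2 (Y n) (snd y)))) \<in> borel_measurable lborel" for n
        by (rule borel_measurable_integrable, intro borel_integrable_compact compact_cball continuous_intros contI continuous_bipoly[OF W])
      have Wm: "W \<in> borel_measurable borel" by (intro borel_measurable_continuous_onI continuous_bipoly[OF W])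
      have Bm: "(\<lambda>y :: real \<times> real. complex_of_real ((2 * a * indicator {u1<..<v1} (fst y)) * (2 * a * indicator {u2<..<v2} (snd y)))) \<in> borel_measurable borel"
        unfolding borel_prod[symmetric] by measurable
      have "(\<lambda>y. indicator (cball 0 a) y *\<^sub>R (W y * of_real ((2 * a * indicator {u1<..<v1} (fst y)) * (2 * a * indicator {u2<..<v2} (snd y))))) \<in> borel_measurable borel"
        by (intro borel_measurable_scaleR borel_measurable_times Wm Bm borel_measurable_indicator) simp
      then show "(\<lambda>y. indicator (cball 0 a) y *\<^sub>R (W y * of_real ((2 * a * indicator {u1<..<v1} (fst y)) * (2 * a * indicator {u2<..<v2} (snd y))))) \<in> borel_measurable lborel"
        by simp
      have "integrable lborel (\<lambda>y. indicator (cball 0 a) y *\<^sub>R W y)"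
        by (intro borel_integrable_compact compact_cball continuous_bipoly[OF W])
      then show "integrable lborel (\<lambda>y. (10 * a) * (10 * a) * norm (indicator (cball 0 a) y *\<^sub>R W y))"
        by (intro integrable_mult_right integrable_norm)
      have coord: "\<bar>fst y\<bar> \<le> a" "\<bar>snd y\<bar> \<le> a" if "y \<in> cball 0 a" for y :: "real \<times> real"
        using that norm_fst_le[of "fst y" "snd y"] norm_snd_le[of "snd y" "fst y"] by auto
      show "AE y in lborel. norm (indicator (cball 0 a) y *\<^sub>R (W y * of_real (interval_sum a u1 v1 (X n) (fst y) * interval_sum a u2 v2 (Y n) (snd y))))
        \<le> (10 * a) * (10 * a) * norm (indicator (cball 0 a) y *\<^sub>R W y)" for n
      proof (rule AE_I2)
        fix y
        show "norm (indicator (cball 0 a) y *\<^sub>R (W y * of_real (interval_sum a u1 v1 (X n) (fst y) * interval_sum a u2 v2 (Y n) (snd y))))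
          \<le> (10 * a) * (10 * a) * norm (indicator (cball 0 a) y *\<^sub>R W y)"
        proof (cases "y \<in> cball 0 a")
          case yc: True
          have "\<bar>interval_sum a u1 v1 (X n) (fst y)\<bar> * \<bar>interval_sum a u2 v2 (Y n) (snd y)\<bar> \<le> (10 * a) * (10 * a)"
            using a bd True coord[OF yc] by (intro mult_mono interval_sum_bound) auto
          then have "norm (W y) * (\<bar>interval_sum a u1 v1 (X n) (fst y)\<bar> * \<bar>interval_sum a u2 v2 (Y n) (snd y)\<bar>) \<le> norm (W y) * ((10 * a) * (10 * a))"
            by (intro mult_left_mono) auto
          then show ?thesis using yc by (simp add: norm_mult mult.commute del: mem_cball mem_cball_0)
        qed simp
      qed
      have "AE y in lborel. fst y \<noteq> u1 \<and> fst y \<noteq> v1 \<and> fst y \<noteq> a \<and> fst y \<noteq> - a \<and> snd y \<noteq> u2 \<and> snd y \<noteq> v2 \<and> snd y \<noteq> a \<and> snd y \<noteq> - a"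
        by (intro AE_conjI AE_lborel_coordinates)
      then show "AE y in lborel. (\<lambda>n. indicator (cball 0 a) y *\<^sub>R (W y * of_real (interval_sum a u1 v1 (X n) (fst y) * interval_sum a u2 v2 (Y n) (snd y))))
        \<longlonglongrightarrow> indicator (cball 0 a) y *\<^sub>R (W y * of_real ((2 * a * indicator {u1<..<v1} (fst y)) * (2 * a * indicator {u2<..<v2} (snd y))))"
      proof eventually_elim
        case (elim y)
        show ?case
        proof (cases "y \<in> cball 0 a")
          case yc: True
          have lt: "\<bar>fst y\<bar> < a" "\<bar>snd y\<bar> < a" using coord[OF yc] elim by auto
          have "(\<lambda>n. interval_sum a u1 v1 (X n) (fst y)) \<longlonglongrightarrow> 2 * a * indicator {u1<..<v1} (fst y)"
            using a bd True lt elim by (intro filterlim_compose[OF interval_sum_tendsto X]) auto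
          moreover have "(\<lambda>n. interval_sum a u2 v2 (Y n) (snd y)) \<longlonglongrightarrow> 2 * a * indicator {u2<..<v2} (snd y)"
            using a bd True lt elim by (intro filterlim_compose[OF interval_sum_tendsto Y]) auto
          ultimately show ?thesis by (intro tendsto_intros)
        qed simp
      qed
    qed
    have "indicator (cball 0 a) y *\<^sub>R (W y * of_real ((2 * a * indicator {u1<..<v1} (fst y)) * (2 * a * indicator {u2<..<v2} (snd y))))
      = indicator (box u v) y *\<^sub>R (of_real (4 * a\<^sup>2) * W y)" for y
    proof (cases "y \<in> box u v")
      case True
      then have "y \<in> cball 0 a" using sub ball_subset_cball[of 0 a] by blast
      moreover have "fst y \<in> {u1<..<v1}" "snd y \<in> {u2<..<v2}" using True by (auto simp: uv box_pair)
      ultimately show ?thesis using True by (simp add: power2_eq_square mult_ac del: mem_cball mem_cball_0)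
    next
      case False
      then have "fst y \<notin> {u1<..<v1} \<or> snd y \<notin> {u2<..<v2}" by (cases y) (auto simp: uv box_pair)
      then show ?thesis using False by auto
    qed
    then show ?thesis using lim integral_box_partial_sum[OF a W, of u1 v1 u2 v2] True unfolding uv by simp
  qed
qed

text \<open>The difference between partial sums and limit is cut off to the open disc, because the
  criterion by boxes works on an open set. The circle lost in this way is a null set, and
  \<open>g\<close> vanishes outside.\<close>

proposition partial_sum_weak_limit:
  assumes a: "0 < a" and W: "bipoly W" and g: "integrable lborel g" and off: "\<And>x. x \<notin> cball 0 a \<Longrightarrow> g x = 0"
  shows "((\<lambda>(M, N). \<integral>x. g x * partial_sum_integral a W M N x \<partial>lborel) \<longlongrightarrow> of_real (4 * a\<^sup>2) * (\<integral>x. g x * W x \<partial>lborel))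
    (sequentially \<times>\<^sub>F sequentially)"
proof (rule double_limit_sequentially)
  fix X Y :: "nat \<Rightarrow> nat"
  assume X: "filterlim X sequentially sequentially" and Y: "filterlim Y sequentially sequentially"
  define T where "T n = partial_sum_integral a W (X n) (Y n)" for n
  define V where "V x = of_real (4 * a\<^sup>2) * W x" for x
  define U where "U n x = indicator (ball 0 a) x *\<^sub>R (T n x - V x)" for n x
  obtain C where C: "\<forall>M N. \<forall>x \<in> cball 0 a. norm (partial_sum_integral a W M N x) \<le> C"
    using partial_sum_bipoly_bound[OF a W] by blast
  have contV: "continuous_on S V" for S unfolding V_def by (intro continuous_intros continuous_bipoly[OF W])
  have contT: "continuous_on S (T n)" for S n
    unfolding T_def partial_sum_integral_eq[OF W, abs_def] by (intro continuous_intros)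
  obtain D where D: "\<And>x. x \<in> cball 0 a \<Longrightarrow> norm (V x) \<le> D"
    using compact_imp_bounded[OF compact_continuous_image[OF contV compact_cball[of 0 a]]] unfolding bounded_iff by blast
  have Um: "U n \<in> borel_measurable borel" for n
    unfolding U_def
    by (intro borel_measurable_scaleR borel_measurable_diff borel_measurable_indicator
        borel_measurable_continuous_onI[OF contT] borel_measurable_continuous_onI[OF contV]) simp
  have "0 \<le> C + D" using C D[of 0] a order_trans[OF norm_ge_zero, of "partial_sum_integral a W 0 0 0" C] order_trans[OF norm_ge_zero, of "V 0" D] by auto
  then have Ub: "norm (U n x) \<le> C + D" for n x
  proof (cases "x \<in> ball 0 a")
    case True
    then have xc: "x \<in> cball 0 a" by auto
    have "norm (T n x - V x) \<le> norm (T n x) + norm (V x)" by (rule norm_triangle_ineq4)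
    also have "\<dots> \<le> C + D" using C D xc by (intro add_mono) (auto simp: T_def)
    finally show ?thesis using True by (simp add: U_def)
  qed (simp add: U_def)
  have W0: "(\<lambda>n. \<integral>x. g x * U n x \<partial>lborel) \<longlonglongrightarrow> 0"
  proof (rule tendsto_zero_weak[OF Um Ub _ open_ball _ g])
    show "U n x = 0" if "x \<notin> ball 0 a" for n x using that by (simp add: U_def)
    fix u v assume sub: "box u v \<subseteq> ball (0 :: real \<times> real) a"
    have "(\<integral>x. indicator (box u v) x * U n x \<partial>lborel)
      = (\<integral>x. indicator (box u v) x *\<^sub>R T n x \<partial>lborel) - (\<integral>x. indicator (box u v) x *\<^sub>R V x \<partial>lborel)" for n
    proof -
      have "(\<integral>x. indicator (box u v) x * U n x \<partial>lborel) = (\<integral>x. indicator (box u v) x *\<^sub>R T n x - indicator (box u v) x *\<^sub>R V x \<partial>lborel)"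
        using sub by (intro Bochner_Integration.integral_cong refl) (auto simp: U_def indicator_def simp del: mem_ball mem_ball_0)
      then show ?thesis
        by (simp only: Bochner_Integration.integral_diff[OF integrable_compact_times[OF contT] integrable_compact_times[OF contV]])
    qed
    moreover have "(\<lambda>n. (\<integral>x. indicator (box u v) x *\<^sub>R T n x \<partial>lborel) - (\<integral>x. indicator (box u v) x *\<^sub>R V x \<partial>lborel)) \<longlonglongrightarrow> 0"
      using box_partial_sum_tendsto[OF a W sub X Y] unfolding T_def V_def by (rule LIM_zero)
    ultimately show "(\<lambda>n. \<integral>x. indicator (box u v) x * U n x \<partial>lborel) \<longlonglongrightarrow> 0" by (simp only:)
  qed
  have sphere: "AE x in (lborel :: (real \<times> real) measure). norm x \<noteq> a"
  proof -
    have "sphere (0 :: real \<times> real) a \<in> null_sets lebesgue"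
      using negligible_sphere negligible_iff_null_sets by blast
    then have "sphere (0 :: real \<times> real) a \<in> null_sets lborel"
      by (subst (asm) null_sets_completion_iff) auto
    from AE_not_in[OF this] show ?thesis by eventually_elim simp
  qed
  \<comment> \<open>Integrability against one bounded function is the lemma for bounded sequences,
    applied to a constant sequence.\<close>
  have gint: "integrable lborel (\<lambda>x. g x * (indicator (cball 0 a) x *\<^sub>R H x))" if H: "continuous_on UNIV H" for H
  proof -
    obtain B where B: "\<And>x. x \<in> cball 0 a \<Longrightarrow> norm (H x) \<le> B"
      using compact_imp_bounded[OF compact_continuous_image[OF continuous_on_subset[OF H] compact_cball[of 0 a]]] unfolding bounded_iff by blast
    have "norm (H 0) \<le> B" using a by (intro B) simp
    then have B0: "0 \<le> B" by (rule order_trans[OF norm_ge_zero])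
    show ?thesis
    proof (rule integrable_mult_bounded[OF _ _ g, of "\<lambda>n::nat. \<lambda>x. indicator (cball 0 a) x *\<^sub>R H x" B])
      show "(\<lambda>x. indicator (cball 0 a) x *\<^sub>R H x) \<in> borel_measurable borel"
        by (intro borel_measurable_scaleR borel_measurable_indicator borel_measurable_continuous_onI[OF H]) simp
      show "norm (indicator (cball 0 a) x *\<^sub>R H x) \<le> B" for x
        using B B0 by (simp add: indicator_def del: mem_cball mem_cball_0)
    qed
  qed
  have gind: "g x * (indicator (cball 0 a) x *\<^sub>R h) = g x * h" for x h
    using off[of x] by (simp add: indicator_def del: mem_cball mem_cball_0)
  have "(\<integral>x. g x * U n x \<partial>lborel) = (\<integral>x. g x * T n x \<partial>lborel) - (\<integral>x. g x * V x \<partial>lborel)" for n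
  proof -
    have "(\<integral>x. g x * U n x \<partial>lborel) = (\<integral>x. g x * T n x - g x * V x \<partial>lborel)"
    proof (rule integral_cong_AE)
      show "(\<lambda>x. g x * U n x) \<in> borel_measurable lborel" using Um borel_measurable_integrable[OF g] by simp
      show "(\<lambda>x. g x * T n x - g x * V x) \<in> borel_measurable lborel"
        using borel_measurable_integrable[OF g] borel_measurable_continuous_onI[OF contT] borel_measurable_continuous_onI[OF contV] by simp
      show "AE x in lborel. g x * U n x = g x * T n x - g x * V x"
        using sphere
      proof eventually_elim
        case (elim x)
        then show ?case using off[of x] by (cases "norm x < a") (auto simp: U_def right_diff_distrib)
      qed
    qed
    then show ?thesis using gint[OF contT, of n] gint[OF contV] unfolding gind by (simp only: Bochner_Integration.integral_diff)
  qed
  then have "(\<lambda>n. (\<integral>x. g x * T n x \<partial>lborel) - (\<integral>x. g x * V x \<partial>lborel)) \<longlonglongrightarrow> 0" using W0 by simp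
  then have "(\<lambda>n. \<integral>x. g x * T n x \<partial>lborel) \<longlonglongrightarrow> (\<integral>x. g x * V x \<partial>lborel)" by (rule LIM_zero_cancel)
  moreover have "(\<integral>x. g x * V x \<partial>lborel) = of_real (4 * a\<^sup>2) * (\<integral>x. g x * W x \<partial>lborel)"
    unfolding V_def integral_mult_right_zero[symmetric] by (simp only: mult.left_commute)
  ultimately show "(\<lambda>n. \<integral>x. g x * partial_sum_integral a W (X n) (Y n) x \<partial>lborel) \<longlonglongrightarrow> of_real (4 * a\<^sup>2) * (\<integral>x. g x * W x \<partial>lborel)"
    unfolding T_def by simp
qed

section \<open>Convolution and Fourier coefficients\<close>

text \<open>The completion measures every subset of a null set, so sets that agree almost everywhere
  are measurable together. This lets the completed integrals of the statement be replaced by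
  integrals over \<open>lborel\<close>, where Fubini is applied.\<close>

lemma lebesgue_measurable_AE_eq:
  fixes f g :: "'a :: euclidean_space \<Rightarrow> 'b :: {second_countable_topology, real_normed_vector}"
  assumes g: "g \<in> borel_measurable borel" and eq: "AE x in lborel. f x = g x"
  shows "f \<in> borel_measurable lebesgue"
proof (rule measurableI)
  fix S :: "'b set" assume S: "S \<in> sets borel"
  have gl: "g \<in> borel_measurable lebesgue" using g by (simp add: measurable_completion)
  have "AE x in lebesgue. f x = g x" using eq by (rule AE_completion)
  then have "AE x in lebesgue. x \<in> g -` S \<longleftrightarrow> x \<in> f -` S" by eventually_elim simp
  moreover have "g -` S \<in> sets lebesgue" using measurable_sets[OF gl S] by simp
  ultimately have "f -` S \<in> sets lebesgue" by (rule completion.in_sets_AE) simp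
  then show "f -` S \<inter> space lebesgue \<in> sets lebesgue" by simp
qed simp

lemma integral_lebesgue_AE_eq:
  fixes f g :: "'a :: euclidean_space \<Rightarrow> 'b :: {second_countable_topology, banach}"
  assumes g: "g \<in> borel_measurable borel" and eq: "AE x in lborel. f x = g x"
  shows "integral\<^sup>L lebesgue f = integral\<^sup>L lborel g"
proof -
  have "integral\<^sup>L lebesgue f = integral\<^sup>L lebesgue g"
    using lebesgue_measurable_AE_eq[OF g eq] g AE_completion[OF eq]
    by (intro integral_cong_AE) (auto simp: measurable_completion)
  also have "\<dots> = integral\<^sup>L lborel g" using g by (intro integral_completion) simp
  finally show ?thesis .
qed

text \<open>Real and imaginary parts have Borel representatives; multiplying by the indicator of the
  ball makes the support condition hold everywhere instead of almost everywhere.\<close>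

lemma borel_version:
  fixes f :: "real \<times> real \<Rightarrow> complex"
  assumes f: "integrable lebesgue f" and off: "AE x in lebesgue. x \<notin> cball 0 b \<longrightarrow> f x = 0"
  obtains f' where "integrable lborel f'" "f' \<in> borel_measurable borel" "AE x in lborel. f x = f' x" "\<And>x. x \<notin> cball 0 b \<Longrightarrow> f' x = 0"
proof -
  have fm: "f \<in> borel_measurable lebesgue" by (rule borel_measurable_integrable[OF f])
  obtain r where r: "r \<in> borel_measurable lborel" "AE x in lborel. Re (f x) = r x"
    using completion_ex_borel_measurable_real[of "\<lambda>x. Re (f x)" lborel] fm by auto
  obtain i where i: "i \<in> borel_measurable lborel" "AE x in lborel. Im (f x) = i x"
    using completion_ex_borel_measurable_real[of "\<lambda>x. Im (f x)" lborel] fm by auto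
  define f' where "f' x = indicator (cball 0 b) x *\<^sub>R (of_real (r x) + \<i> * of_real (i x))" for x
  have rm: "r \<in> borel_measurable borel" "i \<in> borel_measurable borel" using r(1) i(1) by simp_all
  have m: "f' \<in> borel_measurable borel"
  proof -
    note [measurable] = rm
    have [measurable]: "cball (0 :: real \<times> real) b \<in> sets borel" by simp
    show ?thesis unfolding f'_def by measurable
  qed
  have "AE x in lborel. x \<notin> cball 0 b \<longrightarrow> f x = 0" using off by (simp only: AE_completion_iff)
  with r(2) i(2) have ae: "AE x in lborel. f x = f' x"
  proof eventually_elim
    case (elim x)
    then show ?case by (auto simp: f'_def complex_eq_iff indicator_def)
  qed
  have "f' \<in> borel_measurable lebesgue" using m by (simp add: measurable_completion)
  then have "integrable lebesgue f'" using integrable_cong_AE[OF fm _ AE_completion[OF ae]] f by blast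
  then have "integrable lborel f'" using m by (simp add: integrable_completion)
  then show ?thesis using that m ae by (simp add: f'_def)
qed

lemma lborel_distr_reflect: "distr lborel borel (\<lambda>y. x - y) = (lborel :: (real \<times> real) measure)"
  by (subst lborel_affine[of "-1" x]) (auto simp: density_1 one_ennreal_def[symmetric])

lemma AE_lborel_reflect:
  fixes x :: "real \<times> real"
  assumes "AE y in lborel. P y" shows "AE y in lborel. P (x - y)"
proof -
  obtain N where N: "N \<in> null_sets lborel" "{y. \<not> P y} \<subseteq> N"
    using assms unfolding eventually_ae_filter by auto
  have m: "(\<lambda>y. x - y) \<in> measurable lborel borel" by simp
  have "(\<lambda>y. x - y) -` N \<inter> space lborel \<in> null_sets lborel"
  proof (rule null_setsI)
    have Nb: "N \<in> sets borel" using N by auto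
    have "emeasure lborel ((\<lambda>y. x - y) -` N \<inter> space lborel) = emeasure (distr lborel borel (\<lambda>y. x - y)) N"
      by (rule emeasure_distr[OF m Nb, symmetric])
    then show "emeasure lborel ((\<lambda>y. x - y) -` N \<inter> space lborel) = 0"
      unfolding lborel_distr_reflect using N by auto
    show "(\<lambda>y. x - y) -` N \<inter> space lborel \<in> sets lborel" using measurable_sets[OF m Nb] by simp
  qed
  from AE_not_in[OF this] show ?thesis by eventually_elim (use N in auto)
qed

lemma lborel_translate:
  fixes f :: "real \<times> real \<Rightarrow> 'b :: {banach, second_countable_topology}"
  assumes f: "integrable lborel f"
  shows "integrable lborel (\<lambda>x. f (x - y))" "(\<integral>x. f (x - y) \<partial>lborel) = (\<integral>x. f x \<partial>lborel)"
proof -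
  have m: "(+) (- y) \<in> measurable lborel borel" by simp
  have fm: "f \<in> borel_measurable borel" using borel_measurable_integrable[OF f] by simp
  have "integrable (distr lborel borel ((+) (- y))) f" using f by (simp add: lborel_distr_plus)
  then show "integrable lborel (\<lambda>x. f (x - y))" by (simp add: integrable_distr_eq[OF m fm])
  have "(\<integral>x. f x \<partial>lborel) = (\<integral>x. f x \<partial>distr lborel borel ((+) (- y)))" by (simp add: lborel_distr_plus)
  also have "\<dots> = (\<integral>x. f ((- y) + x) \<partial>lborel)" by (rule integral_distr[OF m fm])
  finally show "(\<integral>x. f (x - y) \<partial>lborel) = (\<integral>x. f x \<partial>lborel)" by simp
qed

section \<open>Convolution of Borel functions and its transform\<close>

definition borel_conv :: "(real \<times> real \<Rightarrow> complex) \<Rightarrow> (real \<times> real \<Rightarrow> complex) \<Rightarrow> real \<times> real \<Rightarrow> complex"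
  where "borel_conv f g x = (\<integral>y. f y * g (x - y) \<partial>lborel)"

text \<open>For fixed \<open>x\<close> the reflection \<open>y -> x - y\<close> preserves null sets,
  so the integrands agree almost everywhere and the convolutions agree at every single point. This
  matters because the inner integral of the coefficient runs along a circle, which is a null set of
  the plane.\<close>

lemma conv2_eq_borel_conv:
  assumes f: "f' \<in> borel_measurable borel" "AE x in lborel. f x = f' x"
    and g: "g' \<in> borel_measurable borel" "AE x in lborel. g x = g' x"
  shows "conv2 f g x = borel_conv f' g' x"
  unfolding conv2_def borel_conv_def
proof (rule integral_lebesgue_AE_eq)
  show "(\<lambda>y. f' y * g' (x - y)) \<in> borel_measurable borel"
    using f(1) measurable_compose[OF _ g(1), of "\<lambda>y. x - y" borel] by simp
  show "AE y in lborel. f y * g (x - y) = f' y * g' (x - y)"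
    using f(2) AE_lborel_reflect[OF g(2), of x] by eventually_elim simp
qed

text \<open>With \<open>x\<close> integrated first, translation invariance leaves
  \<open>norm (f y)\<close> times the \<open>L1\<close> norm of \<open>g\<close>.\<close>

lemma integrable_conv_kernel:
  fixes f g :: "real \<times> real \<Rightarrow> complex"
  assumes f: "integrable lborel f" and g: "integrable lborel g"
  shows "integrable (lborel \<Otimes>\<^sub>M lborel) (\<lambda>(y, x). f y * g (x - y))"
proof (rule lborel_pair.Fubini_integrable)
  have [measurable]: "f \<in> borel_measurable borel" "g \<in> borel_measurable borel"
    using borel_measurable_integrable[OF f] borel_measurable_integrable[OF g] by simp_all
  show "(\<lambda>(y, x). f y * g (x - y)) \<in> borel_measurable (lborel \<Otimes>\<^sub>M lborel)" by measurable
  have "(\<integral>x. norm (case (y, x) of (y, x) \<Rightarrow> f y * g (x - y)) \<partial>lborel) = norm (f y) * (\<integral>x. norm (g x) \<partial>lborel)" for y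
    using lborel_translate(2)[OF integrable_norm[OF g], of y] by (simp add: norm_mult)
  then show "integrable lborel (\<lambda>y. \<integral>x. norm (case (y, x) of (y, x) \<Rightarrow> f y * g (x - y)) \<partial>lborel)"
    using integrable_norm[OF f] by simp
  show "AE y in lborel. integrable lborel (\<lambda>x. case (y, x) of (y, x) \<Rightarrow> f y * g (x - y))"
    using lborel_translate(1)[OF g] by simp
qed

lemma integrable_borel_conv:
  assumes "integrable lborel f" "integrable lborel g"
  shows "integrable lborel (borel_conv f g)"
  using lborel_pair.integrable_snd[of "\<lambda>y x. f y * g (x - y)", OF integrable_conv_kernel[OF assms]]
  unfolding borel_conv_def[abs_def] .

lemma borel_measurable_borel_conv:
  assumes [measurable]: "f \<in> borel_measurable borel" "g \<in> borel_measurable borel"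
  shows "borel_conv f g \<in> borel_measurable borel"
proof -
  have "(\<lambda>x. \<integral>y. f y * g (x - y) \<partial>lborel) \<in> borel_measurable lborel"
    by (rule lborel.borel_measurable_lebesgue_integral) measurable
  then show ?thesis by (simp add: borel_conv_def[abs_def])
qed

lemma integrable_mult_lattice_exp:
  assumes "integrable lborel g" shows "integrable lborel (\<lambda>x. g x * lattice_exp a k (- x))"
proof (rule integrable_mult_bounded[OF _ _ assms, of "\<lambda>n::nat. \<lambda>x. lattice_exp a k (- x)" 1])
  show "(\<lambda>x. lattice_exp a k (- x)) \<in> borel_measurable borel"
    by (intro borel_measurable_continuous_onI continuous_intros)
qed (simp add: norm_lattice_exp)

text \<open>The character at \<open>x\<close> is its value at \<open>y\<close> times its value at
  \<open>x - y\<close>, so the integrand is again a convolution kernel, of the two modulated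
  functions, and Fubini with a translation splits it.\<close>

lemma borel_conv_transform:
  assumes f: "integrable lborel f" and g: "integrable lborel g"
  shows "(\<integral>x. borel_conv f g x * lattice_exp a k (- x) \<partial>lborel)
    = (\<integral>x. f x * lattice_exp a k (- x) \<partial>lborel) * (\<integral>x. g x * lattice_exp a k (- x) \<partial>lborel)"
proof -
  let ?e = "\<lambda>x. lattice_exp a k (- x)"
  have split: "f y * g (x - y) * ?e x = (f y * ?e y) * (g (x - y) * ?e (x - y))" for x y
  proof -
    have "?e x = ?e y * ?e (x - y)" unfolding lattice_exp_add[symmetric] by simp
    then show ?thesis by simp
  qed
  have int: "integrable (lborel \<Otimes>\<^sub>M lborel) (case_prod (\<lambda>y x. f y * g (x - y) * ?e x))"
    using integrable_conv_kernel[OF integrable_mult_lattice_exp[OF f] integrable_mult_lattice_exp[OF g], of a k a k]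
    by (simp only: split)
  have "(\<integral>x. borel_conv f g x * ?e x \<partial>lborel) = (\<integral>x. (\<integral>y. f y * g (x - y) * ?e x \<partial>lborel) \<partial>lborel)"
    unfolding borel_conv_def by simp
  also have "\<dots> = (\<integral>y. (\<integral>x. f y * g (x - y) * ?e x \<partial>lborel) \<partial>lborel)"
    by (rule lborel_pair.Fubini_integral[OF int])
  also have "\<dots> = (\<integral>y. (f y * ?e y) * (\<integral>x. g x * ?e x \<partial>lborel) \<partial>lborel)"
    unfolding split using lborel_translate(2)[OF integrable_mult_lattice_exp[OF g]] by simp
  also have "\<dots> = (\<integral>x. f x * ?e x \<partial>lborel) * (\<integral>x. g x * ?e x \<partial>lborel)" by simp
  finally show ?thesis .
qed

lemma borel_conv_support:
  assumes f: "\<And>x. x \<notin> cball 0 (a / 2) \<Longrightarrow> f x = 0" and g: "\<And>x. x \<notin> cball 0 (a / 2) \<Longrightarrow> g x = 0" and x: "x \<notin> cball 0 a"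
  shows "borel_conv f g x = 0"
proof -
  have z: "f y * g (x - y) = 0" for y
  proof (cases "y \<in> cball 0 (a / 2)")
    case True
    have "norm x \<le> norm y + norm (x - y)" by (rule norm_triangle_sub)
    then have "x - y \<notin> cball 0 (a / 2)" using True x by auto
    then show ?thesis using g by simp
  qed (use f in simp)
  show ?thesis by (simp only: borel_conv_def z Bochner_Integration.integral_zero)
qed

text \<open>A null set of the plane has null slices for almost every second coordinate. There the
  inner integral may be taken over the Borel version, and the outer integral does not see the rest.
  The square is then dropped because the Borel version vanishes outside it.\<close>

lemma fourier_hat_eq:
  assumes a: "0 < a" and f': "integrable lborel f'" "f' \<in> borel_measurable borel"
    and ae: "AE x in lborel. f x = f' x" and off: "\<And>x. x \<notin> cball 0 (a / 2) \<Longrightarrow> f' x = 0"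
  shows "fourier_hat a f k = (\<integral>x. f' x * lattice_exp a k (- x) \<partial>lborel)"
proof -
  let ?e = "\<lambda>x1 x2. exp (- (of_real pi * \<i> * of_real (1 / a) * of_real (of_int (fst k) * x1 + of_int (snd k) * x2)))"
  have e: "?e x1 x2 = lattice_exp a k (- (x1, x2))" for x1 x2
    unfolding lattice_exp_minus by (simp add: algebra_simps)
  have [measurable]: "f' \<in> borel_measurable (borel \<Otimes>\<^sub>M borel)" using f'(2) by (simp add: borel_prod)
  obtain N where N: "N \<in> null_sets lborel" "{x. f x \<noteq> f' x} \<subseteq> N"
    using ae unfolding eventually_ae_filter by auto
  have Nm: "N \<in> sets (lborel \<Otimes>\<^sub>M lborel)" using null_setsD2[OF N(1)] by (simp only: lborel_prod)
  have "AE z in lborel \<Otimes>\<^sub>M lborel. z \<notin> N" using AE_not_in[OF N(1)] by (simp only: lborel_prod)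
  then have ae12: "AE x1 in lborel. AE x2 in lborel. (x1, x2) \<notin> N" by (rule lborel_pair.AE_pair)
  have sets12: "{x \<in> space (lborel \<Otimes>\<^sub>M lborel). (fst x, snd x) \<notin> N} \<in> sets (lborel \<Otimes>\<^sub>M lborel)"
  proof -
    have "{x \<in> space (lborel \<Otimes>\<^sub>M lborel). (fst x, snd x) \<notin> N} = space (lborel \<Otimes>\<^sub>M lborel) - N" by auto
    then show ?thesis using sets.compl_sets[OF Nm] by (simp only:)
  qed
  \<comment> \<open>Fubini yields null slices with the first coordinate fixed; the inner integral
    runs over \<open>x1\<close>, so the quantifiers are exchanged.\<close>
  note aeN = iffD1[OF lborel_pair.AE_commute[where P = "\<lambda>x1 x2. (x1, x2) \<notin> N", OF sets12] ae12]
  define G where "G x1 x2 = indicator {-a..a} x1 *\<^sub>R (f' (x1, x2) * lattice_exp a k (- (x1, x2)))" for x1 x2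
  have em: "(\<lambda>x. lattice_exp a k (- x)) \<in> borel_measurable (borel \<Otimes>\<^sub>M borel)"
    unfolding borel_prod by (intro borel_measurable_continuous_onI continuous_intros)
  have Gm: "case_prod G \<in> borel_measurable (lborel \<Otimes>\<^sub>M lborel)"
  proof -
    have "(\<lambda>x. indicator {-a..a} (fst x) *\<^sub>R (f' x * lattice_exp a k (- x))) \<in> borel_measurable (borel \<Otimes>\<^sub>M borel)"
      by (intro borel_measurable_scaleR borel_measurable_times em) measurable
    then show ?thesis by (simp add: G_def split_beta' del: uminus_Pair)
  qed
  have Gslice: "(\<lambda>x1. G x1 x2) \<in> borel_measurable borel" for x2
    using measurable_Pair2'[of x2 lborel lborel] measurable_compose[OF _ Gm, of "\<lambda>x1. (x1, x2)" borel] by simp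
  have inner: "(LINT x1:{-a..a}|lebesgue. f (x1, x2) * ?e x1 x2) = (\<integral>x1. G x1 x2 \<partial>lborel)"
    if "AE x1 in lborel. (x1, x2) \<notin> N" for x2
    unfolding set_lebesgue_integral_def
  proof (rule integral_lebesgue_AE_eq[OF Gslice])
    show "AE x1 in lborel. indicator {-a..a} x1 *\<^sub>R (f (x1, x2) * ?e x1 x2) = G x1 x2"
      using that
    proof eventually_elim
      case (elim x1)
      then have "f (x1, x2) = f' (x1, x2)" using N(2) by auto
      then show ?case by (simp only: G_def e)
    qed
  qed
  have mo: "(\<lambda>x2. indicator {-a..a} x2 *\<^sub>R (\<integral>x1. G x1 x2 \<partial>lborel)) \<in> borel_measurable borel"
  proof -
    have "(\<lambda>x2. \<integral>x1. G x1 x2 \<partial>lborel) \<in> borel_measurable lborel"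
    proof (rule lborel.borel_measurable_lebesgue_integral)
      show "(\<lambda>(x2, x1). G x1 x2) \<in> borel_measurable (lborel \<Otimes>\<^sub>M lborel)"
        using measurable_compose[OF measurable_pair_swap' Gm] by (simp add: split_beta')
    qed
    then show ?thesis by (intro borel_measurable_scaleR borel_measurable_indicator) auto
  qed
  have zero: "f' (x1, x2) = 0" if "x1 \<notin> {-a..a} \<or> x2 \<notin> {-a..a}" for x1 x2
  proof (rule off)
    have "\<bar>x1\<bar> \<le> norm (x1, x2)" "\<bar>x2\<bar> \<le> norm (x1, x2)" using norm_fst_le[of x1 x2] norm_snd_le[of x2 x1] by auto
    then show "(x1, x2) \<notin> cball 0 (a / 2)" using that a by (simp del: mem_cball) auto
  qed
  have Geq: "G x1 x2 = f' (x1, x2) * lattice_exp a k (- (x1, x2))" for x1 x2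
    using zero[of x1 x2] unfolding G_def by (simp add: indicator_def)
  have int: "integrable (lborel \<Otimes>\<^sub>M lborel) (case_prod G)"
    using integrable_mult_lattice_exp[OF f'(1), of a k] by (simp add: lborel_prod Geq split_beta')
  have "fourier_hat a f k = (\<integral>x2. indicator {-a..a} x2 *\<^sub>R (\<integral>x1. G x1 x2 \<partial>lborel) \<partial>lborel)"
    unfolding fourier_hat_def
  proof (subst set_lebesgue_integral_def, rule integral_lebesgue_AE_eq[OF mo])
    show "AE x2 in lborel. indicator {-a..a} x2 *\<^sub>R (LINT x1:{-a..a}|lebesgue. f (x1, x2) * ?e x1 x2)
      = indicator {-a..a} x2 *\<^sub>R (\<integral>x1. G x1 x2 \<partial>lborel)"
      using aeN by eventually_elim (simp only: inner)
  qed
  also have "\<dots> = (\<integral>x2. (\<integral>x1. G x1 x2 \<partial>lborel) \<partial>lborel)"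
  proof (intro Bochner_Integration.integral_cong refl)
    fix x2 :: real
    show "indicator {-a..a} x2 *\<^sub>R (\<integral>x1. G x1 x2 \<partial>lborel) = (\<integral>x1. G x1 x2 \<partial>lborel)"
      using zero[of _ x2] by (cases "x2 \<in> {-a..a}") (simp_all add: Geq)
  qed
  also have "\<dots> = integral\<^sup>L (lborel \<Otimes>\<^sub>M lborel) (case_prod G)" by (rule lborel_pair.integral_snd[OF int])
  also have "\<dots> = (\<integral>x. f' x * lattice_exp a k (- x) \<partial>lborel)"
    by (simp add: lborel_prod Geq split_beta')
  finally show ?thesis .
qed

text \<open>\<open>g\<close> is Borel, so every circular slice is measurable and both completed
  integrals reduce to Borel ones. The range \<open>[0, a]\<close> extends to the half line because
  \<open>g\<close> vanishes beyond radius \<open>a\<close>, and the polar formula applies.\<close>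

lemma fz_coeff_eq:
  assumes a: "0 < a" and g: "integrable lborel g" "g \<in> borel_measurable borel" and off: "\<And>x. x \<notin> cball 0 a \<Longrightarrow> g x = 0"
    and pq: "p \<le> q" and m: "nat \<bar>m\<bar> = q - p"
  shows "fz_coeff a (p + q) m g = (\<integral>x. g x * conj_zernike a p q m x \<partial>lborel)"
proof -
  let ?W = "conj_zernike a p q m"
  define G where "G x = g x * ?W x" for x
  have Gm: "G \<in> borel_measurable borel"
    unfolding G_def by (intro borel_measurable_times g(2) borel_measurable_continuous_onI continuous_intros)
  obtain B where B: "\<And>x. x \<in> cball 0 a \<Longrightarrow> norm (?W x) \<le> B"
    using compact_imp_bounded[OF compact_continuous_image[OF continuous_conj_zernike compact_cball[of 0 a]]] unfolding bounded_iff by blast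
  have "integrable lborel G"
  proof (rule Bochner_Integration.integrable_bound)
    show "integrable lborel (\<lambda>x. B * norm (g x))" using g by (intro integrable_mult_right integrable_norm)
    show "AE x in lborel. norm (G x) \<le> norm (B * norm (g x))"
    proof (rule AE_I2)
      fix x
      show "norm (G x) \<le> norm (B * norm (g x))"
      proof (cases "x \<in> cball 0 a")
        case True
        have "norm (?W x) * norm (g x) \<le> \<bar>B\<bar> * norm (g x)" using B[OF True] by (intro mult_right_mono) auto
        then show ?thesis by (simp add: G_def norm_mult abs_mult mult.commute)
      next
        case False then show ?thesis using off by (simp add: G_def)
      qed
    qed
  qed (use Gm in simp)
  note polar = integral_polar[OF this]
  have Gpm: "(\<lambda>(r, t). G (r * cos t, r * sin t)) \<in> borel_measurable (borel \<Otimes>\<^sub>M borel)"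
  proof -
    have "(\<lambda>(r, t). (r * cos t, r * sin t) :: real \<times> real) \<in> borel_measurable (borel \<Otimes>\<^sub>M borel)"
      unfolding borel_prod by (intro borel_measurable_continuous_onI) (auto simp: split_beta' intro!: continuous_intros)
    from measurable_compose[OF this Gm] show ?thesis by (simp add: split_beta')
  qed
  define H where "H r t = indicator {0..2*pi} t *\<^sub>R (G (r * cos t, r * sin t) * of_real r)" for r t
  have Hm: "(\<lambda>(r, t). H r t) \<in> borel_measurable (borel \<Otimes>\<^sub>M borel)"
    unfolding H_def split_beta' by (intro borel_measurable_scaleR borel_measurable_times Gpm[unfolded split_beta']) measurable
  have Hslice: "H r \<in> borel_measurable borel" for r
    using measurable_compose[OF measurable_Pair1' Hm, of r] by simp
  have inner: "(LINT t:{0..2*pi}|lebesgue. g (r * cos t, r * sin t) * cnj (fourier_zernike a (p + q) m r t) * of_real r) = (\<integral>t. H r t \<partial>lborel)" for r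
    unfolding set_lebesgue_integral_def
    by (rule integral_lebesgue_AE_eq[OF Hslice]) (simp add: H_def G_def conj_zernike_polar[OF pq m])
  have "(\<lambda>r. \<integral>t. H r t \<partial>lborel) \<in> borel_measurable lborel"
    by (rule lborel.borel_measurable_lebesgue_integral) (use Hm in simp)
  then have mo: "(\<lambda>r. indicator {0..a} r *\<^sub>R (\<integral>t. H r t \<partial>lborel)) \<in> borel_measurable borel"
    by (intro borel_measurable_scaleR borel_measurable_indicator) auto
  have "fz_coeff a (p + q) m g = (\<integral>r. indicator {0..a} r *\<^sub>R (\<integral>t. H r t \<partial>lborel) \<partial>lborel)"
    unfolding fz_coeff_def inner
    unfolding set_lebesgue_integral_def
    by (rule integral_lebesgue_AE_eq[OF mo]) simp
  also have "\<dots> = (\<integral>r. indicator {0..} r *\<^sub>R (\<integral>t. H r t \<partial>lborel) \<partial>lborel)"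
  proof (intro Bochner_Integration.integral_cong refl)
    fix r :: real
    have "H r t = 0" if "a < r" for t
    proof -
      have "(r * cos t)\<^sup>2 + (r * sin t)\<^sup>2 = r\<^sup>2" by (simp add: power_mult_distrib distrib_left[symmetric])
      then have "norm (r * cos t, r * sin t) = r" using that a by (simp add: norm_prod_def)
      then show ?thesis using off[of "(r * cos t, r * sin t)"] that by (simp add: H_def G_def)
    qed
    then show "indicator {0..a} r *\<^sub>R (\<integral>t. H r t \<partial>lborel) = indicator {0..} r *\<^sub>R (\<integral>t. H r t \<partial>lborel)"
      by (cases "a < r") (auto simp: indicator_def)
  qed
  also have "\<dots> = (LINT r:{0..}|lborel. LINT t:{0..2*pi}|lborel. G (r * cos t, r * sin t) * of_real r)"
    unfolding set_lebesgue_integral_def H_def ..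
  also have "\<dots> = integral\<^sup>L lborel G" by (rule polar(2))
  finally show ?thesis unfolding G_def .
qed

text \<open>As \<open>n - m\<close> is even,
  \<open>i^m (-1)^((n - m) / 2) = i^m i^(n - m) = i^n\<close>. The real constants agree because
  \<open>4 a^2 / (2 a sqrt pi)\<close> equals \<open>2 a^2 / (a sqrt pi)\<close>.\<close>

lemma conv_coeff_eq:
  assumes a: "0 < a" and pq: "p \<le> q" and m: "nat \<bar>m\<bar> = q - p"
  shows "of_real (4 * a\<^sup>2) * conv_coeff a k (p + q) m
    = (\<integral>y. indicator (cball 0 a) y *\<^sub>R (conj_zernike a p q m y * lattice_exp a k y) \<partial>lborel)"
proof -
  have i: "\<i> powi m * (- 1) powi ((int (p + q) - m) div 2) = \<i> ^ (p + q)"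
  proof -
    have "int (p + q) - m = 2 * ((int (p + q) - m) div 2)"
    proof -
      have "m = int q - int p \<or> m = int p - int q" using m pq by linarith
      then show ?thesis by auto
    qed
    then have "int (p + q) = m + 2 * ((int (p + q) - m) div 2)" by linarith
    then have "\<i> ^ (p + q) = \<i> powi (m + 2 * ((int (p + q) - m) div 2))" by (metis power_int_of_nat)
    also have "\<dots> = \<i> powi m * (- 1) powi ((int (p + q) - m) div 2)"
      by (simp add: power_int_add power_int_mult)
    finally show ?thesis ..
  qed
  define c where "c = sqrt (real (p + q) + 1)"
  have s: "sqrt ((real (p + q) + 1) / pi) = c / sqrt pi" by (simp add: c_def real_sqrt_divide)
  have real: "4 * a\<^sup>2 * (c * (1 / (2 * a * sqrt pi))) = 2 * (1 / a * (c / sqrt pi)) * a\<^sup>2"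
    using a by (simp add: field_simps power2_eq_square)
  have r: "complex_of_real (4 * a\<^sup>2) * (of_real c * (1 / of_real (2 * a * sqrt pi))) = 2 * of_real (1 / a * (c / sqrt pi)) * of_real (a\<^sup>2)"
    using arg_cong[OF real, of complex_of_real] by (simp only: of_real_mult of_real_divide of_real_1 of_real_numeral)
  have "of_real (4 * a\<^sup>2) * conv_coeff a k (p + q) m
    = (complex_of_real (4 * a\<^sup>2) * (of_real c * (1 / of_real (2 * a * sqrt pi)))) * \<i> ^ (p + q)
      * exp (- (\<i> * of_int m * of_real (lattice_angle k))) * of_real (bessel_quotient (p + q) k)"
    unfolding conv_coeff_def i c_def[symmetric] by simp
  also have "\<dots> = (\<integral>y. indicator (cball 0 a) y *\<^sub>R (conj_zernike a p q m y * lattice_exp a k y) \<partial>lborel)"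
    unfolding r lattice_exp_def disc_fourier_sums[OF pq a m] s ..
  finally show ?thesis .
qed

theorem theorem4p1:
  fixes a :: real and f1 f2 :: "real \<times> real \<Rightarrow> complex" and m :: int and n :: nat
  assumes "a > 0"
    and "integrable lebesgue f1" and "integrable lebesgue f2"
    and "AE x in lebesgue. x \<notin> cball 0 (a / 2) \<longrightarrow> f1 x = 0"
    and "AE x in lebesgue. x \<notin> cball 0 (a / 2) \<longrightarrow> f2 x = 0"
    and "\<bar>m\<bar> \<le> int n" and "even (int n - \<bar>m\<bar>)"
  shows "lattice_sums (\<lambda>k. conv_coeff a k n m * fourier_hat a f1 k * fourier_hat a f2 k)
           (fz_coeff a n m (conv2 f1 f2))"
proof -
  note a = \<open>a > 0\<close>
  obtain d where d: "int n - \<bar>m\<bar> = 2 * d" using assms(7) by (rule evenE)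
  \<comment> \<open>The aim is \<open>n = p + q\<close> and \<open>|m| = q - p\<close>; evenness
    makes the halving exact, and \<open>d\<close> is nonnegative because
    \<open>|m| <= n\<close>.\<close>
  define p where "p = nat d"
  have p: "int n - \<bar>m\<bar> = 2 * int p" using d assms(6) by (simp add: p_def)
  define q where "q = p + nat \<bar>m\<bar>"
  have pq: "p \<le> q" and m: "nat \<bar>m\<bar> = q - p" and n: "n = p + q" using p by (auto simp: q_def)
  obtain g1 where g1: "integrable lborel g1" "g1 \<in> borel_measurable borel" "AE x in lborel. f1 x = g1 x" "\<And>x. x \<notin> cball 0 (a / 2) \<Longrightarrow> g1 x = 0"
    using borel_version[OF assms(2,4)] by blast
  obtain g2 where g2: "integrable lborel g2" "g2 \<in> borel_measurable borel" "AE x in lborel. f2 x = g2 x" "\<And>x. x \<notin> cball 0 (a / 2) \<Longrightarrow> g2 x = 0"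
    using borel_version[OF assms(3,5)] by blast
  define g where "g = borel_conv g1 g2"
  define W where "W = conj_zernike a p q m"
  have gint: "integrable lborel g" unfolding g_def by (rule integrable_borel_conv[OF g1(1) g2(1)])
  have gm: "g \<in> borel_measurable borel" unfolding g_def by (rule borel_measurable_borel_conv[OF g1(2) g2(2)])
  have goff: "g x = 0" if "x \<notin> cball 0 a" for x unfolding g_def by (rule borel_conv_support[OF g1(4) g2(4) that])
  have "conv2 f1 f2 = g" unfolding g_def by (rule ext) (rule conv2_eq_borel_conv[OF g1(2,3) g2(2,3)])
  then have fz: "fz_coeff a n m (conv2 f1 f2) = (\<integral>x. g x * W x \<partial>lborel)"
    using fz_coeff_eq[OF a gint gm goff pq m] unfolding n W_def by simp
  have W: "bipoly W" unfolding W_def by (rule bipoly_conj_zernike)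
  have a4: "complex_of_real (4 * a\<^sup>2) \<noteq> 0" using a by simp
  have hat: "fourier_hat a f1 k * fourier_hat a f2 k = (\<integral>x. g x * lattice_exp a k (- x) \<partial>lborel)" for k
    using fourier_hat_eq[OF a g1, of k] fourier_hat_eq[OF a g2, of k]
    unfolding g_def borel_conv_transform[OF g1(1) g2(1)] by simp
  define c where "c k = (\<integral>y. indicator (cball 0 a) y *\<^sub>R (W y * lattice_exp a k y) \<partial>lborel)" for k
  have coeff: "conv_coeff a k n m = c k / of_real (4 * a\<^sup>2)" for k
    using conv_coeff_eq[OF a pq m, of k] a4 unfolding n c_def W_def by (simp only: nonzero_eq_divide_eq[OF a4] mult.commute)
  have sum: "(\<Sum>k\<in>{- int M..int M} \<times> {- int N..int N}. conv_coeff a k n m * fourier_hat a f1 k * fourier_hat a f2 k)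
    = (\<integral>x. g x * partial_sum_integral a W M N x \<partial>lborel) / of_real (4 * a\<^sup>2)" for M N
  proof -
    let ?R = "{- int M..int M} \<times> {- int N..int N}"
    have "(\<integral>x. g x * partial_sum_integral a W M N x \<partial>lborel) = (\<integral>x. (\<Sum>k\<in>?R. c k * (g x * lattice_exp a k (- x))) \<partial>lborel)"
      unfolding partial_sum_integral_eq[OF W] c_def sum_distrib_left by (simp only: mult.left_commute)
    also have "\<dots> = (\<Sum>k\<in>?R. c k * (\<integral>x. g x * lattice_exp a k (- x) \<partial>lborel))"
      by (rule integral_sum_mult(2)) (rule integrable_mult_lattice_exp[OF gint])
    finally have eq: "(\<integral>x. g x * partial_sum_integral a W M N x \<partial>lborel)
      = (\<Sum>k\<in>?R. c k * (\<integral>x. g x * lattice_exp a k (- x) \<partial>lborel))" .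
    show ?thesis unfolding eq sum_divide_distrib
      by (intro sum.cong refl) (simp only: coeff mult.assoc hat times_divide_eq_left)
  qed
  have "((\<lambda>(M, N). \<integral>x. g x * partial_sum_integral a W M N x \<partial>lborel) \<longlongrightarrow> of_real (4 * a\<^sup>2) * (\<integral>x. g x * W x \<partial>lborel))
    (sequentially \<times>\<^sub>F sequentially)"
    by (rule partial_sum_weak_limit[OF a W gint goff])
  then have "((\<lambda>z. (case z of (M, N) \<Rightarrow> \<integral>x. g x * partial_sum_integral a W M N x \<partial>lborel) / of_real (4 * a\<^sup>2))
     \<longlongrightarrow> of_real (4 * a\<^sup>2) * (\<integral>x. g x * W x \<partial>lborel) / of_real (4 * a\<^sup>2)) (sequentially \<times>\<^sub>F sequentially)"
    by (intro tendsto_divide tendsto_const a4)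
  then show ?thesis
    unfolding lattice_sums_def fz sum using a4 by (simp add: split_beta')
qed

end
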